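(* Let $W$ and $W'$ be non-trivial subspaces of $V$ (i.e. different from $0$ and $V$). Then the vertices $y_W$ and $y_{W'}$ in $X_\infty$ can be connected by a geodesic in $X$ if and only if $W\oplus W'=V$.
   Context: $K$ is a finite extension of $\mathbb{Q}_p$ with valuation ring $R$ and prime element $\pi$; $V$ is an $n$-dimensional $K$-vector space. A lattice in $V$ is an $R$-submodule generated by a $K$-basis of $V$; $\{M\}$ denotes the class of $M$ up to multiplication by $K^\times$. $X$ is the Bruhat-Tits building of $G=PGL(V)$. Its vertices are the classes $\{M\}$ of lattices in $V$. Two different classes are adjacent if they have representatives $M,N$ with $\pi N\subset M\subset N$; simplices are the sets of pairwise adjacent classes, and $X$ is the geometric realization. For a basis $w_1,\dots,w_n$ of $V$, the vertices $\{\sum_i\pi^{k_i}Rw_i\}$, $k_i\in\mathbb{Z}$, span an apartment, identified with $\mathbb{R}^n/\mathbb{R}(1,\dots,1)$ by sending $\{\sum_i\pi^{k_i}Rw_i\}$ to the class of $(-k_1,\dots,-k_n)$. $X$ carries the $G$-invariant metric $d$ which on each apartment is the Euclidean metric of a fixed $S_n$-invariant scalar product. A geodesic (half-geodesic) is an isometric map $\mathbb{R}\to X$ (resp. $\mathbb{R}_{\ge0}\to X$) with respect to $d$. $X_\infty$ is the boundary of $X$ in the Borel-Serre compactification; its points are the classes of half-geodesics modulo being at bounded distance, and it is the geometric realization of the Tits building of $G$ (the flag complex of $V$). For a subspace $0\ne W\subsetneq V$, $y_W\in X_\infty$ is the corresponding vertex, i.e. the unique boundary point whose stabilizer in $G$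 is the stabilizer of $W$. A geodesic $\gamma$ connects $y$ and $y'$ in $X_\infty$ if $\gamma(t)$ converges to one of them as $t\to\infty$ and to the other as $t\to-\infty$. *)

theory Defs
  imports "HOL-Analysis.Analysis" "HOL-Computational_Algebra.Computational_Algebra"
begin

text \<open>
  The type \<open>'k\<close> is the field \<open>K\<close>, given with its absolute value; \<open>Qp\<close> is the subfield
  \<open>\<rat>\<^sub>p\<close>, characterised as a completion of \<open>\<rat>\<close> for the \<open>p\<close>-adic absolute value. The
  absolute value of \<open>\<rat>\<^sub>p\<close> extends uniquely to \<open>K\<close>, so that \<open>absv\<close> is no additional choice.
\<close>

locale padic_field =
  fixes p :: nat and Qp :: "'k::field_char_0 set" and absv :: "'k \<Rightarrow> real"
  assumes prime_p: "prime p"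
    and absv_nonneg: "absv x \<ge> 0"
    and absv_eq_0_iff: "absv x = 0 \<longleftrightarrow> x = 0"
    and absv_mult: "absv (x * y) = absv x * absv y"
    and absv_ultrametric: "absv (x + y) \<le> max (absv x) (absv y)"
    and absv_padic: "m \<noteq> 0 \<Longrightarrow> absv (of_int m) = (1 / real p) ^ multiplicity (int p) m"
    and Qp_one: "1 \<in> Qp"
    and Qp_diff: "\<lbrakk>x \<in> Qp; y \<in> Qp\<rbrakk> \<Longrightarrow> x - y \<in> Qp"
    and Qp_mult: "\<lbrakk>x \<in> Qp; y \<in> Qp\<rbrakk> \<Longrightarrow> x * y \<in> Qp"
    and Qp_inverse: "x \<in> Qp \<Longrightarrow> inverse x \<in> Qp"
    and Qp_dense: "\<lbrakk>x \<in> Qp; e > 0\<rbrakk> \<Longrightarrow> \<exists>q. absv (x - of_rat q) < e"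
    and Qp_complete:
      "\<lbrakk>\<And>j. s j \<in> Qp; \<And>e. e > 0 \<Longrightarrow> \<exists>N::nat. \<forall>i\<ge>N. \<forall>j\<ge>N. absv (s i - s j) < e\<rbrakk>
        \<Longrightarrow> \<exists>l\<in>Qp. (\<lambda>j. absv (s j - l)) \<longlonglongrightarrow> 0"
    and finite_extension:
      "\<exists>B. finite B \<and> (\<forall>x. \<exists>c. (\<forall>b\<in>B. c b \<in> Qp) \<and> x = (\<Sum>b\<in>B. c b * b))"
begin

definition valuation_ring :: "'k set" where
  "valuation_ring = {x. absv x \<le> 1}"

definition maximal_ideal :: "'k set" where
  "maximal_ideal = {x. absv x < 1}"

end

locale bruhat_tits_building =
  padic_field p Qp absv + vector_space scale
  for p :: nat and Qp :: "'k::field_char_0 set" and absv :: "'k \<Rightarrow> real"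
    and scale :: "'k \<Rightarrow> 'v::ab_group_add \<Rightarrow> 'v" (infixr \<open>*s\<close> 75) +
  fixes \<pi> :: 'k and n :: nat
  assumes prime_element: "maximal_ideal = (\<lambda>r. \<pi> * r) ` valuation_ring"
    and finite_dim: "\<exists>B. finite B \<and> span B = (UNIV :: 'v set)"
    and dim_n: "dim (UNIV :: 'v set) = n"
begin

definition is_basis :: "(nat \<Rightarrow> 'v) \<Rightarrow> bool" where
  "is_basis w \<longleftrightarrow> inj_on w {..<n} \<and> independent (w ` {..<n}) \<and> span (w ` {..<n}) = UNIV"

definition lattice_of :: "(nat \<Rightarrow> 'v) \<Rightarrow> 'v set" where
  "lattice_of w = {\<Sum>i<n. a i *s w i | a. \<forall>i<n. a i \<in> valuation_ring}"

definition is_lattice :: "'v set \<Rightarrow> bool" where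
  "is_lattice M \<longleftrightarrow> (\<exists>w. is_basis w \<and> M = lattice_of w)"

definition lattice_class :: "'v set \<Rightarrow> 'v set set" where
  "lattice_class M = {scale c ` M | c. c \<noteq> 0}"

definition vertices :: "'v set set set" where
  "vertices = {lattice_class M | M. is_lattice M}"

definition adjacent :: "'v set set \<Rightarrow> 'v set set \<Rightarrow> bool" where
  "adjacent v v' \<longleftrightarrow> v \<noteq> v' \<and> (\<exists>M\<in>v. \<exists>N\<in>v'. scale \<pi> ` N \<subseteq> M \<and> M \<subseteq> N)"

definition is_simplex :: "'v set set set \<Rightarrow> bool" where
  "is_simplex S \<longleftrightarrow> finite S \<and> S \<noteq> {} \<and> S \<subseteq> vertices \<and>
     (\<forall>v\<in>S. \<forall>v'\<in>S. v \<noteq> v' \<longrightarrow> adjacent v v')"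

text \<open>Points of the geometric realization are given by their barycentric coordinates.\<close>

definition building :: "('v set set \<Rightarrow> real) set" where
  "building = {x. \<exists>S. is_simplex S \<and> (\<forall>v. v \<notin> S \<longrightarrow> x v = 0) \<and> (\<forall>v\<in>S. x v \<ge> 0) \<and> sum x S = 1}"

definition apartment_vertex :: "(nat \<Rightarrow> 'v) \<Rightarrow> (nat \<Rightarrow> int) \<Rightarrow> 'v set set" where
  "apartment_vertex w k = lattice_class (lattice_of (\<lambda>i. (\<pi> powi k i) *s w i))"

definition apartment :: "(nat \<Rightarrow> 'v) \<Rightarrow> ('v set set \<Rightarrow> real) set" where
  "apartment w = {x \<in> building. \<forall>v. x v \<noteq> 0 \<longrightarrow> v \<in> range (apartment_vertex w)}"

text \<open>
  Elements of \<open>\<real>\<^sup>n / \<real>(1,\<dots>,1)\<close> are represented by functions \<open>nat \<Rightarrow> real\<close>, of which only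
  the values at \<open>i < n\<close>, up to a common additive constant, are relevant. The exponents of an
  apartment vertex are determined only up to such a constant, so \<open>vertex_coords\<close> picks one
  representative; \<open>chart\<close> is the extension that is affine on simplices.
\<close>

definition vertex_coords :: "(nat \<Rightarrow> 'v) \<Rightarrow> 'v set set \<Rightarrow> nat \<Rightarrow> real" where
  "vertex_coords w v = (SOME a. \<exists>k. v = apartment_vertex w k \<and> a = (\<lambda>i. - real_of_int (k i)))"

definition chart :: "(nat \<Rightarrow> 'v) \<Rightarrow> ('v set set \<Rightarrow> real) \<Rightarrow> nat \<Rightarrow> real" where
  "chart w x = (\<lambda>i. \<Sum>v | x v \<noteq> 0. x v * vertex_coords w v i)"

definition GL :: "('v \<Rightarrow> 'v) set" where
  "GL = {g. Vector_Spaces.linear scale scale g \<and> bij g}"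

text \<open>The image of \<open>g\<close> in \<open>PGL(V)\<close>. Scalars act trivially on all objects considered below.\<close>

definition proj_class :: "('v \<Rightarrow> 'v) \<Rightarrow> ('v \<Rightarrow> 'v) set" where
  "proj_class g = {\<lambda>v. c *s g v | c. c \<noteq> 0}"

definition act_vertex :: "('v \<Rightarrow> 'v) \<Rightarrow> 'v set set \<Rightarrow> 'v set set" where
  "act_vertex g v = (\<lambda>M. g ` M) ` v"

definition act_point :: "('v \<Rightarrow> 'v) \<Rightarrow> ('v set set \<Rightarrow> real) \<Rightarrow> 'v set set \<Rightarrow> real" where
  "act_point g x = (\<lambda>v. x (act_vertex (inv g) v))"

definition stabilizer_subspace :: "'v set \<Rightarrow> ('v \<Rightarrow> 'v) set set" where
  "stabilizer_subspace W = {proj_class g | g. g \<in> GL \<and> g ` W = W}"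

end

text \<open>
  A scalar product on \<open>\<real>\<^sup>n / \<real>(1,\<dots>,1)\<close> invariant under permutations of the coordinates,
  given as a bilinear form on representatives.
\<close>

definition invariant_scalar_product :: "nat \<Rightarrow> ((nat \<Rightarrow> real) \<Rightarrow> (nat \<Rightarrow> real) \<Rightarrow> real) \<Rightarrow> bool" where
  "invariant_scalar_product n ip \<longleftrightarrow>
     (\<forall>a a' b. (\<exists>c. \<forall>i<n. a' i = a i + c) \<longrightarrow> ip a' b = ip a b) \<and>
     (\<forall>a b. ip a b = ip b a) \<and>
     (\<forall>r s a a' b. ip (\<lambda>i. r * a i + s * a' i) b = r * ip a b + s * ip a' b) \<and>
     (\<forall>a. (\<nexists>c. \<forall>i<n. a i = c) \<longrightarrow> ip a a > 0) \<and>
     (\<forall>\<sigma> a b. \<sigma> permutes {..<n} \<longrightarrow> ip (a \<circ> \<sigma>) (b \<circ> \<sigma>) = ip a b)"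

text \<open>
  Any two points of the building lie in a common apartment, so \<open>d_apartment\<close> determines \<open>d\<close>
  on the building; the values of \<open>d\<close> elsewhere are irrelevant.
\<close>

locale metric_bruhat_tits_building =
  bruhat_tits_building p Qp absv scale \<pi> n
  for p :: nat and Qp :: "'k::field_char_0 set" and absv :: "'k \<Rightarrow> real"
    and scale :: "'k \<Rightarrow> 'v::ab_group_add \<Rightarrow> 'v" (infixr \<open>*s\<close> 75)
    and \<pi> :: 'k and n :: nat +
  fixes ip :: "(nat \<Rightarrow> real) \<Rightarrow> (nat \<Rightarrow> real) \<Rightarrow> real"
    and d :: "('v set set \<Rightarrow> real) \<Rightarrow> ('v set set \<Rightarrow> real) \<Rightarrow> real"
  assumes scalar_product: "invariant_scalar_product n ip"
    and metric: "Metric_space building d"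
    and d_invariant:
      "\<lbrakk>g \<in> GL; x \<in> building; y \<in> building\<rbrakk> \<Longrightarrow> d (act_point g x) (act_point g y) = d x y"
    and d_apartment:
      "\<lbrakk>is_basis w; x \<in> apartment w; y \<in> apartment w\<rbrakk> \<Longrightarrow>
        d x y = sqrt (ip (\<lambda>i. chart w x i - chart w y i) (\<lambda>i. chart w x i - chart w y i))"
begin

definition is_geodesic :: "(real \<Rightarrow> 'v set set \<Rightarrow> real) \<Rightarrow> bool" where
  "is_geodesic \<gamma> \<longleftrightarrow> (\<forall>t. \<gamma> t \<in> building) \<and> (\<forall>s t. d (\<gamma> s) (\<gamma> t) = \<bar>s - t\<bar>)"

text \<open>Half-geodesics are total functions whose values at negative arguments are irrelevant.\<close>

definition is_half_geodesic :: "(real \<Rightarrow> 'v set set \<Rightarrow> real) \<Rightarrow> bool" where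
  "is_half_geodesic \<rho> \<longleftrightarrow>
     (\<forall>t\<ge>0. \<rho> t \<in> building) \<and> (\<forall>s\<ge>0. \<forall>t\<ge>0. d (\<rho> s) (\<rho> t) = \<bar>s - t\<bar>)"

definition is_segment ::
    "(real \<Rightarrow> 'v set set \<Rightarrow> real) \<Rightarrow> ('v set set \<Rightarrow> real) \<Rightarrow> ('v set set \<Rightarrow> real) \<Rightarrow> bool" where
  "is_segment c x y \<longleftrightarrow> c 0 = x \<and> c (d x y) = y \<and> (\<forall>t\<in>{0..d x y}. c t \<in> building) \<and>
     (\<forall>s\<in>{0..d x y}. \<forall>t\<in>{0..d x y}. d (c s) (c t) = \<bar>s - t\<bar>)"

definition boundary_class ::
    "(real \<Rightarrow> 'v set set \<Rightarrow> real) \<Rightarrow> (real \<Rightarrow> 'v set set \<Rightarrow> real) set" where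
  "boundary_class \<rho> = {\<sigma>. is_half_geodesic \<sigma> \<and> (\<exists>C. \<forall>t\<ge>0. d (\<rho> t) (\<sigma> t) \<le> C)}"

definition boundary :: "(real \<Rightarrow> 'v set set \<Rightarrow> real) set set" where
  "boundary = {boundary_class \<rho> | \<rho>. is_half_geodesic \<rho>}"

text \<open>
  The compactification is the disjoint union of \<open>building\<close> and \<open>boundary\<close> with the cone
  topology: it is generated by the open balls of the building and the sets
  \<open>cone_nbhd \<rho> r \<epsilon>\<close> of those \<open>z\<close> for which the geodesic from \<open>\<rho> 0\<close> to \<open>z\<close> is defined
  beyond \<open>r\<close> and at \<open>r\<close> is at distance less than \<open>\<epsilon>\<close> from \<open>\<rho> r\<close>. On a building this
  is the topology of the Borel-Serre compactification.
\<close>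

definition cone_nbhd ::
    "(real \<Rightarrow> 'v set set \<Rightarrow> real) \<Rightarrow> real \<Rightarrow> real \<Rightarrow>
     (('v set set \<Rightarrow> real) + (real \<Rightarrow> 'v set set \<Rightarrow> real) set) set" where
  "cone_nbhd \<rho> r \<epsilon> =
     Inl ` {x \<in> building. d (\<rho> 0) x > r \<and> (\<exists>c. is_segment c (\<rho> 0) x \<and> d (c r) (\<rho> r) < \<epsilon>)} \<union>
     Inr ` {y \<in> boundary. \<exists>\<sigma>\<in>y. \<sigma> 0 = \<rho> 0 \<and> d (\<sigma> r) (\<rho> r) < \<epsilon>}"

definition compactification ::
    "(('v set set \<Rightarrow> real) + (real \<Rightarrow> 'v set set \<Rightarrow> real) set) topology" where
  "compactification = topology_generated_by
     ({Inl ` Metric_space.mball building d x \<epsilon> | x \<epsilon>. x \<in> building \<and> \<epsilon> > 0} \<union>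
      {cone_nbhd \<rho> r \<epsilon> | \<rho> r \<epsilon>. is_half_geodesic \<rho> \<and> r > 0 \<and> \<epsilon> > 0})"

definition act_boundary ::
    "('v \<Rightarrow> 'v) \<Rightarrow> (real \<Rightarrow> 'v set set \<Rightarrow> real) set \<Rightarrow> (real \<Rightarrow> 'v set set \<Rightarrow> real) set" where
  "act_boundary g y = (\<lambda>\<rho> t. act_point g (\<rho> t)) ` y"

definition stabilizer_boundary ::
    "(real \<Rightarrow> 'v set set \<Rightarrow> real) set \<Rightarrow> ('v \<Rightarrow> 'v) set set" where
  "stabilizer_boundary y = {proj_class g | g. g \<in> GL \<and> act_boundary g y = y}"

definition boundary_vertex :: "'v set \<Rightarrow> (real \<Rightarrow> 'v set set \<Rightarrow> real) set" where
  "boundary_vertex W = (THE y. y \<in> boundary \<and> stabilizer_boundary y = stabilizer_subspace W)"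

definition connects ::
    "(real \<Rightarrow> 'v set set \<Rightarrow> real) \<Rightarrow> (real \<Rightarrow> 'v set set \<Rightarrow> real) set \<Rightarrow>
     (real \<Rightarrow> 'v set set \<Rightarrow> real) set \<Rightarrow> bool" where
  "connects \<gamma> y y' \<longleftrightarrow>
     (limitin compactification (\<lambda>t. Inl (\<gamma> t)) (Inr y) at_top \<and>
      limitin compactification (\<lambda>t. Inl (\<gamma> t)) (Inr y') at_bot) \<or>
     (limitin compactification (\<lambda>t. Inl (\<gamma> t)) (Inr y') at_top \<and>
      limitin compactification (\<lambda>t. Inl (\<gamma> t)) (Inr y) at_bot)"

definition connectable ::
    "(real \<Rightarrow> 'v set set \<Rightarrow> real) set \<Rightarrow> (real \<Rightarrow> 'v set set \<Rightarrow> real) set \<Rightarrow> bool" where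
  "connectable y y' \<longleftrightarrow> (\<exists>\<gamma>. is_geodesic \<gamma> \<and> connects \<gamma> y y')"

end

end

theory Submission
  imports Defs
begin

text \<open>
  Why the theorem holds. A point of the building is a norm on \<open>V\<close> up to a constant factor: a vertex
  is the norm whose unit ball is the lattice, and barycentric coordinates form weighted geometric
  means (\<open>pnorm\<close>). A point lies in the apartment of a basis iff the basis is orthogonal for its norm
  (\<open>apartment_adapted\<close>, \<open>adapted_apartment\<close>), and the chart records the logarithms of the norms of
  the basis vectors (\<open>chart_pnorm\<close>). Two norms have a common orthogonal basis
  (\<open>common_orthogonal_set\<close>), hence two points have a common apartment.

  The metric satisfies the inequality of Bruhat and Tits (\<open>bruhat_tits_inequality\<close>). It holds with
  equality in Euclidean space, and it passes to the building because the retraction onto an apartment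
  keeps the distance from its centre and does not increase other distances of points from the
  apartment (\<open>retraction\<close>). The latter says that the relative position of two norms majorizes a
  vector read off from the retracted points; it follows by expanding principal minors of a transition
  matrix (\<open>relative_position_majorizes\<close>). Consequently geodesics with a common end point are at least
  as close as in the plane (\<open>thales\<close>), and a geodesic converges to a boundary point in the cone
  topology iff it belongs to that class of half-geodesics (\<open>limit_in_compactification\<close>).

  Let \<open>W\<close> be spanned by the part \<open>w ` I\<close> of a basis \<open>w\<close>. The ray in the apartment of \<open>w\<close> that
  enlarges the unit balls along \<open>W\<close> and keeps them fixed along the other basis vectors has a
  class whose stabilizer is that of \<open>W\<close> (\<open>stabilizer_boundary_ray\<close>). It is the only such class:
  invariance under finitely many elementary maps stabilizing \<open>W\<close> forces a half-geodesic to stay near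
  this ray (\<open>boundary_class_determined\<close>). So \<open>y\<^sub>W\<close> is the class of the ray, whatever the
  choice of \<open>w\<close>.

  Given \<open>W\<close> and \<open>W'\<close>, choose a basis that contains bases of both, with index sets \<open>I\<close> and \<open>I'\<close>. The
  two rays start from one point of a Euclidean apartment in the directions of the classes of \<open>1\<^sub>I\<close> and
  \<open>1\<^sub>I\<^sub>'\<close> modulo \<open>(1, \<dots>, 1)\<close>. A geodesic that connects \<open>y\<^sub>W\<close> with \<open>y\<^sub>W\<^sub>'\<close> stays near the two rays, so
  their distance grows like \<open>2 t\<close> and the directions are opposite. Conversely, opposite rays form a
  geodesic. A sum of positive multiples of \<open>1\<^sub>I\<close> and \<open>1\<^sub>I\<^sub>'\<close> is constant only if \<open>I\<close> and \<open>I'\<close> are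
  complementary, so the directions are opposite iff \<open>V\<close> is the direct sum of \<open>W\<close> and \<open>W'\<close>.
\<close>

(* Otherwise *s would also denote the scalar multiplication of coordinate vectors. *)
no_notation vector_scalar_mult (infixl "*s" 70)

section \<open>Absolute values\<close>

lemma finite_argmax:
  fixes f :: "'a \<Rightarrow> real"
  assumes "finite A" "A \<noteq> {}"
  obtains i where "i \<in> A" "\<And>j. j \<in> A \<Longrightarrow> f j \<le> f i"
proof -
  have "Max (f ` A) \<in> f ` A" using assms by (intro Max_in) auto
  then obtain i where "i \<in> A" "f i = Max (f ` A)" by auto
  moreover have "f j \<le> Max (f ` A)" if "j \<in> A" for j
    using assms that by (intro Max_ge) auto
  ultimately show ?thesis using that[of i] by simp
qed

context padic_field
begin

lemma absv_0 [simp]: "absv 0 = 0"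
  using absv_eq_0_iff by simp

lemma absv_pos: "x \<noteq> 0 \<Longrightarrow> 0 < absv x"
  using absv_nonneg[of x] absv_eq_0_iff[of x] by linarith

lemma absv_1 [simp]: "absv 1 = 1"
  using absv_mult[of 1 1] absv_eq_0_iff[of 1] by simp

lemma absv_minus [simp]: "absv (- x) = absv x"
proof -
  have "absv (- 1) * absv (- 1) = 1"
    using absv_mult[of "- 1" "- 1"] by simp
  hence "absv (- 1) = 1"
    using absv_nonneg[of "- 1"] by (metis abs_of_nonneg real_sqrt_abs2 real_sqrt_one)
  thus ?thesis
    using absv_mult[of "- 1" x] by simp
qed

lemma absv_inverse: "absv (inverse x) = inverse (absv x)"
proof (cases "x = 0")
  case False
  hence "absv x * absv (inverse x) = 1"
    by (metis absv_1 absv_mult right_inverse)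
  thus ?thesis by (metis inverse_unique)
qed simp

lemma absv_divide: "absv (x / y) = absv x / absv y"
  by (simp add: divide_inverse absv_mult absv_inverse)

lemma absv_power: "absv (x ^ k) = absv x ^ k"
  by (induction k) (simp_all add: absv_mult)

lemma absv_powi: "absv (x powi k) = absv x powi k"
  by (simp add: power_int_def absv_power absv_inverse)

lemma absv_prod: "absv (\<Prod>i\<in>A. f i) = (\<Prod>i\<in>A. absv (f i))"
  by (induction A rule: infinite_finite_induct) (simp_all add: absv_mult)

lemma absv_sum_le:
  assumes "finite A" "A \<noteq> {}"
  shows "\<exists>i\<in>A. absv (\<Sum>i\<in>A. f i) \<le> absv (f i)"
  using assms
proof (induction A rule: finite_ne_induct)
  case (insert a A)
  then obtain i where i: "i \<in> A" "absv (\<Sum>i\<in>A. f i) \<le> absv (f i)" by blast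
  have "absv (f a + (\<Sum>i\<in>A. f i)) \<le> max (absv (f a)) (absv (\<Sum>i\<in>A. f i))"
    by (rule absv_ultrametric)
  thus ?case using insert i by (auto simp: max_def split: if_splits intro: order_trans)
qed simp

end

context bruhat_tits_building
begin

text \<open>The generator, larger than \<open>1\<close>, of the value group of \<open>K\<close>.\<close>

definition q :: real where "q = 1 / absv \<pi>"

lemma absv_pi: "0 < absv \<pi>" "absv \<pi> < 1"
proof -
  have p: "prime (int p)" using prime_p by simp
  have "of_int (int p) \<noteq> (0 :: 'k)" using prime_p by (simp add: prime_gt_0_nat)
  hence p0: "(of_nat p :: 'k) \<noteq> 0" by simp
  have "absv (of_int (int p)) = (1 / real p) ^ multiplicity (int p) (int p)"
    using prime_p by (intro absv_padic) (auto simp: prime_gt_0_nat)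
  also have "\<dots> = 1 / real p"
    using p by simp
  finally have "absv (of_nat p) < 1"
    using prime_gt_1_nat[OF prime_p] by simp
  hence "of_nat p \<in> maximal_ideal" by (simp add: maximal_ideal_def)
  then obtain r where "of_nat p = \<pi> * r" using prime_element by auto
  with p0 have "\<pi> \<noteq> 0" by auto
  thus "0 < absv \<pi>" by (rule absv_pos)
  have "\<pi> \<in> (\<lambda>r. \<pi> * r) ` valuation_ring"
    by (rule image_eqI[of _ _ 1]) (auto simp: valuation_ring_def)
  thus "absv \<pi> < 1" using prime_element by (auto simp: maximal_ideal_def)
qed

lemma pi_nz [simp]: "\<pi> \<noteq> 0"
  using absv_pi by auto

lemma q_gt_1: "1 < q"
  using absv_pi by (simp add: q_def)

lemma absv_pi_powi: "absv (\<pi> powi k) = q powi (- k)"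
  by (simp add: q_def absv_powi power_int_minus power_int_divide_distrib inverse_eq_divide)

text \<open>\<open>\<pi>\<close> generates the maximal ideal, so no element has absolute value strictly between
  \<open>1 / q\<close> and \<open>1\<close>; therefore the value group is \<open>q\<^sup>\<int>\<close>.\<close>

lemma value_group:
  assumes "a \<noteq> 0"
  obtains k :: int where "absv a = q powi k"
proof -
  define k where "k = \<lfloor>log q (absv a)\<rfloor>"
  have a: "absv a > 0" using assms by (rule absv_pos)
  have "of_int k \<le> log q (absv a)" "log q (absv a) < of_int (k + 1)"
    unfolding k_def by linarith+
  hence k: "q powi k \<le> absv a" "absv a < q powi (k + 1)"
    using q_gt_1 a by (simp_all add: le_log_iff log_less_iff flip: powr_real_of_int')
  define b where "b = a * \<pi> powi (k + 1)"
  have b: "absv b = absv a / q powi (k + 1)"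
    unfolding b_def absv_mult absv_pi_powi power_int_minus divide_inverse ..
  also have "\<dots> < 1" using k q_gt_1 by simp
  finally have "b \<in> maximal_ideal" by (simp add: maximal_ideal_def)
  then obtain r where r: "b = \<pi> * r" "absv r \<le> 1"
    using prime_element by (auto simp: valuation_ring_def)
  have "absv a / q powi (k + 1) = absv r / q"
    using r b by (simp add: absv_mult q_def mult.commute)
  hence "absv a = q powi k * absv r"
    using q_gt_1 by (simp add: field_simps power_int_add)
  hence "absv a \<le> q powi k"
    using r(2) q_gt_1 by (simp add: mult_left_le)
  with k have "absv a = q powi k" by simp
  thus ?thesis by (rule that)
qed

lemma powi_less_imp_le:
  assumes "q powi k < q powi l"
  shows "q * q powi k \<le> q powi l"
proof -
  have "k + 1 \<le> l" using assms q_gt_1 by (metis linorder_not_less power_int_increasing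
        zle_add1_eq_le add.commute less_imp_le)
  hence "q powi (k + 1) \<le> q powi l" using q_gt_1 by (intro power_int_increasing) auto
  thus ?thesis using q_gt_1 by (simp add: power_int_add mult.commute)
qed

section \<open>Norms and lattices\<close>

definition nonarch_norm :: "('v \<Rightarrow> real) \<Rightarrow> bool" where
  "nonarch_norm N \<longleftrightarrow> (\<forall>v. 0 \<le> N v) \<and> (\<forall>v. N v = 0 \<longleftrightarrow> v = 0) \<and>
     (\<forall>c v. N (c *s v) = absv c * N v) \<and> (\<forall>u v. N (u + v) \<le> max (N u) (N v))"

lemma nonarch_normD:
  assumes "nonarch_norm N"
  shows "0 \<le> N v" "N v = 0 \<longleftrightarrow> v = 0" "N (c *s v) = absv c * N v"
    "N (u + v) \<le> max (N u) (N v)" "v \<noteq> 0 \<Longrightarrow> 0 < N v"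
  using assms by (auto simp: nonarch_norm_def less_le)

lemma nonarch_norm_diff:
  assumes "nonarch_norm N"
  shows "N (u - v) \<le> max (N u) (N v)"
  using nonarch_normD(4)[OF assms, of u "- v"] nonarch_normD(3)[OF assms, of "- 1" v]
  by simp

lemma nonarch_norm_sum_le:
  assumes N: "nonarch_norm N" and "finite A" "0 \<le> C" "\<And>i. i \<in> A \<Longrightarrow> N (f i) \<le> C"
  shows "N (\<Sum>i\<in>A. f i) \<le> C"
  using assms(2,4)
proof (induction A rule: finite_induct)
  case empty
  thus ?case using nonarch_normD(2)[OF N, of 0] assms(3) by simp
next
  case (insert a A)
  have "N (f a + sum f A) \<le> max (N (f a)) (N (sum f A))" by (rule nonarch_normD(4)[OF N])
  also have "\<dots> \<le> C" using insert by simp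
  finally show ?case using insert.hyps by simp
qed

text \<open>A finite set is orthogonal for a norm if the norm of each linear combination is the
  largest norm of its terms; the lower bound says this, as the upper bound always holds.\<close>

definition orthogonal :: "('v \<Rightarrow> real) \<Rightarrow> 'v set \<Rightarrow> bool" where
  "orthogonal N B \<longleftrightarrow> finite B \<and> 0 \<notin> B \<and>
     (\<forall>a. \<forall>b\<in>B. absv (a b) * N b \<le> N (\<Sum>b\<in>B. a b *s b))"

lemma orthogonal_independent:
  assumes "nonarch_norm N" "orthogonal N B"
  shows "independent B"
proof -
  have fin: "finite B" using assms by (simp add: orthogonal_def)
  have "a b = 0" if "(\<Sum>b\<in>B. a b *s b) = 0" "b \<in> B" for a b
  proof -
    have "absv (a b) * N b \<le> N 0"
      using assms(2) that unfolding orthogonal_def by metis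
    moreover have "b \<noteq> 0" using assms(2) that by (auto simp: orthogonal_def)
    hence "N 0 = 0" "N b > 0" using nonarch_normD(2,5)[OF assms(1)] by auto
    ultimately have "absv (a b) \<le> 0" by (simp add: mult_le_0_iff)
    thus ?thesis using absv_nonneg[of "a b"] absv_eq_0_iff by simp
  qed
  thus ?thesis using fin by (auto simp: dependent_finite)
qed

text \<open>A vector \<open>f\<close> that maximises \<open>N0 / N\<close> splits off orthogonally for both norms: a complement
  \<open>H\<close> of the line through \<open>f\<close> that is orthogonal for \<open>N0\<close>, which an orthogonal basis of \<open>N0\<close>
  provides, is by maximality orthogonal for \<open>N\<close> as well.\<close>

lemma common_orthogonal_set:
  assumes N0: "nonarch_norm N0" and N: "nonarch_norm N"
    and fin: "finite ((\<lambda>v. N0 v / N v) ` (- {0}))"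
    and "orthogonal N0 B"
  shows "\<exists>B'. orthogonal N0 B' \<and> orthogonal N B' \<and> span B' = span B"
  using assms(4)
proof (induction "card B" arbitrary: B)
  case 0
  hence "B = {}" by (simp add: orthogonal_def)
  thus ?case by (intro exI[of _ "{}"]) (auto simp: orthogonal_def)
next
  case (Suc k)
  have finB: "finite B" and B0: "0 \<notin> B" using Suc.prems by (auto simp: orthogonal_def)
  have oB: "absv (a b) * N0 b \<le> N0 (\<Sum>b\<in>B. a b *s b)" if "b \<in> B" for a b
    using Suc.prems that by (auto simp: orthogonal_def)
  have "B \<noteq> {}" using Suc.hyps by auto
  then obtain b0 where b0: "b0 \<in> B" by blast
  let ?R = "(\<lambda>v. N0 v / N v) ` (span B - {0})"
  have finR: "finite ?R" by (rule finite_subset[OF _ fin]) auto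
  have "b0 \<in> span B - {0}" using b0 B0 by (auto intro: span_base)
  hence neR: "?R \<noteq> {}" by blast
  obtain f where f: "f \<in> span B" "f \<noteq> 0"
    and fmax: "\<And>v. v \<in> span B \<Longrightarrow> v \<noteq> 0 \<Longrightarrow> N0 v / N v \<le> N0 f / N f"
  proof -
    have "Max ?R \<in> ?R" using finR neR by (rule Max_in)
    then obtain f where "f \<in> span B - {0}" "N0 f / N f = Max ?R" by (metis (no_types, lifting) imageE)
    moreover have "N0 v / N v \<le> Max ?R" if "v \<in> span B" "v \<noteq> 0" for v
      using finR that by (intro Max_ge) auto
    ultimately show ?thesis using that[of f] by simp
  qed
  obtain \<beta> where \<beta>: "f = (\<Sum>b\<in>B. \<beta> b *s b)"
    using f(1) by (auto simp: span_finite[OF finB])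
  obtain j where j: "j \<in> B" and jmax: "\<And>b. b \<in> B \<Longrightarrow> absv (\<beta> b) * N0 b \<le> absv (\<beta> j) * N0 j"
    using finite_argmax[of B "\<lambda>b. absv (\<beta> b) * N0 b"] finB b0 by blast
  have Nf: "N0 f \<le> absv (\<beta> j) * N0 j"
    unfolding \<beta> using finB jmax absv_nonneg nonarch_normD(1)[OF N0]
    by (intro nonarch_norm_sum_le[OF N0]) (auto simp: nonarch_normD(3)[OF N0])
  have f0: "N0 f > 0" "N f > 0" using f(2) nonarch_normD(5) N0 N by auto
  have \<beta>j: "\<beta> j \<noteq> 0" using Nf f0 by auto
  let ?C = "B - {j}"
  have finC: "finite ?C" using finB by simp
  have sumB: "(\<Sum>b\<in>B. a b *s b) = a j *s j + (\<Sum>b\<in>?C. a b *s b)" for a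
    using finB j by (simp add: sum.remove)
  have "orthogonal N0 ?C"
    unfolding orthogonal_def
  proof (intro conjI allI ballI)
    fix a b assume b: "b \<in> ?C"
    have "absv ((a(j := 0)) b) * N0 b \<le> N0 (\<Sum>b\<in>B. (a(j := 0)) b *s b)"
      using b by (intro oB) auto
    moreover have "(\<Sum>b\<in>?C. (a(j := 0)) b *s b) = (\<Sum>b\<in>?C. a b *s b)"
      by (intro sum.cong) auto
    ultimately show "absv (a b) * N0 b \<le> N0 (\<Sum>b\<in>?C. a b *s b)"
      using b by (simp add: sumB)
  qed (use finB B0 in auto)
  moreover have "k = card ?C" using Suc.hyps(2) j finB by simp
  ultimately obtain B'' where B'': "orthogonal N0 B''" "orthogonal N B''" "span B'' = span ?C"
    using Suc.hyps(1) by blast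
  have N0split: "absv \<alpha> * N0 f \<le> N0 (\<alpha> *s f + h)" if "h \<in> span ?C" for \<alpha> h
  proof -
    obtain \<eta> where \<eta>: "h = (\<Sum>b\<in>?C. \<eta> b *s b)"
      using \<open>h \<in> span ?C\<close> by (auto simp: span_finite[OF finC])
    let ?a = "\<lambda>b. \<alpha> * \<beta> b + (if b = j then 0 else \<eta> b)"
    have "(\<Sum>b\<in>?C. ?a b *s b) = (\<Sum>b\<in>?C. (\<alpha> * \<beta> b) *s b + \<eta> b *s b)"
      by (intro sum.cong) (auto simp: scale_left_distrib)
    hence "(\<Sum>b\<in>B. ?a b *s b) = \<alpha> *s f + h"
      by (simp add: sumB \<beta> \<eta> sum.distrib scale_right_distrib scale_sum_right)
    moreover have "absv (?a j) * N0 j \<le> N0 (\<Sum>b\<in>B. ?a b *s b)" using j by (rule oB)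
    moreover have "absv \<alpha> * N0 f \<le> absv \<alpha> * (absv (\<beta> j) * N0 j)"
      using Nf absv_nonneg by (rule mult_left_mono)
    ultimately show ?thesis by (simp add: absv_mult mult.assoc)
  qed
  have Nsplit: "absv \<alpha> * N f \<le> N (\<alpha> *s f + h)" if h: "h \<in> span ?C" for \<alpha> h
  proof (cases "\<alpha> *s f + h = 0")
    case True
    hence "absv \<alpha> * N0 f \<le> 0"
      using N0split[OF h, of \<alpha>] nonarch_normD(2)[OF N0, of 0] by simp
    hence "absv \<alpha> = 0" using f0 absv_nonneg[of \<alpha>] by (simp add: mult_le_0_iff)
    thus ?thesis using nonarch_normD(1)[OF N] by simp
  next
    case False
    let ?v = "\<alpha> *s f + h"
    have v0: "N ?v > 0" using False nonarch_normD(5)[OF N] by auto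
    have "h \<in> span B" using h span_mono[of ?C B] by auto
    hence "?v \<in> span B" using f(1) by (intro span_add span_scale)
    hence "N0 ?v / N ?v \<le> N0 f / N f" using False by (intro fmax) auto
    hence "N0 ?v * N f \<le> N0 f * N ?v" using v0 f0 by (simp add: field_simps)
    moreover have "absv \<alpha> * N0 f * N f \<le> N0 ?v * N f"
      using N0split[OF h] f0 by (intro mult_right_mono) auto
    ultimately have "N0 f * (absv \<alpha> * N f) \<le> N0 f * N ?v" by (simp add: mult_ac)
    thus ?thesis using f0 by simp
  qed
  have ext: "orthogonal M (insert f B'')"
    if M: "nonarch_norm M" and o: "orthogonal M B''"
      and split: "\<And>\<alpha> h. h \<in> span ?C \<Longrightarrow> absv \<alpha> * M f \<le> M (\<alpha> *s f + h)" for M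
  proof -
    have finB'': "finite B''" using o by (simp add: orthogonal_def)
    have fnot: "f \<notin> B''"
    proof
      assume "f \<in> B''"
      hence "f \<in> span ?C" using B''(3) span_base by auto
      hence "- f \<in> span ?C" by (rule span_neg)
      from N0split[OF this, of 1] f0 nonarch_normD(2)[OF N0, of 0] show False by simp
    qed
    have "absv (a b) * M b \<le> M (\<Sum>b\<in>insert f B''. a b *s b)" if "b \<in> insert f B''" for a b
    proof -
      let ?h = "\<Sum>b\<in>B''. a b *s b"
      have h: "?h \<in> span ?C" unfolding B''(3)[symmetric]
        by (intro span_sum span_scale span_base)
      have eq: "(\<Sum>b\<in>insert f B''. a b *s b) = a f *s f + ?h"
        using finB'' fnot by simp
      have 1: "absv (a f) * M f \<le> M (a f *s f + ?h)" by (rule split[OF h])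
      have "M ?h \<le> max (M (a f *s f + ?h)) (M (a f *s f))"
        using nonarch_norm_diff[OF M, of "a f *s f + ?h" "a f *s f"] by simp
      also have "\<dots> = M (a f *s f + ?h)"
        using 1 nonarch_normD(3)[OF M] by (simp add: max_def)
      finally have 2: "M ?h \<le> M (a f *s f + ?h)" .
      show ?thesis
      proof (cases "b = f")
        case False
        hence "absv (a b) * M b \<le> M ?h" using o that by (auto simp: orthogonal_def)
        thus ?thesis using 2 eq by simp
      qed (use 1 eq in simp)
    qed
    thus ?thesis using finB'' f(2) o by (auto simp: orthogonal_def)
  qed
  have "span (insert f B'') = span B"
  proof (rule subset_antisym)
    have "B'' \<subseteq> span B" using span_superset[of B''] B''(3) span_mono[of ?C B] by auto
    thus "span (insert f B'') \<subseteq> span B" using f(1) by (intro span_minimal) auto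
    have C: "span ?C \<subseteq> span (insert f B'')"
      unfolding B''(3)[symmetric] by (intro span_mono) auto
    have "j = inverse (\<beta> j) *s (f - (\<Sum>b\<in>?C. \<beta> b *s b))"
      using \<beta>j by (simp add: \<beta> sumB)
    moreover have "(\<Sum>b\<in>?C. \<beta> b *s b) \<in> span ?C"
      by (intro span_sum span_scale span_base)
    hence "(\<Sum>b\<in>?C. \<beta> b *s b) \<in> span (insert f B'')" using C by blast
    hence "f - (\<Sum>b\<in>?C. \<beta> b *s b) \<in> span (insert f B'')"
      by (rule span_diff[OF span_base, rotated]) simp
    ultimately have "j \<in> span (insert f B'')" by (metis span_scale)
    hence "B \<subseteq> span (insert f B'')" using C span_superset[of ?C] by auto
    thus "span B \<subseteq> span (insert f B'')" by (intro span_minimal) auto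
  qed
  thus ?case using ext[OF N0 B''(1) N0split] ext[OF N B''(2) Nsplit] by blast
qed

subsection \<open>Bases\<close>

lemma basis_nz: "is_basis w \<Longrightarrow> i < n \<Longrightarrow> w i \<noteq> 0"
  unfolding is_basis_def using dependent_zero[of "w ` {..<n}"] by auto

lemma basis_sum_image:
  assumes "is_basis w"
  shows "(\<Sum>b\<in>w ` {..<n}. f b) = (\<Sum>i<n. f (w i))"
  using assms by (simp add: is_basis_def sum.reindex)

lemma basis_coeffs:
  assumes "is_basis w"
  obtains a where "v = (\<Sum>i<n. a i *s w i)"
proof -
  have "v \<in> span (w ` {..<n})" using assms by (simp add: is_basis_def)
  then obtain a where "v = (\<Sum>b\<in>w ` {..<n}. a b *s b)"
    by (auto simp: span_finite)
  thus ?thesis using that[of "a \<circ> w"] by (simp add: basis_sum_image[OF assms])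
qed

lemma basis_coeffs_unique:
  assumes "is_basis w" "(\<Sum>i<n. a i *s w i) = (\<Sum>i<n. b i *s w i)" "i < n"
  shows "a i = b i"
proof -
  define c where "c = (\<lambda>v. a (inv_into {..<n} w v) - b (inv_into {..<n} w v))"
  have inj: "inj_on w {..<n}" using assms(1) by (simp add: is_basis_def)
  have "(\<Sum>v\<in>w ` {..<n}. c v *s v) = (\<Sum>i<n. c (w i) *s w i)"
    by (rule basis_sum_image[OF assms(1)])
  also have "\<dots> = (\<Sum>i<n. a i *s w i - b i *s w i)"
    by (intro sum.cong) (simp_all add: c_def inv_into_f_f[OF inj] scale_left_diff_distrib)
  also have "\<dots> = 0" using assms(2) by (simp add: sum_subtractf)
  finally have "c (w i) = 0"
    using assms independentD[of "w ` {..<n}" "w ` {..<n}" c "w i"] by (auto simp: is_basis_def)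
  thus ?thesis using inv_into_f_f[OF inj] assms(3) by (simp add: c_def)
qed

lemma basis_scale:
  assumes "is_basis w" "\<And>i. i < n \<Longrightarrow> c i \<noteq> 0"
  shows "is_basis (\<lambda>i. c i *s w i)"
proof -
  let ?w = "\<lambda>i. c i *s w i"
  have ne: "i = j" if "i < n" "j < n" "?w i = ?w j" for i j
  proof (rule ccontr)
    assume "i \<noteq> j"
    have 1: "(\<Sum>k<n. (if k = i then c i else 0) *s w k) = ?w i" if "i < n" for i
      using that by (simp add: if_distrib[of "\<lambda>x. x *s _"] cong: if_cong)
    have "(if i = i then c i else 0) = (if i = j then c j else 0)"
      by (rule basis_coeffs_unique[OF assms(1) _ \<open>i < n\<close>]) (simp only: 1 that)
    thus False using \<open>i \<noteq> j\<close> assms(2)[OF \<open>i < n\<close>] by simp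
  qed
  hence inj: "inj_on ?w {..<n}" by (auto intro: inj_onI)
  have sub: "w ` {..<n} \<subseteq> span (?w ` {..<n})"
  proof safe
    fix i assume "i < n"
    hence "w i = inverse (c i) *s ?w i" using assms(2) by simp
    thus "w i \<in> span (?w ` {..<n})"
      using \<open>i < n\<close> by (metis (no_types, lifting) span_scale span_base imageI lessThan_iff)
  qed
  hence sp: "span (?w ` {..<n}) = UNIV"
    using assms(1) span_minimal[OF sub] by (auto simp: is_basis_def)
  have "u v = 0" if u: "(\<Sum>v\<in>?w ` {..<n}. u v *s v) = 0" "v \<in> ?w ` {..<n}" for u v
  proof -
    obtain i where i: "i < n" "v = ?w i" using u(2) by auto
    have "(\<Sum>i<n. (u (?w i) * c i) *s w i) = (\<Sum>i<n. 0 *s w i)"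
      using u(1) inj by (simp add: sum.reindex)
    hence "u (?w i) * c i = 0"
      using basis_coeffs_unique[OF assms(1) _ i(1), of "\<lambda>i. u (?w i) * c i" "\<lambda>i. 0"] by simp
    thus ?thesis using assms(2) i by simp
  qed
  hence "independent (?w ` {..<n})" by (auto simp: dependent_finite)
  with inj sp show ?thesis by (simp add: is_basis_def)
qed

lemma enumerate_basis:
  assumes "finite B" "independent B" "span B = UNIV"
  obtains w where "is_basis w" "w ` {..<n} = B"
proof -
  have "card B = n"
    using assms dim_n dim_eq_card[of B UNIV] by auto
  then obtain w where w: "bij_betw w {..<n} B"
    using ex_bij_betw_nat_finite[OF assms(1)] by (auto simp: atLeast0LessThan)
  hence "inj_on w {..<n}" "w ` {..<n} = B" by (auto simp: bij_betw_def)
  thus ?thesis using that[of w] assms by (simp add: is_basis_def)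
qed

lemma independent_finite: "independent B \<Longrightarrow> finite B"
proof -
  assume "independent B"
  obtain A where A: "finite A" "span A = (UNIV :: 'v set)" using finite_dim by blast
  show "finite B"
    using independent_span_bound[OF A(1) \<open>independent B\<close>] A(2) by auto
qed

lemma extend_to_basis:
  assumes "independent B0"
  obtains w J where "is_basis w" "J \<subseteq> {..<n}" "w ` J = B0"
proof -
  obtain B where B: "B0 \<subseteq> B" "independent B" "UNIV \<subseteq> span B"
    using maximal_independent_subset_extend[OF _ assms, of UNIV] by auto
  have "span B = UNIV" using B(3) by auto
  then obtain w where w: "is_basis w" "w ` {..<n} = B"
    using enumerate_basis[OF independent_finite[OF B(2)] B(2)] by metis
  show ?thesis
    by (rule that[OF w(1), of "{i. i < n \<and> w i \<in> B0}"]) (use B w(2) in auto)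
qed

lemma basis_exists: obtains w where "is_basis w"
  using extend_to_basis[OF independent_empty] by metis

text \<open>The version of \<open>orthogonal\<close> for the enumerated bases by which apartments are indexed.\<close>

definition adapted :: "('v \<Rightarrow> real) \<Rightarrow> (nat \<Rightarrow> 'v) \<Rightarrow> bool" where
  "adapted N w \<longleftrightarrow> (\<forall>a. \<forall>i<n. absv (a i) * N (w i) \<le> N (\<Sum>i<n. a i *s w i))"

lemma adaptedD: "adapted N w \<Longrightarrow> i < n \<Longrightarrow> absv (a i) * N (w i) \<le> N (\<Sum>i<n. a i *s w i)"
  by (simp add: adapted_def)

lemma orthogonal_iff_adapted:
  assumes w: "is_basis w"
  shows "orthogonal N (w ` {..<n}) \<longleftrightarrow> adapted N w"
proof
  assume o: "orthogonal N (w ` {..<n})"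
  show "adapted N w"
    unfolding adapted_def
  proof (intro allI impI)
    fix a :: "nat \<Rightarrow> 'k" and i assume i: "i < n"
    have inj: "inj_on w {..<n}" using w by (simp add: is_basis_def)
    let ?a = "\<lambda>v. a (inv_into {..<n} w v)"
    have "absv (?a (w i)) * N (w i) \<le> N (\<Sum>b\<in>w ` {..<n}. ?a b *s b)"
      using o[unfolded orthogonal_def, THEN conjunct2, THEN conjunct2, rule_format, of "w i" ?a] i
      by blast
    also have "(\<Sum>b\<in>w ` {..<n}. ?a b *s b) = (\<Sum>i<n. ?a (w i) *s w i)"
      by (rule basis_sum_image[OF w])
    also have "\<dots> = (\<Sum>i<n. a i *s w i)"
      by (intro sum.cong) (simp_all add: inv_into_f_f[OF inj])
    finally show "absv (a i) * N (w i) \<le> N (\<Sum>i<n. a i *s w i)"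
      using i by (simp add: inv_into_f_f[OF inj])
  qed
next
  assume a: "adapted N w"
  show "orthogonal N (w ` {..<n})"
    unfolding orthogonal_def
  proof (intro conjI allI ballI)
    fix c :: "'v \<Rightarrow> 'k" and b assume "b \<in> w ` {..<n}"
    then obtain i where "i < n" "b = w i" by auto
    thus "absv (c b) * N b \<le> N (\<Sum>b\<in>w ` {..<n}. c b *s b)"
      using adaptedD[OF a, of i "\<lambda>i. c (w i)"] by (simp add: basis_sum_image[OF w])
  qed (use basis_nz[OF w] in auto)
qed

lemma norm_combination_le:
  assumes "nonarch_norm N" "0 \<le> C" "\<And>i. i < n \<Longrightarrow> absv (a i) * N (w i) \<le> C"
  shows "N (\<Sum>i<n. a i *s w i) \<le> C"
  using assms(2,3) by (intro nonarch_norm_sum_le[OF assms(1)]) (auto simp: nonarch_normD(3)[OF assms(1)])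

lemma norm_combination_le_term:
  assumes "nonarch_norm N" "(\<Sum>i<n. a i *s w i) \<noteq> 0"
  obtains i where "i < n" "N (\<Sum>i<n. a i *s w i) \<le> absv (a i) * N (w i)"
proof -
  have "{..<n} \<noteq> {}" using assms(2) by (cases n) auto
  then obtain i where i: "i < n" "\<And>j. j < n \<Longrightarrow> absv (a j) * N (w j) \<le> absv (a i) * N (w i)"
    using finite_argmax[of "{..<n}" "\<lambda>i. absv (a i) * N (w i)"] by auto
  have "N (\<Sum>i<n. a i *s w i) \<le> absv (a i) * N (w i)"
    using i nonarch_normD(1)[OF assms(1)] absv_nonneg by (intro norm_combination_le[OF assms(1)]) auto
  thus ?thesis by (rule that[OF i(1)])
qed

lemma common_adapted_basis:
  assumes "nonarch_norm N0" "nonarch_norm N"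
    and "finite ((\<lambda>v. N0 v / N v) ` (- {0}))"
    and "is_basis w" "adapted N0 w"
  obtains w' where "is_basis w'" "adapted N0 w'" "adapted N w'"
proof -
  have "orthogonal N0 (w ` {..<n})" using orthogonal_iff_adapted[OF assms(4)] assms(5) by simp
  from common_orthogonal_set[OF assms(1,2,3) this]
  obtain B where B: "orthogonal N0 B" "orthogonal N B" "span B = span (w ` {..<n})" by blast
  have "span B = UNIV" using B(3) assms(4) by (simp add: is_basis_def)
  moreover have "finite B" "independent B"
    using B(2) orthogonal_independent[OF assms(2)] by (auto simp: orthogonal_def)
  ultimately obtain w' where w': "is_basis w'" "w' ` {..<n} = B"
    using enumerate_basis[of B] by blast
  have "adapted N0 w'" "adapted N w'"
    using B(1,2) orthogonal_iff_adapted[OF w'(1)] unfolding w'(2) by blast+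
  with w'(1) show ?thesis by (rule that)
qed

subsection \<open>The norm of a lattice\<close>

text \<open>For a lattice \<open>L\<close> the infimum is attained, and \<open>gauge L\<close> is the norm with unit ball \<open>L\<close>.\<close>

definition gauge :: "'v set \<Rightarrow> 'v \<Rightarrow> real" where
  "gauge L v = Inf (absv ` {c. v \<in> scale c ` L})"

lemma mem_scale_lattice_of:
  assumes "is_basis w"
  shows "(\<Sum>i<n. a i *s w i) \<in> scale c ` lattice_of w \<longleftrightarrow> (\<forall>i<n. absv (a i) \<le> absv c)"
proof
  assume "(\<Sum>i<n. a i *s w i) \<in> scale c ` lattice_of w"
  then obtain b where b: "\<forall>i<n. absv (b i) \<le> 1"
    "(\<Sum>i<n. a i *s w i) = c *s (\<Sum>i<n. b i *s w i)"
    by (auto simp: lattice_of_def valuation_ring_def)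
  have "(\<Sum>i<n. a i *s w i) = (\<Sum>i<n. (c * b i) *s w i)"
    using b(2) by (simp add: scale_sum_right)
  hence "\<forall>i<n. a i = c * b i"
    using basis_coeffs_unique[OF assms, of a "\<lambda>i. c * b i"] by simp
  thus "\<forall>i<n. absv (a i) \<le> absv c"
    using b(1) absv_nonneg by (simp add: absv_mult mult_left_le)
next
  assume *: "\<forall>i<n. absv (a i) \<le> absv c"
  have "(\<Sum>i<n. a i *s w i) = c *s (\<Sum>i<n. (a i / c) *s w i)"
  proof (cases "c = 0")
    case True
    hence "\<forall>i<n. a i = 0" using * absv_nonneg absv_eq_0_iff by (metis absv_0 antisym)
    thus ?thesis using True by simp
  qed (simp add: scale_sum_right)
  moreover have "\<forall>i<n. absv (a i / c) \<le> 1"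
    using * absv_nonneg by (simp add: absv_divide divide_le_eq_1 less_le)
  hence "(\<Sum>i<n. (a i / c) *s w i) \<in> lattice_of w"
    by (auto simp: lattice_of_def valuation_ring_def)
  ultimately show "(\<Sum>i<n. a i *s w i) \<in> scale c ` lattice_of w" by blast
qed

lemma gauge_attained:
  assumes "is_basis w"
  obtains c where "gauge (lattice_of w) (\<Sum>i<n. a i *s w i) = absv c"
    "\<forall>i<n. absv (a i) \<le> absv c" "c = 0 \<or> (\<exists>i<n. c = a i)"
proof -
  let ?C = "insert 0 (a ` {..<n})"
  obtain c where c: "c \<in> ?C" and le: "\<And>b. b \<in> ?C \<Longrightarrow> absv b \<le> absv c"
    using finite_argmax[of ?C absv] by blast
  have "gauge (lattice_of w) (\<Sum>i<n. a i *s w i) = absv c"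
    unfolding gauge_def mem_scale_lattice_of[OF assms]
  proof (rule cInf_eq_minimum)
    show "absv c \<in> absv ` {c. \<forall>i<n. absv (a i) \<le> absv c}" using le by auto
    show "absv c \<le> x" if "x \<in> absv ` {c. \<forall>i<n. absv (a i) \<le> absv c}" for x
      using that c absv_nonneg by auto
  qed
  thus ?thesis using that c le by blast
qed

lemma gauge_le_iff:
  assumes "is_basis w" "0 \<le> C"
  shows "gauge (lattice_of w) (\<Sum>i<n. a i *s w i) \<le> C \<longleftrightarrow> (\<forall>i<n. absv (a i) \<le> C)"
  using gauge_attained[OF assms(1), of a] assms(2) by (metis absv_0 order_trans)

lemma gauge_nonneg:
  assumes "is_lattice L"
  shows "0 \<le> gauge L v"
proof -
  obtain w where w: "is_basis w" "L = lattice_of w" using assms by (auto simp: is_lattice_def)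
  obtain a where "v = (\<Sum>i<n. a i *s w i)" using basis_coeffs[OF w(1)] by blast
  thus ?thesis using gauge_attained[OF w(1), of a] absv_nonneg w(2) by metis
qed

lemma gauge_value:
  assumes "is_lattice L"
  shows "\<exists>c. gauge L v = absv c"
proof -
  obtain w where w: "is_basis w" "L = lattice_of w" using assms by (auto simp: is_lattice_def)
  obtain a where "v = (\<Sum>i<n. a i *s w i)" using basis_coeffs[OF w(1)] by blast
  thus ?thesis using gauge_attained[OF w(1), of a] w(2) by metis
qed

lemma gauge_scale_vec:
  assumes "is_lattice L"
  shows "gauge L (c *s v) = absv c * gauge L v"
proof -
  obtain w where w: "is_basis w" "L = lattice_of w" using assms by (auto simp: is_lattice_def)
  obtain a where a: "v = (\<Sum>i<n. a i *s w i)" using basis_coeffs[OF w(1)] by blast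
  have ca: "c *s v = (\<Sum>i<n. (c * a i) *s w i)" by (simp add: a scale_sum_right)
  have iff: "gauge L (c *s v) \<le> C \<longleftrightarrow> (\<forall>i<n. absv c * absv (a i) \<le> C)" if "0 \<le> C" for C
    unfolding w(2) ca using gauge_le_iff[OF w(1) that, of "\<lambda>i. c * a i"] by (simp add: absv_mult)
  have iff': "gauge L v \<le> C \<longleftrightarrow> (\<forall>i<n. absv (a i) \<le> C)" if "0 \<le> C" for C
    unfolding w(2) a using gauge_le_iff[OF w(1) that, of a] by simp
  show ?thesis
  proof (cases "c = 0")
    case True
    thus ?thesis using iff[of 0] gauge_nonneg[OF assms, of 0] by auto
  next
    case False
    hence c: "absv c > 0" by (rule absv_pos)
    have nn: "0 \<le> gauge L v" "0 \<le> gauge L (c *s v)" by (rule gauge_nonneg[OF assms])+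
    have "gauge L (c *s v) \<le> absv c * gauge L v"
      using iff[of "absv c * gauge L v"] iff'[OF nn(1)] nn c by simp
    moreover have "gauge L v \<le> gauge L (c *s v) / absv c"
      using iff'[of "gauge L (c *s v) / absv c"] iff[OF nn(2)] nn c
      by (simp add: pos_le_divide_eq mult.commute)
    ultimately show ?thesis using c by (simp add: pos_le_divide_eq mult.commute)
  qed
qed

lemma gauge_norm:
  assumes "is_lattice L"
  shows "nonarch_norm (gauge L)"
proof -
  obtain w where w: "is_basis w" "L = lattice_of w" using assms by (auto simp: is_lattice_def)
  have "v = 0" if "gauge L v = 0" for v
  proof -
    obtain a where a: "v = (\<Sum>i<n. a i *s w i)" using basis_coeffs[OF w(1)] by blast
    have "\<forall>i<n. absv (a i) \<le> 0" using that gauge_le_iff[OF w(1), of 0 a] a w(2) by simp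
    hence "\<forall>i<n. a i = 0" using absv_nonneg absv_eq_0_iff by (metis antisym)
    thus ?thesis using a by simp
  qed
  moreover have "gauge L 0 = 0" using gauge_scale_vec[OF assms, of 0 0] by simp
  moreover have "gauge L (u + v) \<le> max (gauge L u) (gauge L v)" for u v
  proof -
    obtain a where a: "u = (\<Sum>i<n. a i *s w i)" using basis_coeffs[OF w(1)] by blast
    obtain b where b: "v = (\<Sum>i<n. b i *s w i)" using basis_coeffs[OF w(1)] by blast
    let ?C = "max (gauge L u) (gauge L v)"
    have C: "0 \<le> ?C" using gauge_nonneg[OF assms] by (simp add: le_max_iff_disj)
    have "\<forall>i<n. absv (a i) \<le> ?C" "\<forall>i<n. absv (b i) \<le> ?C"
      using gauge_le_iff[OF w(1) C, of a] gauge_le_iff[OF w(1) C, of b] a b w(2) by auto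
    hence "\<forall>i<n. absv (a i + b i) \<le> ?C"
      using absv_ultrametric by (meson max.bounded_iff order_trans max.boundedI)
    moreover have "u + v = (\<Sum>i<n. (a i + b i) *s w i)"
      by (simp add: a b scale_left_distrib sum.distrib)
    ultimately show ?thesis using gauge_le_iff[OF w(1) C, of "\<lambda>i. a i + b i"] w(2) by simp
  qed
  ultimately show ?thesis
    using gauge_nonneg[OF assms] gauge_scale_vec[OF assms] by (auto simp: nonarch_norm_def)
qed

lemma gauge_0: "is_lattice L \<Longrightarrow> gauge L 0 = 0"
  using nonarch_normD(2)[OF gauge_norm] by blast

lemma gauge_mem:
  assumes "is_lattice L"
  shows "v \<in> L \<longleftrightarrow> gauge L v \<le> 1"
proof -
  obtain w where w: "is_basis w" "L = lattice_of w" using assms by (auto simp: is_lattice_def)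
  obtain a where a: "v = (\<Sum>i<n. a i *s w i)" using basis_coeffs[OF w(1)] by blast
  show ?thesis
    using gauge_le_iff[OF w(1), of 1 a] mem_scale_lattice_of[OF w(1), of a 1] a w(2) by simp
qed

lemma scale_image_lattice_of: "scale c ` lattice_of w = lattice_of (\<lambda>i. c *s w i)"
proof -
  have eq: "c *s (\<Sum>i<n. a i *s w i) = (\<Sum>i<n. a i *s c *s w i)" for a
    unfolding scale_sum_right by (intro sum.cong) (simp_all add: mult.commute)
  show ?thesis
  proof (intro equalityI subsetI)
    fix v assume "v \<in> scale c ` lattice_of w"
    then obtain a where "\<forall>i<n. a i \<in> valuation_ring" "v = c *s (\<Sum>i<n. a i *s w i)"
      unfolding lattice_of_def by blast
    thus "v \<in> lattice_of (\<lambda>i. c *s w i)" unfolding lattice_of_def eq by blast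
  next
    fix v assume "v \<in> lattice_of (\<lambda>i. c *s w i)"
    then obtain a where a: "\<forall>i<n. a i \<in> valuation_ring" "v = c *s (\<Sum>i<n. a i *s w i)"
      unfolding lattice_of_def eq by blast
    hence "(\<Sum>i<n. a i *s w i) \<in> lattice_of w" unfolding lattice_of_def by blast
    thus "v \<in> scale c ` lattice_of w" unfolding a(2) by (rule imageI)
  qed
qed

lemma is_lattice_scale:
  assumes "is_lattice L" "c \<noteq> 0"
  shows "is_lattice (scale c ` L)"
proof -
  obtain w where w: "is_basis w" "L = lattice_of w" using assms(1) by (auto simp: is_lattice_def)
  have "is_basis (\<lambda>i. c *s w i)" using basis_scale[OF w(1), of "\<lambda>_. c"] assms(2) by simp
  thus ?thesis unfolding is_lattice_def w(2) scale_image_lattice_of by blast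
qed

lemma gauge_scale:
  assumes L: "is_lattice L" and c: "c \<noteq> 0"
  shows "gauge (scale c ` L) v = gauge L v / absv c"
proof -
  note cL = is_lattice_scale[OF L c]
  have *: "gauge (scale c ` L) v \<le> absv b \<longleftrightarrow> gauge L v / absv c \<le> absv b" if "b \<noteq> 0" for b
  proof -
    have pos: "absv b > 0" "absv c > 0" using that c by (auto intro: absv_pos)
    have "gauge (scale c ` L) v \<le> absv b \<longleftrightarrow> inverse b *s v \<in> scale c ` L"
      unfolding gauge_mem[OF cL] gauge_scale_vec[OF cL] absv_inverse
      using pos by (simp add: inverse_eq_divide)
    also have "\<dots> \<longleftrightarrow> inverse c *s inverse b *s v \<in> L"
    proof
      assume "inverse c *s inverse b *s v \<in> L"
      hence "c *s inverse c *s inverse b *s v \<in> scale c ` L" by (rule imageI)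
      moreover have "c *s inverse c *s inverse b *s v = inverse b *s v"
        using c by (simp add: mult.assoc[symmetric])
      ultimately show "inverse b *s v \<in> scale c ` L" by (simp only:)
    next
      assume "inverse b *s v \<in> scale c ` L"
      then obtain u where u: "u \<in> L" "inverse b *s v = c *s u" by blast
      show "inverse c *s inverse b *s v \<in> L" unfolding u(2) using c u(1) by simp
    qed
    also have "\<dots> \<longleftrightarrow> gauge L v / absv c \<le> absv b"
      unfolding gauge_mem[OF L] gauge_scale_vec[OF L] absv_inverse
      using pos by (simp add: field_simps)
    finally show ?thesis .
  qed
  obtain a where a: "gauge (scale c ` L) v = absv a" using gauge_value[OF cL] ..
  obtain b where "gauge L v = absv b" using gauge_value[OF L] ..
  hence b: "gauge L v / absv c = absv (b / c)" by (simp add: absv_divide)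
  show ?thesis
  proof (cases "v = 0")
    case True
    thus ?thesis using gauge_0[OF L] gauge_0[OF cL] by simp
  next
    case False
    hence "a \<noteq> 0" "b / c \<noteq> 0"
      using a b nonarch_normD(2)[OF gauge_norm[OF L], of v] nonarch_normD(2)[OF gauge_norm[OF cL], of v]
        absv_pos[OF c] by auto
    thus ?thesis using *[of a] *[of "b / c"] a b by simp
  qed
qed

lemma gauge_mono:
  assumes L: "is_lattice L" and M: "is_lattice M" and "M \<subseteq> L"
  shows "gauge L v \<le> gauge M v"
proof (cases "v = 0")
  case True
  thus ?thesis using gauge_0[OF L] gauge_0[OF M] by simp
next
  case False
  obtain c where c: "gauge M v = absv c" using gauge_value[OF M] ..
  have pos: "absv c > 0" unfolding c[symmetric] by (rule nonarch_normD(5)[OF gauge_norm[OF M] False])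
  have "inverse c *s v \<in> M"
    unfolding gauge_mem[OF M] gauge_scale_vec[OF M] absv_inverse c using pos by simp
  hence "inverse c *s v \<in> L" using \<open>M \<subseteq> L\<close> by blast
  thus ?thesis
    unfolding gauge_mem[OF L] gauge_scale_vec[OF L] absv_inverse c
    using pos by (simp add: inverse_eq_divide)
qed

lemma gauge_adapted:
  assumes "is_basis w" 
  shows "adapted (gauge (lattice_of w)) w" "i < n \<Longrightarrow> gauge (lattice_of w) (w i) = 1"
proof -
  have L: "is_lattice (lattice_of w)" using assms by (auto simp: is_lattice_def)
  have one: "gauge (lattice_of w) (w i) \<le> 1" if "i < n" for i
  proof -
    have eq: "(\<Sum>k<n. (if k = i then 1 else 0) *s w k) = w i"
      using that by (simp add: if_distrib[of "\<lambda>x. x *s _"] cong: if_cong)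
    show ?thesis
      using gauge_le_iff[OF assms, of 1 "\<lambda>k. if k = i then 1 else 0"] unfolding eq by simp
  qed
  have ge: "absv (a i) \<le> gauge (lattice_of w) (\<Sum>i<n. a i *s w i)" if "i < n" for a i
    using gauge_le_iff[OF assms gauge_nonneg[OF L], of a] that by blast
  show "adapted (gauge (lattice_of w)) w"
    unfolding adapted_def
  proof (intro allI impI)
    fix a i assume i: "i < n"
    have "absv (a i) * gauge (lattice_of w) (w i) \<le> absv (a i)"
      using one[OF i] absv_nonneg by (simp add: mult_left_le)
    thus "absv (a i) * gauge (lattice_of w) (w i) \<le> gauge (lattice_of w) (\<Sum>i<n. a i *s w i)"
      using ge[OF i, of a] by linarith
  qed
  show "gauge (lattice_of w) (w i) = 1" if "i < n"
  proof (rule antisym[OF one[OF that]])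
    have eq: "(\<Sum>k<n. (if k = i then 1 else 0) *s w k) = w i"
      using that by (simp add: if_distrib[of "\<lambda>x. x *s _"] cong: if_cong)
    show "1 \<le> gauge (lattice_of w) (w i)"
      using ge[OF that, of "\<lambda>k. if k = i then 1 else 0"] unfolding eq by simp
  qed
qed

section \<open>Points of the building as norms\<close>

text \<open>The choice of the representatives affects the norms of points only by constant factors.\<close>

definition rep :: "'v set set \<Rightarrow> 'v set" where
  "rep u = (SOME M. M \<in> u)"

abbreviation vgauge :: "'v set set \<Rightarrow> 'v \<Rightarrow> real" where
  "vgauge u \<equiv> gauge (rep u)"

lemma lattice_class_self: "M \<in> lattice_class M"
proof -
  have "M = scale 1 ` M" by simp
  thus ?thesis unfolding lattice_class_def by (metis (mono_tags, lifting) mem_Collect_eq one_neq_zero)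
qed

lemma lattice_class_scale:
  assumes "c \<noteq> 0"
  shows "lattice_class (scale c ` M) = lattice_class M"
proof -
  have "\<exists>c'. scale b ` scale c ` M = scale c' ` M \<and> c' \<noteq> 0" if "b \<noteq> 0" for b
    using that assms by (intro exI[of _ "b * c"]) (simp add: image_image)
  moreover have "\<exists>c'. scale b ` M = scale c' ` scale c ` M \<and> c' \<noteq> 0" if "b \<noteq> 0" for b
    using that assms by (intro exI[of _ "b / c"]) (simp add: image_image)
  ultimately show ?thesis unfolding lattice_class_def by blast
qed

lemma vertex_rep:
  assumes "u \<in> vertices"
  shows "is_lattice (rep u)" "u = lattice_class (rep u)"
proof -
  obtain M where M: "is_lattice M" "u = lattice_class M" using assms by (auto simp: vertices_def)
  have "rep u \<in> u" unfolding rep_def by (rule someI[of _ M]) (simp add: M lattice_class_self)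
  then obtain c where c: "c \<noteq> 0" "rep u = scale c ` M" by (auto simp: M(2) lattice_class_def)
  show "is_lattice (rep u)" unfolding c(2) by (rule is_lattice_scale[OF M(1) c(1)])
  show "u = lattice_class (rep u)" unfolding c(2) lattice_class_scale[OF c(1)] by (rule M(2))
qed

lemma gauge_member:
  assumes "u \<in> vertices" "M \<in> u"
  obtains A where "is_lattice M" "0 < A" "\<And>v. gauge M v = A * vgauge u v"
proof -
  obtain c where c: "c \<noteq> 0" "M = scale c ` rep u"
    using assms(2) vertex_rep(2)[OF assms(1)] unfolding lattice_class_def by blast
  show ?thesis
  proof (rule that[of "1 / absv c"])
    show "is_lattice M" unfolding c(2) by (rule is_lattice_scale[OF vertex_rep(1)[OF assms(1)] c(1)])
    show "gauge M v = 1 / absv c * vgauge u v" for v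
      unfolding c(2) gauge_scale[OF vertex_rep(1)[OF assms(1)] c(1)] by simp
  qed (use absv_pos[OF c(1)] in simp)
qed

lemma vgauge_pos: "u \<in> vertices \<Longrightarrow> v \<noteq> 0 \<Longrightarrow> 0 < vgauge u v"
  by (rule nonarch_normD(5)[OF gauge_norm[OF vertex_rep(1)]])

lemma vgauge_discrete:
  assumes u: "u \<in> vertices" and "v \<noteq> 0" and lt: "vgauge u v < vgauge u v'"
  shows "q * vgauge u v \<le> vgauge u v'"
proof -
  obtain a where a: "vgauge u v = absv a" using gauge_value[OF vertex_rep(1)[OF u]] ..
  obtain b where b: "vgauge u v' = absv b" using gauge_value[OF vertex_rep(1)[OF u]] ..
  have "a \<noteq> 0" using a vgauge_pos[OF u \<open>v \<noteq> 0\<close>] by auto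
  then obtain k where k: "absv a = q powi k" by (rule value_group)
  have "b \<noteq> 0" using lt a b absv_nonneg[of a] by auto
  then obtain l where l: "absv b = q powi l" by (rule value_group)
  show ?thesis using lt powi_less_imp_le[of k l] by (simp add: a b k l)
qed

lemma adjacent_vgauge:
  assumes u: "u \<in> vertices" and u': "u' \<in> vertices" and adj: "adjacent u u'"
  obtains A where "0 < A" "\<And>v. A * vgauge u v \<le> vgauge u' v"
    "\<And>v. vgauge u' v \<le> q * (A * vgauge u v)"
proof -
  obtain M N where MN: "M \<in> u" "N \<in> u'" "scale \<pi> ` N \<subseteq> M" "M \<subseteq> N"
    using adj by (auto simp: adjacent_def)
  obtain a where a: "is_lattice M" "0 < a" "\<And>v. gauge M v = a * vgauge u v"
    using gauge_member[OF u MN(1)] by metis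
  obtain b where b: "is_lattice N" "0 < b" "\<And>v. gauge N v = b * vgauge u' v"
    using gauge_member[OF u' MN(2)] by metis
  have q: "q > 0" using q_gt_1 by simp
  have 1: "b * vgauge u' v \<le> a * vgauge u v" for v
    using gauge_mono[OF b(1) a(1) MN(4), of v] a(3) b(3) by simp
  have 2: "a * vgauge u v \<le> q * (b * vgauge u' v)" for v
    using gauge_mono[OF a(1) is_lattice_scale[OF b(1) pi_nz] MN(3), of v] a(3)[of v] b(3)[of v]
      gauge_scale[OF b(1) pi_nz, of v] by (simp add: q_def)
  show ?thesis
  proof (rule that[of "a / (q * b)"])
    show "a / (q * b) * vgauge u v \<le> vgauge u' v" for v
      using 2[of v] q b(2) by (simp add: field_simps)
    show "vgauge u' v \<le> q * (a / (q * b) * vgauge u v)" for v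
      using 1[of v] q b(2) by (simp add: field_simps)
  qed (use a b q in simp)
qed

definition supp :: "('v set set \<Rightarrow> real) \<Rightarrow> 'v set set set" where
  "supp x = {u. x u \<noteq> 0}"

lemma buildingD:
  assumes "x \<in> building"
  shows "finite (supp x)" "supp x \<noteq> {}" "supp x \<subseteq> vertices" "sum x (supp x) = 1"
    "u \<in> supp x \<Longrightarrow> 0 < x u" "u \<in> supp x \<Longrightarrow> u' \<in> supp x \<Longrightarrow> u \<noteq> u' \<Longrightarrow> adjacent u u'"
proof -
  obtain S where S: "is_simplex S" "\<forall>v. v \<notin> S \<longrightarrow> x v = 0" "\<forall>v\<in>S. x v \<ge> 0" "sum x S = 1"
    using assms unfolding building_def by blast
  have S': "finite S" "S \<subseteq> vertices" "\<forall>v\<in>S. \<forall>v'\<in>S. v \<noteq> v' \<longrightarrow> adjacent v v'"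
    using S(1) unfolding is_simplex_def by blast+
  have sub: "supp x \<subseteq> S" using S(2) by (auto simp: supp_def)
  show "finite (supp x)" using sub S'(1) by (rule finite_subset)
  show "supp x \<subseteq> vertices" using sub S'(2) by auto
  have "sum x (supp x) = sum x S"
    using sub S'(1) by (intro sum.mono_neutral_left) (auto simp: supp_def)
  thus 1: "sum x (supp x) = 1" using S(4) by simp
  thus "supp x \<noteq> {}" by auto
  show "0 < x u" if "u \<in> supp x" using that sub S(3) by (force simp: supp_def)
  show "adjacent u u'" if "u \<in> supp x" "u' \<in> supp x" "u \<noteq> u'" using that sub S'(3) by blast
qed

lemma buildingI:
  assumes "finite (supp x)" "supp x \<subseteq> vertices" "sum x (supp x) = 1" "\<And>u. 0 \<le> x u"
    "\<And>u u'. u \<in> supp x \<Longrightarrow> u' \<in> supp x \<Longrightarrow> u \<noteq> u' \<Longrightarrow> adjacent u u'"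
  shows "x \<in> building"
proof -
  have "supp x \<noteq> {}" using assms(3) by auto
  hence "is_simplex (supp x)" using assms by (auto simp: is_simplex_def)
  moreover have "\<forall>v. v \<notin> supp x \<longrightarrow> x v = 0" by (simp add: supp_def)
  ultimately show ?thesis unfolding building_def using assms(3,4) by blast
qed

text \<open>The two lattice norms of adjacent vertices differ, up to a constant, by a factor in
  \<open>{1, q}\<close>, while each of them takes values in a coset of \<open>q\<^sup>\<int>\<close>. Hence they never order two
  vectors in opposite ways.\<close>

lemma vgauge_order_compatible:
  assumes x: "x \<in> building" and u: "u \<in> supp x" and u': "u' \<in> supp x"
    and "v \<noteq> 0" "v' \<noteq> 0" and lt: "vgauge u v < vgauge u v'"
  shows "vgauge u' v \<le> vgauge u' v'"
proof (cases "u = u'")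
  case False
  have vert: "u \<in> vertices" "u' \<in> vertices" using buildingD(3)[OF x] u u' by auto
  obtain A where A: "0 < A" "\<And>v. A * vgauge u v \<le> vgauge u' v"
    "\<And>v. vgauge u' v \<le> q * (A * vgauge u v)"
    using adjacent_vgauge[OF vert buildingD(6)[OF x u u' False]] by metis
  show ?thesis
  proof (rule ccontr)
    assume "\<not> vgauge u' v \<le> vgauge u' v'"
    hence "q * vgauge u' v' \<le> vgauge u' v" using vgauge_discrete[OF vert(2) \<open>v' \<noteq> 0\<close>] by simp
    also have "\<dots> \<le> q * (A * vgauge u v)" by (rule A(3))
    finally have "vgauge u' v' \<le> A * vgauge u v" using q_gt_1 by simp
    also have "\<dots> < A * vgauge u v'" using lt A(1) by simp
    also have "\<dots> \<le> vgauge u' v'" by (rule A(2))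
    finally show False by simp
  qed
qed (use lt in simp)

text \<open>The weighted geometric mean of the lattice norms at the vertices of the simplex of \<open>x\<close>.\<close>

definition pnorm :: "('v set set \<Rightarrow> real) \<Rightarrow> 'v \<Rightarrow> real" where
  "pnorm x v = (if v = 0 then 0 else q powr (\<Sum>u\<in>supp x. x u * log q (vgauge u v)))"

lemma pnorm_0 [simp]: "pnorm x 0 = 0" by (simp add: pnorm_def)

lemma pnorm_pos: "v \<noteq> 0 \<Longrightarrow> 0 < pnorm x v"
  using q_gt_1 by (simp add: pnorm_def)

lemma log_pnorm: "v \<noteq> 0 \<Longrightarrow> log q (pnorm x v) = (\<Sum>u\<in>supp x. x u * log q (vgauge u v))"
  using q_gt_1 by (simp add: pnorm_def)

lemma pnorm_mono:
  assumes x: "x \<in> building" and "v \<noteq> 0" "v' \<noteq> 0"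
    and le: "\<And>u. u \<in> supp x \<Longrightarrow> vgauge u v \<le> vgauge u v'"
  shows "pnorm x v \<le> pnorm x v'"
proof -
  have "(\<Sum>u\<in>supp x. x u * log q (vgauge u v)) \<le> (\<Sum>u\<in>supp x. x u * log q (vgauge u v'))"
  proof (intro sum_mono mult_left_mono)
    fix u assume u: "u \<in> supp x"
    hence "u \<in> vertices" using buildingD(3)[OF x] by auto
    thus "log q (vgauge u v) \<le> log q (vgauge u v')"
      using le[OF u] vgauge_pos[of u] assms(2,3) q_gt_1 by simp
    show "0 \<le> x u" using buildingD(5)[OF x u] by simp
  qed
  thus ?thesis using assms(2,3) q_gt_1 by (simp add: pnorm_def)
qed

text \<open>Therefore the order that \<open>pnorm x\<close> puts on vectors refines that of each vertex of the
  simplex of \<open>x\<close>; in particular the lattices at these vertices are balls of \<open>pnorm x\<close>.\<close>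

lemma vgauge_le_of_pnorm_le:
  assumes x: "x \<in> building" and "v \<noteq> 0" "v' \<noteq> 0" and le: "pnorm x v \<le> pnorm x v'"
    and u: "u \<in> supp x"
  shows "vgauge u v \<le> vgauge u v'"
proof (rule ccontr)
  assume "\<not> vgauge u v \<le> vgauge u v'"
  hence lt: "vgauge u v' < vgauge u v" by simp
  have "(\<Sum>u\<in>supp x. x u * log q (vgauge u v')) < (\<Sum>u\<in>supp x. x u * log q (vgauge u v))"
  proof (rule sum_strict_mono_ex1)
    show "\<forall>u'\<in>supp x. x u' * log q (vgauge u' v') \<le> x u' * log q (vgauge u' v)"
    proof
      fix u' assume u': "u' \<in> supp x"
      hence vert: "u' \<in> vertices" using buildingD(3)[OF x] by auto
      have "vgauge u' v' \<le> vgauge u' v"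
        by (rule vgauge_order_compatible[OF x u u' assms(3,2) lt])
      hence "log q (vgauge u' v') \<le> log q (vgauge u' v)"
        using vgauge_pos[OF vert] assms(2,3) q_gt_1 by simp
      thus "x u' * log q (vgauge u' v') \<le> x u' * log q (vgauge u' v)"
        using buildingD(5)[OF x u'] by simp
    qed
    have vert: "u \<in> vertices" using buildingD(3)[OF x] u by auto
    have "log q (vgauge u v') < log q (vgauge u v)"
      using lt vgauge_pos[OF vert] assms(2,3) q_gt_1 by simp
    thus "\<exists>u\<in>supp x. x u * log q (vgauge u v') < x u * log q (vgauge u v)"
      using u buildingD(5)[OF x u] by (intro bexI[of _ u]) simp_all
  qed (rule buildingD(1)[OF x])
  thus False using le assms(2,3) q_gt_1 by (simp add: pnorm_def)
qed

lemma pnorm_norm: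
  assumes x: "x \<in> building"
  shows "nonarch_norm (pnorm x)"
  unfolding nonarch_norm_def
proof (intro conjI allI)
  show "0 \<le> pnorm x v" for v by (simp add: pnorm_def)
  show "pnorm x v = 0 \<longleftrightarrow> v = 0" for v using q_gt_1 by (simp add: pnorm_def)
next
  fix c v
  show "pnorm x (c *s v) = absv c * pnorm x v"
  proof (cases "c = 0 \<or> v = 0")
    case False
    hence c: "absv c > 0" by (auto intro: absv_pos)
    have "(\<Sum>u\<in>supp x. x u * log q (vgauge u (c *s v))) =
        (\<Sum>u\<in>supp x. x u * log q (absv c) + x u * log q (vgauge u v))"
    proof (intro sum.cong refl)
      fix u assume "u \<in> supp x"
      hence u: "u \<in> vertices" using buildingD(3)[OF x] by auto
      have "log q (vgauge u (c *s v)) = log q (absv c) + log q (vgauge u v)"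
        unfolding gauge_scale_vec[OF vertex_rep(1)[OF u]]
        using c vgauge_pos[OF u] False by (intro log_mult_pos) auto
      thus "x u * log q (vgauge u (c *s v)) = x u * log q (absv c) + x u * log q (vgauge u v)"
        by (simp add: distrib_left)
    qed
    also have "\<dots> = sum x (supp x) * log q (absv c) + (\<Sum>u\<in>supp x. x u * log q (vgauge u v))"
      by (simp add: sum.distrib sum_distrib_right)
    finally show ?thesis
      using False c q_gt_1 buildingD(4)[OF x] by (simp add: pnorm_def powr_add)
  qed auto
next
  have aux: "pnorm x (v + v') \<le> pnorm x v'" if "pnorm x v \<le> pnorm x v'" for v v'
  proof (cases "v = 0 \<or> v' = 0 \<or> v + v' = 0")
    case True
    have "0 \<le> pnorm x v'" by (simp add: pnorm_def)
    moreover have "v = 0" if "v' = 0" using \<open>pnorm x v \<le> pnorm x v'\<close> that pnorm_pos[of v x] by force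
    ultimately show ?thesis using True by auto
  next
    case False
    show ?thesis
    proof (rule pnorm_mono[OF x])
      fix u assume u: "u \<in> supp x"
      hence vert: "u \<in> vertices" using buildingD(3)[OF x] by auto
      have "vgauge u v \<le> vgauge u v'"
        using vgauge_le_of_pnorm_le[OF x _ _ \<open>pnorm x v \<le> pnorm x v'\<close> u] False by auto
      thus "vgauge u (v + v') \<le> vgauge u v'"
        using nonarch_normD(4)[OF gauge_norm[OF vertex_rep(1)[OF vert]], of v v'] by simp
    qed (use False in auto)
  qed
  show "pnorm x (v + v') \<le> max (pnorm x v) (pnorm x v')" for v v'
    using aux[of v v'] aux[of v' v] by (cases "pnorm x v \<le> pnorm x v'") (auto simp: add.commute max_def)
qed

lemma pnorm_scale: "x \<in> building \<Longrightarrow> pnorm x (c *s v) = absv c * pnorm x v"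
  by (rule nonarch_normD(3)[OF pnorm_norm])

subsection \<open>Apartments\<close>

lemma adapted_rescale:
  assumes "adapted N (\<lambda>i. c i *s w i)" "\<And>i. i < n \<Longrightarrow> c i \<noteq> 0" "nonarch_norm N"
  shows "adapted N w"
  unfolding adapted_def
proof (intro allI impI)
  fix a i assume i: "i < n"
  have "(\<Sum>i<n. (a i / c i) *s c i *s w i) = (\<Sum>i<n. a i *s w i)"
    using assms(2) by (intro sum.cong) auto
  hence "absv (a i / c i) * N (c i *s w i) \<le> N (\<Sum>i<n. a i *s w i)"
    using adaptedD[OF assms(1) i, of "\<lambda>i. a i / c i"] by simp
  moreover have "absv (c i) > 0" using assms(2)[OF i] by (rule absv_pos)
  ultimately show "absv (a i) * N (w i) \<le> N (\<Sum>i<n. a i *s w i)"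
    by (simp add: absv_divide nonarch_normD(3)[OF assms(3)])
qed

lemma apartment_vertex_vgauge:
  assumes w: "is_basis w"
  shows "apartment_vertex w k \<in> vertices" "adapted (vgauge (apartment_vertex w k)) w"
    "\<exists>A>0. \<forall>i<n. vgauge (apartment_vertex w k) (w i) = A * q powi k i"
proof -
  let ?w = "\<lambda>i. (\<pi> powi k i) *s w i"
  let ?u = "apartment_vertex w k"
  have w': "is_basis ?w" by (rule basis_scale[OF w]) simp
  have L: "is_lattice (lattice_of ?w)" using w' by (auto simp: is_lattice_def)
  show u: "?u \<in> vertices" unfolding vertices_def apartment_vertex_def using L by blast
  obtain A where A: "0 < A" "\<And>v. gauge (lattice_of ?w) v = A * vgauge ?u v"
    using gauge_member[OF u, of "lattice_of ?w"] lattice_class_self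
    unfolding apartment_vertex_def by metis
  have "adapted (vgauge ?u) ?w"
    unfolding adapted_def
  proof (intro allI impI)
    fix a i assume "i < n"
    hence "absv (a i) * gauge (lattice_of ?w) (?w i) \<le> gauge (lattice_of ?w) (\<Sum>i<n. a i *s ?w i)"
      by (rule adaptedD[OF gauge_adapted(1)[OF w']])
    hence "A * (absv (a i) * vgauge ?u (?w i)) \<le> A * vgauge ?u (\<Sum>i<n. a i *s ?w i)"
      unfolding A(2) by (simp add: mult.left_commute)
    thus "absv (a i) * vgauge ?u (?w i) \<le> vgauge ?u (\<Sum>i<n. a i *s ?w i)"
      using A(1) by simp
  qed
  thus "adapted (vgauge ?u) w"
    by (rule adapted_rescale) (use gauge_norm[OF vertex_rep(1)[OF u]] in auto)
  have "vgauge ?u (w i) = 1 / A * q powi k i" if "i < n" for i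
  proof -
    have "1 = A * vgauge ?u (?w i)" using gauge_adapted(2)[OF w' that] A(2) by simp
    also have "vgauge ?u (?w i) = q powi (- k i) * vgauge ?u (w i)"
      unfolding gauge_scale_vec[OF vertex_rep(1)[OF u]] absv_pi_powi ..
    finally show ?thesis using A(1) q_gt_1 by (simp add: power_int_minus field_simps)
  qed
  thus "\<exists>A>0. \<forall>i<n. vgauge ?u (w i) = A * q powi k i"
    using A(1) by (intro exI[of _ "1 / A"]) simp
qed

lemma apartmentD:
  assumes "x \<in> apartment w" "u \<in> supp x"
  obtains k where "u = apartment_vertex w k"
  using assms by (auto simp: apartment_def supp_def)

lemma apartment_building: "x \<in> apartment w \<Longrightarrow> x \<in> building"
  by (simp add: apartment_def)

lemma apartment_adapted:
  assumes w: "is_basis w" and xw: "x \<in> apartment w"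
  shows "adapted (pnorm x) w"
  unfolding adapted_def
proof (intro allI impI)
  fix a i assume i: "i < n"
  have x: "x \<in> building" using xw by (rule apartment_building)
  let ?v = "\<Sum>i<n. a i *s w i"
  show "absv (a i) * pnorm x (w i) \<le> pnorm x ?v"
  proof (cases "a i = 0")
    case True
    thus ?thesis using nonarch_normD(1)[OF pnorm_norm[OF x]] by simp
  next
    case False
    have nz: "a i *s w i \<noteq> 0" using False basis_nz[OF w i] by simp
    have v0: "?v \<noteq> 0" using False basis_coeffs_unique[OF w _ i, of a "\<lambda>_. 0"] by auto
    have "pnorm x (a i *s w i) \<le> pnorm x ?v"
    proof (rule pnorm_mono[OF x nz v0])
      fix u assume "u \<in> supp x"
      then obtain k where u: "u = apartment_vertex w k" by (rule apartmentD[OF xw])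
      show "vgauge u (a i *s w i) \<le> vgauge u ?v"
        unfolding u gauge_scale_vec[OF vertex_rep(1)[OF apartment_vertex_vgauge(1)[OF w]]]
        by (rule adaptedD[OF apartment_vertex_vgauge(2)[OF w] i])
    qed
    thus ?thesis unfolding pnorm_scale[OF x] .
  qed
qed

text \<open>The lattice at a vertex \<open>u\<close> of the simplex of \<open>x\<close> is a ball of \<open>pnorm x\<close>, so it contains the
  terms \<open>a i *s w i\<close> of each of its elements, and it is determined by its intersections with the lines
  \<open>K w i\<close>.\<close>

lemma adapted_apartment:
  assumes w: "is_basis w" and x: "x \<in> building" and ad: "adapted (pnorm x) w"
  shows "x \<in> apartment w"
proof -
  have "u \<in> range (apartment_vertex w)" if u: "u \<in> supp x" for u
  proof -
    have vert: "u \<in> vertices" using buildingD(3)[OF x] u by auto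
    note L = vertex_rep(1)[OF vert]
    have "\<exists>k. vgauge u (w i) = q powi k" if i: "i < n" for i
    proof -
      obtain a where a: "vgauge u (w i) = absv a" using gauge_value[OF L] ..
      have "a \<noteq> 0" using a vgauge_pos[OF vert basis_nz[OF w i]] by auto
      then obtain k where "absv a = q powi k" by (rule value_group)
      thus ?thesis using a by auto
    qed
    then obtain k where k: "\<And>i. i < n \<Longrightarrow> vgauge u (w i) = q powi k i" by metis
    let ?w = "\<lambda>i. (\<pi> powi k i) *s w i"
    have w': "is_basis ?w" by (rule basis_scale[OF w]) simp
    have "v \<in> rep u \<longleftrightarrow> v \<in> lattice_of ?w" for v
    proof -
      obtain a where a: "v = (\<Sum>i<n. a i *s ?w i)" using basis_coeffs[OF w'] by blast
      have tm: "vgauge u (a i *s ?w i) = absv (a i)" if "i < n" for i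
        unfolding gauge_scale_vec[OF L] k[OF that] absv_pi_powi
        using q_gt_1 by (simp add: power_int_minus)
      have "v \<in> rep u \<longleftrightarrow> (\<forall>i<n. absv (a i) \<le> 1)"
      proof
        assume v: "v \<in> rep u"
        show "\<forall>i<n. absv (a i) \<le> 1"
        proof (intro allI impI)
          fix i assume i: "i < n"
          show "absv (a i) \<le> 1"
          proof (cases "a i = 0")
            case False
            let ?t = "a i *s ?w i"
            have nz: "?t \<noteq> 0" using False basis_nz[OF w' i] by simp
            have v0: "v \<noteq> 0" using False basis_coeffs_unique[OF w' _ i, of a "\<lambda>_. 0"] a by auto
            have "v = (\<Sum>i<n. (a i * \<pi> powi k i) *s w i)" using a by simp
            hence "pnorm x ?t \<le> pnorm x v"
              using adaptedD[OF ad i, of "\<lambda>i. a i * \<pi> powi k i"] by (simp add: pnorm_scale[OF x])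
            hence "vgauge u ?t \<le> vgauge u v" by (rule vgauge_le_of_pnorm_le[OF x nz v0 _ u])
            also have "\<dots> \<le> 1" using v gauge_mem[OF L] by simp
            finally show ?thesis unfolding tm[OF i] .
          qed simp
        qed
      next
        assume "\<forall>i<n. absv (a i) \<le> 1"
        hence "vgauge u v \<le> 1"
          unfolding a by (intro nonarch_norm_sum_le[OF gauge_norm[OF L]]) (simp_all add: tm del: scale_scale)
        thus "v \<in> rep u" using gauge_mem[OF L] by simp
      qed
      also have "\<dots> \<longleftrightarrow> v \<in> lattice_of ?w"
        using mem_scale_lattice_of[OF w', of a 1] a by simp
      finally show ?thesis .
    qed
    hence "rep u = lattice_of ?w" by blast
    hence "u = apartment_vertex w k"
      using vertex_rep(2)[OF vert] by (simp add: apartment_vertex_def)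
    thus ?thesis by blast
  qed
  thus ?thesis using x by (auto simp: apartment_def supp_def)
qed

text \<open>The lattice with basis \<open>\<pi> powi k i *s w i\<close> has chart coordinates \<open>- k i\<close>, whereas its norm is
  \<open>q powi k i\<close> at \<open>w i\<close>; whence the sign. The constant comes from the choices made in \<open>rep\<close> and
  \<open>vertex_coords\<close>.\<close>

lemma chart_pnorm:
  assumes w: "is_basis w" and xw: "x \<in> apartment w"
  shows "\<exists>C. \<forall>i<n. chart w x i = C - log q (pnorm x (w i))"
proof -
  have x: "x \<in> building" using xw by (rule apartment_building)
  have "\<exists>A>0. \<forall>i<n. vertex_coords w u i = log q A - log q (vgauge u (w i))" if u: "u \<in> supp x" for u
  proof -
    obtain k0 where "u = apartment_vertex w k0" by (rule apartmentD[OF xw u])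
    hence "\<exists>k. u = apartment_vertex w k \<and> vertex_coords w u = (\<lambda>i. - real_of_int (k i))"
      unfolding vertex_coords_def by (intro someI[of "\<lambda>a. \<exists>k. u = apartment_vertex w k \<and>
        a = (\<lambda>i. - real_of_int (k i))" "\<lambda>i. - real_of_int (k0 i)"]) auto
    then obtain k where k: "u = apartment_vertex w k" "vertex_coords w u = (\<lambda>i. - real_of_int (k i))"
      by blast
    obtain A where A: "A > 0" "\<And>i. i < n \<Longrightarrow> vgauge u (w i) = A * q powi k i"
      using apartment_vertex_vgauge(3)[OF w] k(1) by blast
    have "vertex_coords w u i = log q A - log q (vgauge u (w i))" if "i < n" for i
    proof -
      have "log q (q powi k i) = k i"
        using q_gt_1 by (simp flip: powr_real_of_int')
      thus ?thesis using A q_gt_1 that k(2) by (simp add: log_mult_pos)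
    qed
    thus ?thesis using A(1) by blast
  qed
  then obtain A where A: "\<And>u i. u \<in> supp x \<Longrightarrow> i < n \<Longrightarrow>
      vertex_coords w u i = log q (A u) - log q (vgauge u (w i))" by metis
  have "chart w x i = (\<Sum>u\<in>supp x. x u * log q (A u)) - log q (pnorm x (w i))" if i: "i < n" for i
  proof -
    have "chart w x i = (\<Sum>u\<in>supp x. x u * vertex_coords w u i)"
      by (simp add: chart_def supp_def)
    also have "\<dots> = (\<Sum>u\<in>supp x. x u * log q (A u) - x u * log q (vgauge u (w i)))"
      using A[OF _ i] by (intro sum.cong) (simp_all add: right_diff_distrib)
    finally show ?thesis
      unfolding log_pnorm[OF basis_nz[OF w i]] by (simp add: sum_subtractf)
  qed
  thus ?thesis by blast
qed

subsection \<open>Common apartments\<close>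

lemma gauge_bound:
  assumes L: "is_lattice L" and M: "is_lattice M"
  shows "\<exists>C>0. \<forall>v. gauge L v \<le> C * gauge M v"
proof -
  obtain w where w: "is_basis w" "M = lattice_of w" using M by (auto simp: is_lattice_def)
  note nn = gauge_nonneg[OF L]
  let ?C = "1 + (\<Sum>i<n. gauge L (w i))"
  have C: "gauge L (w i) \<le> ?C" if "i < n" for i
    using member_le_sum[of i "{..<n}" "\<lambda>i. gauge L (w i)"] that nn by (simp add: add.commute add_increasing2)
  have C0: "?C > 0" using sum_nonneg[of "{..<n}" "\<lambda>i. gauge L (w i)"] nn by (simp add: add_pos_nonneg)
  have "gauge L v \<le> ?C * gauge M v" for v
  proof -
    obtain a where a: "v = (\<Sum>i<n. a i *s w i)" using basis_coeffs[OF w(1)] by blast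
    have am: "absv (a i) \<le> gauge M v" if "i < n" for i
      using gauge_le_iff[OF w(1) gauge_nonneg[OF M], of a v] that a w(2) by simp
    have "absv (a i) * gauge L (w i) \<le> ?C * gauge M v" if "i < n" for i
      using mult_mono[OF am[OF that] C[OF that]] nn gauge_nonneg[OF M] by (simp add: mult.commute)
    thus ?thesis unfolding a using C0 gauge_nonneg[OF M]
      by (intro norm_combination_le[OF gauge_norm[OF L]]) (auto simp: a)
  qed
  thus ?thesis using C0 by blast
qed

lemma gauge_ratio_finite:
  assumes L: "is_lattice L" and M: "is_lattice M"
  shows "finite ((\<lambda>v. gauge L v / gauge M v) ` (- {0}))"
proof -
  obtain C where C: "C > 0" "\<And>v. gauge L v \<le> C * gauge M v" using gauge_bound[OF L M] by blast
  obtain D where D: "D > 0" "\<And>v. gauge M v \<le> D * gauge L v" using gauge_bound[OF M L] by blast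
  let ?K = "{\<lfloor>log q (1 / D)\<rfloor>..\<lceil>log q C\<rceil>}"
  have "gauge L v / gauge M v \<in> (\<lambda>k. q powi k) ` ?K" if v: "v \<noteq> 0" for v
  proof -
    have pos: "gauge L v > 0" "gauge M v > 0"
      using nonarch_normD(5)[OF gauge_norm[OF L] v] nonarch_normD(5)[OF gauge_norm[OF M] v] by auto
    obtain a where a: "gauge L v = absv a" using gauge_value[OF L] ..
    obtain b where b: "gauge M v = absv b" using gauge_value[OF M] ..
    have "a / b \<noteq> 0" using a b pos by auto
    then obtain k where "absv (a / b) = q powi k" by (rule value_group)
    hence k: "gauge L v / gauge M v = q powi k" by (simp add: a b absv_divide)
    have "q powi k \<le> C" "1 / D \<le> q powi k"
      using C(2)[of v] D(2)[of v] D(1) pos unfolding k[symmetric] by (simp_all add: field_simps)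
    hence "of_int k \<le> log q C" "log q (1 / D) \<le> of_int k"
      using C(1) D(1) q_gt_1 by (simp_all add: le_log_iff log_le_iff flip: powr_real_of_int')
    hence "k \<in> ?K" by simp linarith
    thus ?thesis unfolding k by blast
  qed
  hence "(\<lambda>v. gauge L v / gauge M v) ` (- {0}) \<subseteq> (\<lambda>k. q powi k) ` ?K" by auto
  thus ?thesis by (rule finite_subset) simp
qed

text \<open>The quotient of two norms depends on the quotients of the lattice norms that define them, and
  each of these is a bounded power of \<open>q\<close>.\<close>

lemma pnorm_ratio_finite:
  assumes x: "x \<in> building" and y: "y \<in> building"
  shows "finite ((\<lambda>v. pnorm x v / pnorm y v) ` (- {0}))"
proof -
  obtain o' where o: "o' \<in> vertices" using buildingD(2,3)[OF x] by auto
  let ?S = "supp x \<union> supp y"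
  \<comment> \<open>\<open>?F (?r v)\<close> is the quotient at \<open>v\<close>; the norm of the fixed vertex \<open>o'\<close> cancels.\<close>
  let ?r = "\<lambda>v u. if u \<in> ?S then vgauge u v / vgauge o' v else undefined"
  let ?F = "\<lambda>r. q powr ((\<Sum>u\<in>supp x. x u * log q (r u)) - (\<Sum>u\<in>supp y. y u * log q (r u)))"
  let ?P = "PiE ?S (\<lambda>u. (\<lambda>v. vgauge u v / vgauge o' v) ` (- {0}))"
  have fin: "finite ?P"
    using buildingD(1,3)[OF x] buildingD(1,3)[OF y]
    by (intro finite_PiE gauge_ratio_finite vertex_rep(1)) (auto intro: o)
  have mem: "pnorm x v / pnorm y v \<in> ?F ` ?P" if v: "v \<noteq> 0" for v
  proof (rule image_eqI)
    show "?r v \<in> ?P" by (rule PiE_I) (use v in \<open>simp_all split: if_splits\<close>)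
    have *: "(\<Sum>u\<in>supp z. z u * log q (?r v u)) =
        (\<Sum>u\<in>supp z. z u * log q (vgauge u v)) - log q (vgauge o' v)"
      if z: "z \<in> building" "supp z \<subseteq> ?S" for z
    proof -
      have "(\<Sum>u\<in>supp z. z u * log q (?r v u)) =
          (\<Sum>u\<in>supp z. z u * log q (vgauge u v) - z u * log q (vgauge o' v))"
      proof (intro sum.cong refl)
        fix u assume u: "u \<in> supp z"
        hence "u \<in> vertices" using buildingD(3)[OF z(1)] by auto
        hence "log q (vgauge u v / vgauge o' v) = log q (vgauge u v) - log q (vgauge o' v)"
          using vgauge_pos v o by (intro log_divide_pos) auto
        moreover have "u \<in> ?S" using u z(2) by auto
        ultimately show "z u * log q (?r v u) = z u * log q (vgauge u v) - z u * log q (vgauge o' v)"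
          by (simp add: right_diff_distrib)
      qed
      also have "\<dots> = (\<Sum>u\<in>supp z. z u * log q (vgauge u v)) - sum z (supp z) * log q (vgauge o' v)"
        by (simp add: sum_subtractf sum_distrib_right)
      finally show ?thesis using buildingD(4)[OF z(1)] by simp
    qed
    show "pnorm x v / pnorm y v = ?F (?r v)"
      using v *[OF x] *[OF y] by (simp add: pnorm_def powr_diff[symmetric])
  qed
  have "(\<lambda>v. pnorm x v / pnorm y v) ` (- {0}) \<subseteq> ?F ` ?P"
  proof (rule image_subsetI)
    fix v :: 'v assume "v \<in> - {0}"
    hence "v \<noteq> 0" by simp
    thus "pnorm x v / pnorm y v \<in> ?F ` ?P" by (rule mem)
  qed
  thus ?thesis by (rule finite_subset) (rule finite_imageI[OF fin])
qed

text \<open>To find a basis adapted to two norms one needs a basis adapted to one of them. The norm of a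
  vertex has such a basis by definition; this yields one for \<open>x\<close> and then one for \<open>x\<close> and \<open>y\<close>.\<close>

lemma common_apartment:
  assumes x: "x \<in> building" and y: "y \<in> building"
  obtains w where "is_basis w" "x \<in> apartment w" "y \<in> apartment w"
proof -
  obtain w0 where w0: "is_basis w0" by (rule basis_exists)
  let ?u = "apartment_vertex w0 (\<lambda>_. 0)"
  let ?o = "\<lambda>v. if v = ?u then 1 else (0::real)"
  have so: "supp ?o = {?u}" by (auto simp: supp_def)
  have o: "?o \<in> building"
    using apartment_vertex_vgauge(1)[OF w0] by (intro buildingI) (auto simp: so)
  have "?o \<in> apartment w0" using o by (auto simp: apartment_def)
  hence "adapted (pnorm ?o) w0" by (rule apartment_adapted[OF w0])
  then obtain w1 where w1: "is_basis w1" "adapted (pnorm x) w1"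
    using common_adapted_basis[OF pnorm_norm[OF o] pnorm_norm[OF x] pnorm_ratio_finite[OF o x] w0]
    by blast
  then obtain w where w: "is_basis w" "adapted (pnorm x) w" "adapted (pnorm y) w"
    using common_adapted_basis[OF pnorm_norm[OF x] pnorm_norm[OF y] pnorm_ratio_finite[OF x y] w1(1)]
    by blast
  show ?thesis
    by (rule that[OF w(1) adapted_apartment[OF w(1) x w(2)] adapted_apartment[OF w(1) y w(3)]])
qed

end

subsection \<open>Points of an apartment with given coordinates\<close>

text \<open>Numbers \<open>\<phi> i\<close> in \<open>[0, 1)\<close> are the marginals of a probability distribution on a chain of
  subsets: choose \<open>\<theta>\<close> uniformly in \<open>[0, 1)\<close> and take \<open>{i. \<theta> < \<phi> i}\<close>.\<close>

lemma chain_distribution: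
  fixes \<phi> :: "'i \<Rightarrow> real"
  assumes fin: "finite I" and \<phi>: "\<And>i. i \<in> I \<Longrightarrow> 0 \<le> \<phi> i \<and> \<phi> i < 1"
  shows "\<exists>Y :: 'i set \<Rightarrow> real. (\<forall>T. 0 \<le> Y T) \<and> sum Y (Pow I) = 1 \<and>
    (\<forall>i\<in>I. (\<Sum>T | T \<subseteq> I \<and> i \<in> T. Y T) = \<phi> i) \<and>
    (\<forall>T T'. Y T \<noteq> 0 \<longrightarrow> Y T' \<noteq> 0 \<longrightarrow> T \<subseteq> T' \<or> T' \<subseteq> T)"
proof -
  define P where "P \<theta> = {i\<in>I. \<theta> < \<phi> i}" for \<theta>
  define A where "A T = {0..<1} \<inter> {\<theta>. P \<theta> = T}" for T
  define Y where "Y T = measure lborel (A T)" for T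
  have meas: "A T \<in> sets borel" for T
  proof -
    define B where "B i = (if i \<in> T then {..<\<phi> i} else {\<phi> i..})" for i
    have B: "\<theta> \<in> B i \<longleftrightarrow> (\<theta> < \<phi> i \<longleftrightarrow> i \<in> T)" for \<theta> i by (auto simp: B_def)
    have "{\<theta>. P \<theta> = T} = (if T \<subseteq> I then (\<Inter>i\<in>I. B i) else {})"
    proof -
      have "P \<theta> = T \<longleftrightarrow> T \<subseteq> I \<and> (\<forall>i\<in>I. \<theta> < \<phi> i \<longleftrightarrow> i \<in> T)" for \<theta>
        unfolding P_def by blast
      thus ?thesis by (auto simp: B)
    qed
    moreover have "(\<Inter>i\<in>I. B i) \<in> sets borel"
    proof (cases "I = {}")
      case False
      have "B i \<in> sets borel" for i by (simp add: B_def)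
      thus ?thesis using fin False by (intro sets.finite_INT) auto
    qed simp
    ultimately show ?thesis by (auto simp: A_def intro!: sets.Int)
  qed
  have sum_meas: "(\<Sum>T\<in>F. Y T) = measure lborel (\<Union>T\<in>F. A T)" if "F \<subseteq> Pow I" for F
  proof -
    have "finite F" using that fin by (auto intro: finite_subset)
    moreover have "disjoint_family_on A F" by (auto simp: disjoint_family_on_def A_def)
    moreover have "emeasure lborel (A T) \<noteq> \<infinity>" for T
    proof -
      have "emeasure lborel (A T) \<le> emeasure lborel {0..<1::real}"
        by (intro emeasure_mono) (auto simp: A_def)
      thus ?thesis by (auto simp: top_unique)
    qed
    ultimately show ?thesis
      unfolding Y_def using meas by (intro measure_finite_Union[symmetric]) auto
  qed
  have Y0: "0 \<le> Y T" for T by (simp add: Y_def)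
  have PI: "P \<theta> \<in> Pow I" for \<theta> by (auto simp: P_def)
  have "(\<Union>T\<in>Pow I. A T) = {0..<1}"
  proof (intro equalityI subsetI)
    fix \<theta> :: real assume "\<theta> \<in> {0..<1}"
    hence "\<theta> \<in> A (P \<theta>)" by (simp add: A_def)
    thus "\<theta> \<in> (\<Union>T\<in>Pow I. A T)" using PI by blast
  qed (auto simp: A_def)
  hence Y1: "sum Y (Pow I) = 1" by (simp add: sum_meas)
  have Y2: "(\<Sum>T | T \<subseteq> I \<and> i \<in> T. Y T) = \<phi> i" if i: "i \<in> I" for i
  proof -
    have "(\<Union>T\<in>{T. T \<subseteq> I \<and> i \<in> T}. A T) = {0..<\<phi> i}"
    proof (intro equalityI subsetI)
      fix \<theta> assume "\<theta> \<in> {0..<\<phi> i}"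
      hence "\<theta> \<in> A (P \<theta>)" "i \<in> P \<theta>" using i \<phi>[OF i] by (auto simp: A_def P_def)
      thus "\<theta> \<in> (\<Union>T\<in>{T. T \<subseteq> I \<and> i \<in> T}. A T)" using PI by blast
    next
      fix \<theta> assume "\<theta> \<in> (\<Union>T\<in>{T. T \<subseteq> I \<and> i \<in> T}. A T)"
      then obtain T where "i \<in> T" "\<theta> \<in> {0..<1}" "P \<theta> = T" by (auto simp: A_def)
      thus "\<theta> \<in> {0..<\<phi> i}" by (auto simp: P_def)
    qed
    moreover have "{T. T \<subseteq> I \<and> i \<in> T} \<subseteq> Pow I" by auto
    ultimately show ?thesis using \<phi>[OF i] by (simp add: sum_meas)
  qed
  have Y3: "T \<subseteq> T' \<or> T' \<subseteq> T" if "Y T \<noteq> 0" "Y T' \<noteq> 0" for T T'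
  proof -
    have "A T \<noteq> {}" "A T' \<noteq> {}" using that by (auto simp: Y_def)
    then obtain \<theta> \<theta>' where "P \<theta> = T" "P \<theta>' = T'" by (auto simp: A_def)
    thus ?thesis unfolding P_def by (cases "\<theta> \<le> \<theta>'") auto
  qed
  show ?thesis using Y0 Y1 Y2 Y3 by blast
qed

context bruhat_tits_building
begin

lemma lattice_of_mono_exponents:
  assumes "\<And>i. i < n \<Longrightarrow> k i \<le> l i"
  shows "lattice_of (\<lambda>i. (\<pi> powi l i) *s w i) \<subseteq> lattice_of (\<lambda>i. (\<pi> powi k i) *s w i)"
proof
  fix v assume "v \<in> lattice_of (\<lambda>i. (\<pi> powi l i) *s w i)"
  then obtain a where a: "\<forall>i<n. absv (a i) \<le> 1" "v = (\<Sum>i<n. a i *s (\<pi> powi l i) *s w i)"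
    by (auto simp: lattice_of_def valuation_ring_def)
  let ?b = "\<lambda>i. a i * \<pi> powi (l i - k i)"
  have "v = (\<Sum>i<n. ?b i *s (\<pi> powi k i) *s w i)"
    unfolding a(2) by (intro sum.cong) (simp_all add: power_int_diff)
  moreover have "absv (?b i) \<le> 1" if "i < n" for i
  proof -
    have "q powi (k i - l i) \<le> q powi 0"
      using assms[OF that] q_gt_1 by (intro power_int_increasing) auto
    hence "absv (a i) * q powi (k i - l i) \<le> 1"
      using a(1) that q_gt_1 by (intro mult_le_one) auto
    thus ?thesis by (simp add: absv_mult absv_pi_powi)
  qed
  ultimately show "v \<in> lattice_of (\<lambda>i. (\<pi> powi k i) *s w i)"
    unfolding lattice_of_def valuation_ring_def mem_Collect_eq
    by (intro exI[of _ ?b] conjI allI impI)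
qed

lemma apartment_vertices_adjacent:
  assumes "apartment_vertex w k \<noteq> apartment_vertex w l"
    and "\<And>i. i < n \<Longrightarrow> k i \<le> l i" "\<And>i. i < n \<Longrightarrow> l i \<le> k i + 1"
  shows "adjacent (apartment_vertex w k) (apartment_vertex w l)"
    "adjacent (apartment_vertex w l) (apartment_vertex w k)"
proof -
  define Lk where "Lk k = lattice_of (\<lambda>i. (\<pi> powi k i) *s w i)" for k
  have pi: "scale \<pi> ` Lk k = Lk (\<lambda>i. k i + 1)" for k
    unfolding Lk_def scale_image_lattice_of by (simp add: power_int_add mult.commute)
  have 1: "Lk l \<subseteq> Lk k" "scale \<pi> ` Lk k \<subseteq> Lk l"
    unfolding pi unfolding Lk_def using assms(2,3) by (intro lattice_of_mono_exponents; simp)+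
  have cl: "apartment_vertex w k = lattice_class (Lk k)" for k
    by (simp add: apartment_vertex_def Lk_def)
  have 2: "Lk k \<in> apartment_vertex w k" for k unfolding cl by (rule lattice_class_self)
  have 3: "scale \<pi> ` Lk k \<in> apartment_vertex w k"
    unfolding cl lattice_class_scale[OF pi_nz, of "Lk k", symmetric] by (rule lattice_class_self)
  show "adjacent (apartment_vertex w l) (apartment_vertex w k)"
    unfolding adjacent_def
  proof (intro conjI bexI)
    show "scale \<pi> ` Lk k \<subseteq> Lk l" "Lk l \<subseteq> Lk k" by (rule 1)+
  qed (use assms(1) 2 in auto)
  show "adjacent (apartment_vertex w k) (apartment_vertex w l)"
    unfolding adjacent_def
  proof (intro conjI bexI)
    show "scale \<pi> ` Lk l \<subseteq> scale \<pi> ` Lk k" by (rule image_mono[OF 1(1)])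
    show "scale \<pi> ` Lk k \<subseteq> Lk l" by (rule 1)
  qed (use assms(1) 2 3 in auto)
qed

text \<open>The vertices of the point with weights \<open>c\<close> are the balls of radius \<open>q\<^sup>\<theta>\<close>,
  \<open>0 \<le> \<theta> < 1\<close>, of the norm, each counted as often as it occurs.\<close>

lemma apartment_point_exists:
  assumes w: "is_basis w"
  shows "\<exists>x\<in>apartment w. \<exists>C. \<forall>i<n. log q (pnorm x (w i)) = c i + C"
proof -
  have "0 \<le> frac (c i) \<and> frac (c i) < 1" for i by (simp add: frac_lt_1)
  then obtain Y :: "nat set \<Rightarrow> real" where Y: "\<forall>T. 0 \<le> Y T" "sum Y (Pow {..<n}) = 1"
    "\<forall>i\<in>{..<n}. (\<Sum>T | T \<subseteq> {..<n} \<and> i \<in> T. Y T) = frac (c i)"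
    "\<forall>T T'. Y T \<noteq> 0 \<longrightarrow> Y T' \<noteq> 0 \<longrightarrow> T \<subseteq> T' \<or> T' \<subseteq> T"
    using chain_distribution[of "{..<n}" "\<lambda>i. frac (c i)"] by auto
  define k where "k T i = \<lfloor>c i\<rfloor> + (if i \<in> T then 1 else 0)" for T and i :: nat
  define V where "V T = apartment_vertex w (k T)" for T
  define x where "x u = (\<Sum>T | T \<subseteq> {..<n} \<and> V T = u. Y T)" for u
  have finP: "finite {T. T \<subseteq> {..<n} \<and> R T}" for R
    by (rule finite_subset[of _ "Pow {..<n}"]) auto
  have x0: "0 \<le> x u" for u unfolding x_def using Y(1) by (intro sum_nonneg) simp
  have suppD: "\<exists>T. T \<subseteq> {..<n} \<and> V T = u \<and> Y T \<noteq> 0" if u: "u \<in> supp x" for u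
  proof (rule ccontr)
    assume "\<not> ?thesis"
    hence "x u = 0" unfolding x_def by (intro sum.neutral) auto
    thus False using u by (simp add: supp_def)
  qed
  have sub: "supp x \<subseteq> V ` Pow {..<n}" using suppD by auto
  have fin: "finite (supp x)" by (rule finite_subset[OF sub]) simp
  have transfer: "(\<Sum>u\<in>supp x. x u * h u) = (\<Sum>T\<in>Pow {..<n}. Y T * h (V T))" for h
  proof -
    have "(\<Sum>u\<in>supp x. x u * h u) = (\<Sum>u\<in>V ` Pow {..<n}. x u * h u)"
      using sub by (intro sum.mono_neutral_left) (auto simp: supp_def)
    also have "\<dots> = (\<Sum>u\<in>V ` Pow {..<n}. \<Sum>T | T \<in> Pow {..<n} \<and> V T = u. Y T * h (V T))"
      unfolding x_def by (intro sum.cong) (auto simp: sum_distrib_right intro!: sum.cong)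
    also have "\<dots> = (\<Sum>T\<in>Pow {..<n}. Y T * h (V T))"
      by (rule sum.group) auto
    finally show ?thesis .
  qed
  have x: "x \<in> building"
  proof (rule buildingI[OF fin])
    show "supp x \<subseteq> vertices"
      using sub apartment_vertex_vgauge(1)[OF w] by (auto simp: V_def)
    show "sum x (supp x) = 1" using transfer[of "\<lambda>_. 1"] Y(2) by simp
    show "0 \<le> x u" for u by (rule x0)
    fix u u' assume uu: "u \<in> supp x" "u' \<in> supp x" "u \<noteq> u'"
    obtain T T' where T: "V T = u" "Y T \<noteq> 0" "V T' = u'" "Y T' \<noteq> 0"
      using suppD[OF uu(1)] suppD[OF uu(2)] by blast
    have ne: "apartment_vertex w (k T) \<noteq> apartment_vertex w (k T')"
      using uu(3) T(1,3) by (simp add: V_def)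
    have le: "k T i \<le> k T' i" "k T' i \<le> k T i + 1" if "T \<subseteq> T'" for T T' i
      using that by (auto simp: k_def)
    have "T \<subseteq> T' \<or> T' \<subseteq> T" using Y(4) T by blast
    thus "adjacent u u'"
      using apartment_vertices_adjacent(1)[OF ne le] apartment_vertices_adjacent(2)[OF ne[symmetric] le]
      unfolding T(1,3)[symmetric] V_def by blast
  qed
  hence xw: "x \<in> apartment w" using sub by (auto simp: apartment_def supp_def V_def)
  have "\<exists>A>0. \<forall>i<n. vgauge (V T) (w i) = A * q powi k T i" for T
    unfolding V_def by (rule apartment_vertex_vgauge(3)[OF w])
  then obtain A where A: "\<And>T. A T > 0" "\<And>T i. i < n \<Longrightarrow> vgauge (V T) (w i) = A T * q powi k T i"
    by metis
  have "log q (pnorm x (w i)) = c i + (\<Sum>T\<in>Pow {..<n}. Y T * log q (A T))" if i: "i < n" for i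
  proof -
    have "log q (pnorm x (w i)) = (\<Sum>T\<in>Pow {..<n}. Y T * log q (vgauge (V T) (w i)))"
      unfolding log_pnorm[OF basis_nz[OF w i]] by (rule transfer)
    also have "\<dots> = (\<Sum>T\<in>Pow {..<n}. Y T * log q (A T) + Y T * \<lfloor>c i\<rfloor> + (if i \<in> T then Y T else 0))"
    proof (intro sum.cong refl)
      fix T
      have "log q (q powi k T i) = k T i" using q_gt_1 by (simp flip: powr_real_of_int')
      hence "log q (vgauge (V T) (w i)) = log q (A T) + k T i"
        using A(1)[of T] A(2)[OF i, of T] q_gt_1 by (simp add: log_mult_pos)
      thus "Y T * log q (vgauge (V T) (w i)) = Y T * log q (A T) + Y T * \<lfloor>c i\<rfloor> + (if i \<in> T then Y T else 0)"
        by (simp add: k_def algebra_simps)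
    qed
    also have "\<dots> = (\<Sum>T\<in>Pow {..<n}. Y T * log q (A T)) + sum Y (Pow {..<n}) * \<lfloor>c i\<rfloor>
        + (\<Sum>T\<in>Pow {..<n}. if i \<in> T then Y T else 0)"
      by (simp add: sum.distrib sum_distrib_right)
    also have "(\<Sum>T\<in>Pow {..<n}. if i \<in> T then Y T else 0) = (\<Sum>T | T \<subseteq> {..<n} \<and> i \<in> T. Y T)"
    proof -
      have "{T \<in> Pow {..<n}. i \<in> T} = {T. T \<subseteq> {..<n} \<and> i \<in> T}" by auto
      thus ?thesis using sum.inter_filter[of "Pow {..<n}" Y "\<lambda>T. i \<in> T"] by simp
    qed
    also have "\<dots> = frac (c i)" using Y(3) i by simp
    finally show ?thesis using Y(2) by (simp add: frac_def)
  qed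
  thus ?thesis using xw by blast
qed

end

section \<open>Invariant scalar products and majorization\<close>

text \<open>By permutation invariance the Gram matrix of the standard basis has one value on the diagonal
  and one off it; the vector \<open>(1, \<dots>, 1)\<close> in the radical relates the two.\<close>

lemma invariant_scalar_product_explicit:
  assumes "invariant_scalar_product n ip"
  shows "\<exists>\<kappa>>0. \<forall>a. ip a a = \<kappa> * ((\<Sum>i<n. (a i)\<^sup>2) - (\<Sum>i<n. a i)\<^sup>2 / n)"
proof -
  have shift: "ip a' b = ip a b" if "\<exists>c. \<forall>i<n. a' i = a i + c" for a a' b
    using assms that unfolding invariant_scalar_product_def by blast
  have sym: "ip a b = ip b a" for a b
    using assms unfolding invariant_scalar_product_def by blast
  have lin: "ip (\<lambda>i. r * a i + s * a' i) b = r * ip a b + s * ip a' b" for r s a a' b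
    using assms unfolding invariant_scalar_product_def by blast
  have pos: "(\<nexists>c. \<forall>i<n. a i = c) \<Longrightarrow> ip a a > 0" for a
    using assms unfolding invariant_scalar_product_def by blast
  have perm: "\<sigma> permutes {..<n} \<Longrightarrow> ip (a \<circ> \<sigma>) (b \<circ> \<sigma>) = ip a b" for \<sigma> a b
    using assms unfolding invariant_scalar_product_def by blast
  have zero: "ip (\<lambda>_. 0) b = 0" for b using lin[of 0 "\<lambda>_. 0" 0 "\<lambda>_. 0" b] by simp
  have const: "ip a b = 0" if "\<forall>i<n. a i = c" for a b c
    using shift[of a "\<lambda>_. 0" b] zero[of b] that by auto
  show ?thesis
  proof (cases "n \<le> 1")
    case True
    have "n = 0 \<or> n = 1" using True by auto
    hence "(\<Sum>i<n. (a i)\<^sup>2) - (\<Sum>i<n. a i)\<^sup>2 / n = 0" for a :: "nat \<Rightarrow> real" by auto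
    moreover have "ip a a = 0" for a
      using True by (intro const[of a "a 0"]) (auto simp: le_Suc_eq)
    ultimately show ?thesis by (intro exI[of _ 1]) simp
  next
    case False
    hence n: "2 \<le> n" by simp
    define e where "e i j = (if j = i then 1 else 0 :: real)" for i j :: nat
    have lin_sum: "ip (\<lambda>j. \<Sum>i\<in>A. c i * e i j) b = (\<Sum>i\<in>A. c i * ip (e i) b)" if "finite A" for A c b
      using that
    proof (induction A rule: finite_induct)
      case (insert k A)
      thus ?case using lin[of "c k" "e k" 1 "\<lambda>j. \<Sum>i\<in>A. c i * e i j" b] by simp
    qed (simp add: zero)
    have expand: "ip a b = (\<Sum>i<n. a i * ip (e i) b)" for a b
    proof -
      have "ip a b = ip (\<lambda>j. \<Sum>i<n. a i * e i j) b"
        by (intro shift exI[of _ 0]) (simp add: e_def if_distrib[of "\<lambda>x. _ * x"] cong: if_cong)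
      thus ?thesis by (simp add: lin_sum)
    qed
    define \<alpha> where "\<alpha> = ip (e 0) (e 0)"
    define \<beta> where "\<beta> = ip (e 0) (e 1)"
    have diag: "ip (e i) (e i) = \<alpha>" if "i < n" for i
    proof -
      let ?\<sigma> = "Transposition.transpose 0 i"
      have "?\<sigma> permutes {..<n}" using that n by (intro permutes_swap_id) auto
      moreover have "e 0 \<circ> ?\<sigma> = e i" by (auto simp: e_def Transposition.transpose_def fun_eq_iff)
      ultimately show ?thesis using perm[of ?\<sigma> "e 0" "e 0"] by (simp add: \<alpha>_def)
    qed
    have off: "ip (e i) (e j) = \<beta>" if ij: "i < n" "j < n" "i \<noteq> j" for i j
    proof -
      define j' where "j' = Transposition.transpose 0 i j"
      let ?\<sigma> = "Transposition.transpose 1 j' \<circ> Transposition.transpose 0 i"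
      have j': "j' \<noteq> 0" "j' < n" using ij by (auto simp: j'_def Transposition.transpose_def)
      have "?\<sigma> permutes {..<n}"
        using ij j' n by (intro permutes_compose permutes_swap_id) auto
      moreover have "e 0 \<circ> ?\<sigma> = e i" "e 1 \<circ> ?\<sigma> = e j"
        using j' ij by (auto simp: e_def Transposition.transpose_def fun_eq_iff j'_def split: if_splits)
      ultimately show ?thesis using perm[of ?\<sigma> "e 0" "e 1"] by (simp add: \<beta>_def)
    qed
    have "(\<Sum>j<n. ip (e j) (e 0)) = ip (\<lambda>_. 1) (e 0)" using expand[of "\<lambda>_. 1" "e 0"] by simp
    also have "\<dots> = 0" by (rule const[of _ 1]) simp
    also have "(\<Sum>j<n. ip (e j) (e 0)) = \<alpha> + (\<Sum>j\<in>{..<n} - {0}. ip (e j) (e 0))"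
      using n by (subst sum.remove[of _ 0]) (auto simp: \<alpha>_def)
    also have "(\<Sum>j\<in>{..<n} - {0}. ip (e j) (e 0)) = (\<Sum>j\<in>{..<n} - {0}. \<beta>)"
      using off n by (intro sum.cong) auto
    finally have rel: "\<alpha> + (real n - 1) * \<beta> = 0" using n by (simp add: of_nat_diff)
    have "\<nexists>c. \<forall>i<n. e 0 i = c"
    proof
      assume "\<exists>c. \<forall>i<n. e 0 i = c"
      then obtain c where "\<forall>i<n. e 0 i = c" by blast
      hence "e 0 0 = c" "e 0 1 = c" using n by auto
      thus False by (simp add: e_def)
    qed
    hence "\<alpha> > 0" unfolding \<alpha>_def by (rule pos)
    define \<kappa> where "\<kappa> = \<alpha> - \<beta>"
    have \<kappa>: "\<kappa> = - real n * \<beta>" using rel by (simp add: \<kappa>_def algebra_simps)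
    have "\<beta> < 0"
    proof (rule ccontr)
      assume "\<not> \<beta> < 0"
      hence "0 \<le> (real n - 1) * \<beta>" using n by simp
      thus False using rel \<open>\<alpha> > 0\<close> by simp
    qed
    hence "\<kappa> > 0" using \<open>\<alpha> > 0\<close> by (simp add: \<kappa>_def)
    moreover have "ip a a = \<kappa> * ((\<Sum>i<n. (a i)\<^sup>2) - (\<Sum>i<n. a i)\<^sup>2 / n)" for a
    proof -
      have "ip a a = (\<Sum>i<n. a i * (\<Sum>j<n. a j * ip (e j) (e i)))"
        by (subst expand, subst sym, subst expand) simp
      also have "\<dots> = (\<Sum>i<n. a i * (\<Sum>j<n. a j * \<beta> + (if j = i then a j * \<kappa> else 0)))"
        using diag off by (intro sum.cong arg_cong2[where f = "(*)"]) (auto simp: \<kappa>_def algebra_simps)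
      also have "\<dots> = (\<Sum>i<n. a i * (\<beta> * (\<Sum>j<n. a j)) + \<kappa> * (a i)\<^sup>2)"
        by (intro sum.cong) (simp_all add: sum.distrib sum_distrib_left power2_eq_square algebra_simps)
      also have "\<dots> = \<beta> * (\<Sum>i<n. a i)\<^sup>2 + \<kappa> * (\<Sum>i<n. (a i)\<^sup>2)"
        by (simp add: sum.distrib power2_eq_square mult_ac flip: sum_distrib_left sum_distrib_right)
      also have "\<beta> = - \<kappa> / n" using \<kappa> n by simp
      finally show ?thesis by (simp add: algebra_simps)
    qed
    ultimately show ?thesis by blast
  qed
qed

lemma hinge_has_integral:
  fixes u M :: real
  assumes "\<bar>u\<bar> \<le> M"
  shows "((\<lambda>s. max (u - s) 0) has_integral ((u + M)\<^sup>2 / 2)) {- M..M}"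
proof -
  have 1: "((\<lambda>s. u - s) has_integral (- ((u - u)\<^sup>2 / 2) - - ((u - - M)\<^sup>2 / 2))) {- M..u}"
    using assms by (intro fundamental_theorem_of_calculus)
      (auto intro!: derivative_eq_intros simp: field_simps simp flip: has_real_derivative_iff_has_vector_derivative)
  have 2: "((\<lambda>s. max (u - s) 0) has_integral ((u + M)\<^sup>2 / 2)) {- M..u}"
    by (rule has_integral_eq[OF _ 1[simplified]]) auto
  have 3: "((\<lambda>s. max (u - s) 0) has_integral 0) {u..M}"
    by (rule has_integral_eq[OF _ has_integral_0]) auto
  show ?thesis
    using has_integral_combine[OF _ _ 2 3] assms by simp
qed

text \<open>Majorization \<open>u \<prec> \<mu>\<close> bounds sums of convex functions. Here the hinge functions
  \<open>max (x - s) 0\<close> are compared first, and the squares are integrals of hinge functions over \<open>s\<close>.\<close>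

lemma majorization_sum_squares:
  fixes u \<mu> :: "nat \<Rightarrow> real"
  assumes maj: "\<And>J. J \<subseteq> {..<n} \<Longrightarrow> \<exists>L\<subseteq>{..<n}. card L = card J \<and> sum u J \<le> sum \<mu> L"
    and eq: "sum u {..<n} = sum \<mu> {..<n}"
  shows "(\<Sum>i<n. (u i)\<^sup>2) \<le> (\<Sum>i<n. (\<mu> i)\<^sup>2)"
proof -
  have hinge: "(\<Sum>i<n. max (u i - s) 0) \<le> (\<Sum>i<n. max (\<mu> i - s) 0)" for s
  proof -
    \<comment> \<open>the index set at which the hinge functions of \<open>u\<close> do not vanish\<close>
    let ?J = "{i\<in>{..<n}. u i > s}"
    obtain L where L: "L \<subseteq> {..<n}" "card L = card ?J" "sum u ?J \<le> sum \<mu> L"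
      using maj[of ?J] by auto
    have finL: "finite L" using L(1) by (rule finite_subset) simp
    have "(\<Sum>i<n. max (u i - s) 0) = (\<Sum>i\<in>?J. max (u i - s) 0)"
      by (intro sum.mono_neutral_right) auto
    also have "\<dots> = (\<Sum>i\<in>?J. u i - s)" by (intro sum.cong) auto
    also have "\<dots> \<le> (\<Sum>i\<in>L. \<mu> i - s)" using L by (simp add: sum_subtractf)
    also have "\<dots> \<le> (\<Sum>i\<in>L. max (\<mu> i - s) 0)" by (intro sum_mono) simp
    also have "\<dots> \<le> (\<Sum>i<n. max (\<mu> i - s) 0)" using L(1) by (intro sum_mono2) auto
    finally show ?thesis .
  qed
  define M where "M = (\<Sum>i<n. \<bar>u i\<bar>) + (\<Sum>i<n. \<bar>\<mu> i\<bar>)"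
  have M: "\<bar>u i\<bar> \<le> M" "\<bar>\<mu> i\<bar> \<le> M" if "i < n" for i
  proof -
    have "\<bar>u i\<bar> \<le> (\<Sum>i<n. \<bar>u i\<bar>)" "\<bar>\<mu> i\<bar> \<le> (\<Sum>i<n. \<bar>\<mu> i\<bar>)"
      using that member_le_sum[of i "{..<n}" "\<lambda>i. \<bar>u i\<bar>"] member_le_sum[of i "{..<n}" "\<lambda>i. \<bar>\<mu> i\<bar>"] by auto
    moreover have "0 \<le> (\<Sum>i<n. \<bar>u i\<bar>)" "0 \<le> (\<Sum>i<n. \<bar>\<mu> i\<bar>)" by (intro sum_nonneg; simp)+
    ultimately show "\<bar>u i\<bar> \<le> M" "\<bar>\<mu> i\<bar> \<le> M" by (simp_all add: M_def)
  qed
  have int: "((\<lambda>s. \<Sum>i<n. max (v i - s) 0) has_integral (\<Sum>i<n. (v i + M)\<^sup>2 / 2)) {- M..M}"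
    if "\<And>i. i < n \<Longrightarrow> \<bar>v i\<bar> \<le> M" for v
    using that by (intro has_integral_sum hinge_has_integral) auto
  have "(\<Sum>i<n. (u i + M)\<^sup>2 / 2) \<le> (\<Sum>i<n. (\<mu> i + M)\<^sup>2 / 2)"
    by (rule has_integral_le[OF int int]) (use M hinge in auto)
  moreover have "(\<Sum>i<n. (v i + M)\<^sup>2 / 2) = (\<Sum>i<n. (v i)\<^sup>2) / 2 + M * sum v {..<n} + n * M\<^sup>2 / 2" for v
    by (simp add: power2_sum add_divide_distrib sum.distrib sum_divide_distrib sum_distrib_left mult_ac)
  ultimately show ?thesis using eq by simp
qed

section \<open>Minors\<close>

lemma leibniz_repeated_row:
  fixes b :: "nat \<Rightarrow> nat \<Rightarrow> 'a :: field_char_0"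
  assumes "finite J" "i1 \<in> J" "i2 \<in> J" "i1 \<noteq> i2" "\<phi> i1 = \<phi> i2"
  shows "(\<Sum>\<tau> | \<tau> permutes J. of_int (sign \<tau>) * (\<Prod>i\<in>J. b (\<phi> i) (\<tau> i))) = 0"
    (is "?S = 0")
proof -
  let ?t = "Transposition.transpose i1 i2"
  have t: "?t permutes J" using assms by (intro permutes_swap_id)
  have "?S = (\<Sum>\<tau> | \<tau> permutes J. of_int (sign (\<tau> \<circ> ?t)) * (\<Prod>i\<in>J. b (\<phi> i) ((\<tau> \<circ> ?t) i)))"
    by (rule sum_permutations_compose_right[OF t])
  also have "\<dots> = (\<Sum>\<tau> | \<tau> permutes J. - (of_int (sign \<tau>) * (\<Prod>i\<in>J. b (\<phi> i) (\<tau> i))))"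
  proof (intro sum.cong refl)
    fix \<tau> assume "\<tau> \<in> {\<tau>. \<tau> permutes J}"
    hence \<tau>: "permutation \<tau>" using assms(1) permutation_permutes by auto
    have "sign (\<tau> \<circ> ?t) = - sign \<tau>"
      using \<tau> assms(4) by (simp add: sign_compose permutation_swap_id sign_swap_id)
    moreover have "(\<Prod>i\<in>J. b (\<phi> i) ((\<tau> \<circ> ?t) i)) = (\<Prod>i\<in>J. b (\<phi> (?t i)) (\<tau> i))"
    proof -
      have "(\<Prod>i\<in>J. b (\<phi> (?t i)) (\<tau> i)) = (\<Prod>i\<in>J. b (\<phi> (?t (?t i))) (\<tau> (?t i)))"
        by (rule prod.permute[OF t, unfolded comp_def])
      thus ?thesis by simp
    qed
    moreover have "\<phi> (?t i) = \<phi> i" for i using assms(5) by (auto simp: Transposition.transpose_def)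
    ultimately show "of_int (sign (\<tau> \<circ> ?t)) * (\<Prod>i\<in>J. b (\<phi> i) ((\<tau> \<circ> ?t) i)) =
        - (of_int (sign \<tau>) * (\<Prod>i\<in>J. b (\<phi> i) (\<tau> i)))" by simp
  qed
  also have "\<dots> = - ?S" by (rule sum_negf)
  finally have S: "?S = - ?S" .
  have "x = 0" if "x = - x" for x :: 'a
  proof -
    have "x + x = 0" using that by (simp add: eq_neg_iff_add_eq_0)
    hence "2 * x = 0" unfolding mult_2 .
    thus ?thesis by simp
  qed
  from this[OF S] show ?thesis .
qed

text \<open>The Cauchy--Binet expansion of a minor of a product of matrices: the terms with a repeated
  row cancel.\<close>

lemma (in padic_field) minor_of_product_term:
  fixes a b :: "nat \<Rightarrow> nat \<Rightarrow> 'k"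
  assumes J: "finite J" and K: "finite K"
    and D: "D = (\<Sum>\<tau> | \<tau> permutes J. of_int (sign \<tau>) * (\<Prod>i\<in>J. \<Sum>j\<in>K. a i j * b j (\<tau> i)))"
    and "D \<noteq> 0"
  shows "\<exists>\<phi> \<tau>. inj_on \<phi> J \<and> \<phi> ` J \<subseteq> K \<and> \<tau> permutes J \<and>
    absv D \<le> (\<Prod>i\<in>J. absv (a i (\<phi> i))) * (\<Prod>i\<in>J. absv (b (\<phi> i) (\<tau> i)))"
proof -
  let ?P = "{\<tau>. \<tau> permutes J}" and ?F = "PiE J (\<lambda>_. K)"
  define R where "R \<phi> = (\<Sum>\<tau>\<in>?P. of_int (sign \<tau>) * (\<Prod>i\<in>J. b (\<phi> i) (\<tau> i)))" for \<phi>
  have finP: "finite ?P" using J by (rule finite_permutations)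
  have finF: "finite ?F" using J K by (intro finite_PiE) auto
  have prod: "(\<Prod>i\<in>J. \<Sum>j\<in>K. a i j * b j (\<tau> i)) =
      (\<Sum>\<phi>\<in>?F. (\<Prod>i\<in>J. a i (\<phi> i)) * (\<Prod>i\<in>J. b (\<phi> i) (\<tau> i)))" for \<tau>
    unfolding prod.distrib[symmetric] by (rule prod_sum_PiE[OF J K])
  have "D = (\<Sum>\<tau>\<in>?P. \<Sum>\<phi>\<in>?F. of_int (sign \<tau>) * ((\<Prod>i\<in>J. a i (\<phi> i)) * (\<Prod>i\<in>J. b (\<phi> i) (\<tau> i))))"
    unfolding D prod sum_distrib_left ..
  also have "\<dots> = (\<Sum>\<phi>\<in>?F. \<Sum>\<tau>\<in>?P. of_int (sign \<tau>) * ((\<Prod>i\<in>J. a i (\<phi> i)) * (\<Prod>i\<in>J. b (\<phi> i) (\<tau> i))))"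
    by (rule sum.swap)
  also have "\<dots> = (\<Sum>\<phi>\<in>?F. (\<Prod>i\<in>J. a i (\<phi> i)) * R \<phi>)"
    unfolding R_def sum_distrib_left by (intro sum.cong refl) (simp add: mult_ac)
  finally have DR: "D = (\<Sum>\<phi>\<in>?F. (\<Prod>i\<in>J. a i (\<phi> i)) * R \<phi>)" .
  have "?F \<noteq> {}" using DR \<open>D \<noteq> 0\<close> by auto
  from absv_sum_le[OF finF this, of "\<lambda>\<phi>. (\<Prod>i\<in>J. a i (\<phi> i)) * R \<phi>", folded DR]
  obtain \<phi> where \<phi>: "\<phi> \<in> ?F" "absv D \<le> absv ((\<Prod>i\<in>J. a i (\<phi> i)) * R \<phi>)" ..
  have "R \<phi> \<noteq> 0"
  proof
    assume "R \<phi> = 0"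
    hence "absv D \<le> 0" using \<phi>(2) by simp
    thus False using absv_pos[OF \<open>D \<noteq> 0\<close>] by simp
  qed
  hence inj: "inj_on \<phi> J"
    using leibniz_repeated_row[OF J, of _ _ \<phi> b] unfolding R_def inj_on_def by blast
  have "?P \<noteq> {}" using permutes_id by blast
  from absv_sum_le[OF finP this, of "\<lambda>\<tau>. of_int (sign \<tau>) * (\<Prod>i\<in>J. b (\<phi> i) (\<tau> i))"]
  obtain \<tau> where \<tau>: "\<tau> permutes J"
    "absv (R \<phi>) \<le> absv (of_int (sign \<tau>) * (\<Prod>i\<in>J. b (\<phi> i) (\<tau> i)))"
    unfolding R_def[symmetric] by blast
  have "absv (of_int (sign \<tau>) * (\<Prod>i\<in>J. b (\<phi> i) (\<tau> i))) = (\<Prod>i\<in>J. absv (b (\<phi> i) (\<tau> i)))"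
    by (simp add: sign_def absv_prod)
  with \<tau>(2) have "absv (R \<phi>) \<le> (\<Prod>i\<in>J. absv (b (\<phi> i) (\<tau> i)))" by simp
  hence "(\<Prod>i\<in>J. absv (a i (\<phi> i))) * absv (R \<phi>) \<le>
      (\<Prod>i\<in>J. absv (a i (\<phi> i))) * (\<Prod>i\<in>J. absv (b (\<phi> i) (\<tau> i)))"
    by (intro mult_left_mono prod_nonneg) (auto simp: absv_nonneg)
  hence "absv D \<le> (\<Prod>i\<in>J. absv (a i (\<phi> i))) * (\<Prod>i\<in>J. absv (b (\<phi> i) (\<tau> i)))"
    using \<phi>(2) by (simp add: absv_mult absv_prod)
  moreover have "\<phi> ` J \<subseteq> K" using \<phi>(1) by auto
  ultimately show ?thesis using inj \<tau>(1) by blast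
qed

context bruhat_tits_building
begin

section \<open>Relative position of two norms\<close>

lemma dominant_diagonal:
  assumes M: "nonarch_norm M" and ad: "adapted M f" and e: "e \<noteq> 0" "e = (\<Sum>l<n. c l *s f l)"
    and i: "i < n" and generic: "\<And>l a. l < n \<Longrightarrow> l \<noteq> i \<Longrightarrow> M e \<noteq> absv a * M (f l)"
  shows "absv (c i) * M (f i) = M e" "\<And>l. l < n \<Longrightarrow> l \<noteq> i \<Longrightarrow> absv (c l) * M (f l) < M e"
proof -
  have le: "absv (c l) * M (f l) \<le> M e" if "l < n" for l
    unfolding e(2) by (rule adaptedD[OF ad that])
  show lt: "absv (c l) * M (f l) < M e" if "l < n" "l \<noteq> i" for l
    using le[OF that(1)] generic[OF that, of "c l"] by simp
  obtain l where l: "l < n" "M e \<le> absv (c l) * M (f l)"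
    using norm_combination_le_term[OF M, of c f] e by metis
  have "l = i" using lt[OF l(1)] l(2) by force
  thus "absv (c i) * M (f i) = M e" using le[OF i] l by simp
qed

text \<open>If the diagonal of a matrix dominates after scaling by a norm, the identity permutation
  gives the only term of largest absolute value in each principal minor.\<close>

lemma principal_minor_ge:
  assumes J: "finite J" and m: "\<And>i. i \<in> J \<Longrightarrow> 0 < m i" "\<And>i. i \<in> J \<Longrightarrow> 0 < m' i"
    and diag: "\<And>i. i \<in> J \<Longrightarrow> absv (c i i) * m' i = m i"
    and off: "\<And>i l. i \<in> J \<Longrightarrow> l \<in> J \<Longrightarrow> l \<noteq> i \<Longrightarrow> absv (c i l) * m' l < m i"
  shows "(\<Prod>i\<in>J. absv (c i i)) \<le> absv (\<Sum>\<tau> | \<tau> permutes J. of_int (sign \<tau>) * (\<Prod>i\<in>J. c i (\<tau> i)))"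
proof (rule ccontr)
  let ?t = "\<lambda>\<tau>. of_int (sign \<tau>) * (\<Prod>i\<in>J. c i (\<tau> i))"
  let ?P = "{\<tau>. \<tau> permutes J}"
  let ?d = "\<Prod>i\<in>J. absv (c i i)"
  assume "\<not> ?thesis"
  hence small: "absv (sum ?t ?P) < ?d" by simp
  have d0: "?d > 0"
    using m diag by (intro prod_pos) (metis absv_nonneg less_eq_real_def mult_zero_left)
  have abst: "absv (?t \<tau>) = (\<Prod>i\<in>J. absv (c i (\<tau> i)))" for \<tau>
    by (simp add: sign_def absv_prod absv_mult)
  have lt: "absv (?t \<tau>) < ?d" if \<tau>: "\<tau> permutes J" "\<tau> \<noteq> id" for \<tau>
  proof -
    obtain i where "\<tau> i \<noteq> i" using \<tau>(2) by (auto simp: fun_eq_iff)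
    hence i: "i \<in> J" "\<tau> i \<noteq> i" using \<tau>(1) by (auto simp: permutes_def)
    have \<tau>J: "\<tau> l \<in> J" if "l \<in> J" for l using permutes_in_image[OF \<tau>(1)] that by simp
    have le: "absv (c l (\<tau> l)) * m' (\<tau> l) \<le> m l" if "l \<in> J" for l
      using diag[OF that] off[OF that \<tau>J[OF that]] by (cases "\<tau> l = l") auto
    have nn: "0 \<le> absv (c l (\<tau> l)) * m' (\<tau> l)" if "l \<in> J" for l
      using m(2)[OF \<tau>J[OF that]] absv_nonneg by simp
    let ?g = "\<lambda>l. absv (c l (\<tau> l)) * m' (\<tau> l)"
    have "(\<Prod>l\<in>J. ?g l) = ?g i * (\<Prod>l\<in>J - {i}. ?g l)"
      by (rule prod.remove[OF J i(1)])
    also have "\<dots> \<le> ?g i * (\<Prod>l\<in>J - {i}. m l)"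
      using nn i(1) le by (intro mult_left_mono prod_mono) auto
    also have "\<dots> < m i * (\<Prod>l\<in>J - {i}. m l)"
      using off[OF i(1) \<tau>J[OF i(1)] i(2)] m(1) by (intro mult_strict_right_mono prod_pos) auto
    also have "\<dots> = (\<Prod>l\<in>J. m l)" by (rule prod.remove[OF J i(1), symmetric])
    also have "\<dots> = (\<Prod>l\<in>J. absv (c l l) * m' l)" using diag by simp
    finally have "(\<Prod>l\<in>J. absv (c l (\<tau> l))) * (\<Prod>l\<in>J. m' (\<tau> l)) < ?d * (\<Prod>l\<in>J. m' l)"
      by (simp add: prod.distrib)
    moreover have "(\<Prod>l\<in>J. m' (\<tau> l)) = (\<Prod>l\<in>J. m' l)"
      using prod.permute[OF \<tau>(1), of m'] by (simp add: comp_def)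
    moreover have "(\<Prod>l\<in>J. m' l) > 0" using m(2) by (intro prod_pos) auto
    ultimately show ?thesis unfolding abst by simp
  qed
  let ?R = "?P - {id}"
  have finP: "finite ?P" using J by (rule finite_permutations)
  have split: "sum ?t ?P = ?t id + sum ?t ?R"
    using finP permutes_id[of J] by (intro sum.remove) auto
  have "absv (sum ?t ?R) < ?d"
  proof (cases "?R = {}")
    case False
    have "finite ?R" using finP by simp
    from absv_sum_le[OF this False, of ?t] lt show ?thesis by (blast intro: le_less_trans)
  qed (use d0 in \<open>simp only: sum.empty absv_0\<close>)
  hence "absv (sum ?t ?P - sum ?t ?R) < ?d"
    using absv_ultrametric[of "sum ?t ?P" "- sum ?t ?R"] small by simp
  moreover have "sum ?t ?P - sum ?t ?R = ?t id" using split by simp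
  moreover have "absv (?t id) = ?d" using abst[of id] by simp
  ultimately show False by simp
qed

text \<open>In a basis \<open>h\<close> adapted to both \<open>X\<close> and \<open>Z\<close> their relative position is given by the numbers
  \<open>log Z (h l) - log X (h l)\<close>. If a generic norm \<open>M\<close> is adapted to both \<open>e\<close> and \<open>f\<close>, this
  relative position majorizes the one computed by identifying \<open>e\<close> with \<open>f\<close> as \<open>M\<close> prescribes.
  The principal minors of the transition matrix from \<open>e\<close> to \<open>f\<close> are controlled by \<open>M\<close>; expanded
  through \<open>h\<close> they are bounded by values of \<open>X\<close> and \<open>Z\<close>.\<close>

lemma relative_position_majorizes:
  assumes X: "nonarch_norm X" and Z: "nonarch_norm Z" and M: "nonarch_norm M"
    and h: "is_basis h" and f: "is_basis f"
    and ad: "adapted X h" "adapted Z f" "adapted M f"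
    and e: "\<And>i. i < n \<Longrightarrow> e i \<noteq> 0"
    and generic: "\<And>i j a. i < n \<Longrightarrow> j < n \<Longrightarrow> i \<noteq> j \<Longrightarrow> M (e i) \<noteq> absv a * M (f j)"
    and J: "J \<subseteq> {..<n}"
  shows "\<exists>L\<subseteq>{..<n}. card L = card J \<and>
    (\<Sum>i\<in>J. (log q (Z (f i)) - log q (M (f i))) - (log q (X (e i)) - log q (M (e i))))
      \<le> (\<Sum>l\<in>L. log q (Z (h l)) - log q (X (h l)))"
proof -
  have "\<exists>a. e i = (\<Sum>j<n. a j *s h j)" for i using basis_coeffs[OF h, of "e i"] by metis
  then obtain a where a: "\<And>i. e i = (\<Sum>j<n. a i j *s h j)" by metis
  have "\<exists>b. h j = (\<Sum>l<n. b l *s f l)" for j using basis_coeffs[OF f, of "h j"] by metis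
  then obtain b where b: "\<And>j. h j = (\<Sum>l<n. b j l *s f l)" by metis
  define c where "c i l = (\<Sum>j<n. a i j * b j l)" for i l
  have c: "e i = (\<Sum>l<n. c i l *s f l)" for i
  proof -
    have "e i = (\<Sum>j<n. \<Sum>l<n. (a i j * b j l) *s f l)"
      unfolding a[of i] by (intro sum.cong refl) (subst b, simp add: scale_sum_right)
    also have "\<dots> = (\<Sum>l<n. \<Sum>j<n. (a i j * b j l) *s f l)" by (rule sum.swap)
    finally show ?thesis by (simp add: c_def scale_sum_left)
  qed
  have pos: "0 < N v" if "nonarch_norm N" "v \<noteq> 0" for N v by (rule nonarch_normD(5)[OF that])
  note e0 = pos[OF _ e] and f0 = pos[OF _ basis_nz[OF f]] and h0 = pos[OF _ basis_nz[OF h]]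
  have diag: "absv (c i i) * M (f i) = M (e i)"
    and off: "\<And>l. l < n \<Longrightarrow> l \<noteq> i \<Longrightarrow> absv (c i l) * M (f l) < M (e i)" if i: "i < n" for i
    using dominant_diagonal[OF M ad(3) e[OF i] c[of i] i] generic[OF i] by blast+
  have finJ: "finite J" using J by (rule finite_subset) simp
  define D where "D = (\<Sum>\<tau> | \<tau> permutes J. of_int (sign \<tau>) * (\<Prod>i\<in>J. c i (\<tau> i)))"
  have Dge: "(\<Prod>i\<in>J. absv (c i i)) \<le> absv D"
    unfolding D_def
    by (rule principal_minor_ge[OF finJ, of "\<lambda>i. M (e i)" "\<lambda>i. M (f i)"])
      (use J e0[OF M] f0[OF M] diag off in blast)+
  have cpos: "absv (c i i) > 0" if "i \<in> J" for i
  proof -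
    have "i < n" using J that by auto
    thus ?thesis using diag[of i] e0[OF M, of i] absv_nonneg[of "c i i"] by (cases "c i i = 0") (auto intro: absv_pos)
  qed
  hence "(\<Prod>i\<in>J. absv (c i i)) > 0" by (intro prod_pos)
  hence "D \<noteq> 0" using Dge by auto
  have "D = (\<Sum>\<tau> | \<tau> permutes J. of_int (sign \<tau>) * (\<Prod>i\<in>J. \<Sum>j\<in>{..<n}. a i j * b j (\<tau> i)))"
    unfolding D_def c_def ..
  from minor_of_product_term[OF finJ _ this \<open>D \<noteq> 0\<close>]
  obtain \<phi> \<tau> where \<phi>: "inj_on \<phi> J" "\<phi> ` J \<subseteq> {..<n}" and \<tau>: "\<tau> permutes J"
    and le: "absv D \<le> (\<Prod>i\<in>J. absv (a i (\<phi> i))) * (\<Prod>i\<in>J. absv (b (\<phi> i) (\<tau> i)))" by auto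
  have prod_pos': "0 < (\<Prod>i\<in>J. absv (a i (\<phi> i))) * (\<Prod>i\<in>J. absv (b (\<phi> i) (\<tau> i)))"
    using le Dge \<open>(\<Prod>i\<in>J. absv (c i i)) > 0\<close> by linarith
  have apos: "absv (a i (\<phi> i)) > 0" and bpos: "absv (b (\<phi> i) (\<tau> i)) > 0" if "i \<in> J" for i
  proof -
    have "(\<Prod>i\<in>J. absv (a i (\<phi> i))) \<noteq> 0" "(\<Prod>i\<in>J. absv (b (\<phi> i) (\<tau> i))) \<noteq> 0"
      using prod_pos' by auto
    hence "absv (a i (\<phi> i)) \<noteq> 0" "absv (b (\<phi> i) (\<tau> i)) \<noteq> 0"
      using finJ that by (simp_all add: prod_zero_iff)
    thus "absv (a i (\<phi> i)) > 0" "absv (b (\<phi> i) (\<tau> i)) > 0"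
      using absv_nonneg by (simp_all add: less_le)
  qed
  have logprod: "log q (\<Prod>i\<in>J. g i) = (\<Sum>i\<in>J. log q (g i))" if "\<And>i. i \<in> J \<Longrightarrow> g i > 0" for g
  proof -
    have "ln (\<Prod>i\<in>J. g i) = (\<Sum>i\<in>J. ln (g i))" using that by (intro ln_prod[OF finJ]) force
    thus ?thesis by (simp add: log_def sum_divide_distrib)
  qed
  have "log q (\<Prod>i\<in>J. absv (c i i)) \<le> log q ((\<Prod>i\<in>J. absv (a i (\<phi> i))) * (\<Prod>i\<in>J. absv (b (\<phi> i) (\<tau> i))))"
    using Dge le \<open>(\<Prod>i\<in>J. absv (c i i)) > 0\<close> q_gt_1 prod_pos' by simp
  also have "\<dots> = (\<Sum>i\<in>J. log q (absv (a i (\<phi> i)))) + (\<Sum>i\<in>J. log q (absv (b (\<phi> i) (\<tau> i))))"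
    using apos bpos by (subst log_mult_pos) (auto intro!: prod_pos simp: logprod)
  also have "(\<Sum>i\<in>J. log q (absv (a i (\<phi> i)))) \<le> (\<Sum>i\<in>J. log q (X (e i)) - log q (X (h (\<phi> i))))"
  proof (rule sum_mono)
    fix i assume i: "i \<in> J"
    hence i': "i < n" "\<phi> i < n" using J \<phi>(2) by auto
    have "absv (a i (\<phi> i)) * X (h (\<phi> i)) \<le> X (e i)"
      unfolding a[of i] by (rule adaptedD[OF ad(1) i'(2)])
    hence "log q (absv (a i (\<phi> i)) * X (h (\<phi> i))) \<le> log q (X (e i))"
      using apos[OF i] h0[OF X i'(2)] e0[OF X i'(1)] q_gt_1 by simp
    thus "log q (absv (a i (\<phi> i))) \<le> log q (X (e i)) - log q (X (h (\<phi> i)))"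
      using log_mult_pos[OF apos[OF i] h0[OF X i'(2)], of q] by simp
  qed
  also have "(\<Sum>i\<in>J. log q (absv (b (\<phi> i) (\<tau> i)))) \<le> (\<Sum>i\<in>J. log q (Z (h (\<phi> i))) - log q (Z (f (\<tau> i))))"
  proof (rule sum_mono)
    fix i assume i: "i \<in> J"
    hence i': "\<tau> i < n" "\<phi> i < n" using J \<phi>(2) permutes_in_image[OF \<tau>, of i] by auto
    have "absv (b (\<phi> i) (\<tau> i)) * Z (f (\<tau> i)) \<le> Z (h (\<phi> i))"
      unfolding b[of "\<phi> i"] by (rule adaptedD[OF ad(2) i'(1)])
    hence "log q (absv (b (\<phi> i) (\<tau> i)) * Z (f (\<tau> i))) \<le> log q (Z (h (\<phi> i)))"
      using bpos[OF i] f0[OF Z i'(1)] h0[OF Z i'(2)] q_gt_1 by simp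
    thus "log q (absv (b (\<phi> i) (\<tau> i))) \<le> log q (Z (h (\<phi> i))) - log q (Z (f (\<tau> i)))"
      using log_mult_pos[OF bpos[OF i] f0[OF Z i'(1)], of q] by simp
  qed
  also have "log q (\<Prod>i\<in>J. absv (c i i)) = (\<Sum>i\<in>J. log q (M (e i)) - log q (M (f i)))"
  proof (subst logprod, erule cpos, intro sum.cong refl)
    fix i assume i: "i \<in> J"
    hence i': "i < n" using J by auto
    show "log q (absv (c i i)) = log q (M (e i)) - log q (M (f i))"
      using log_mult_pos[OF cpos[OF i] f0[OF M i'], of q] diag[OF i'] by simp
  qed
  finally have "(\<Sum>i\<in>J. log q (M (e i)) - log q (M (f i))) \<le>
      (\<Sum>i\<in>J. log q (X (e i)) - log q (X (h (\<phi> i)))) +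
      (\<Sum>i\<in>J. log q (Z (h (\<phi> i))) - log q (Z (f (\<tau> i))))" by simp
  moreover have "(\<Sum>i\<in>J. log q (Z (f (\<tau> i)))) = (\<Sum>i\<in>J. log q (Z (f i)))"
    using sum.permute[OF \<tau>, of "\<lambda>i. log q (Z (f i))"] by (simp add: comp_def)
  moreover have "(\<Sum>l\<in>\<phi> ` J. log q (Z (h l)) - log q (X (h l))) =
      (\<Sum>i\<in>J. log q (Z (h (\<phi> i))) - log q (X (h (\<phi> i))))"
    by (simp add: sum.reindex[OF \<phi>(1)])
  ultimately have "(\<Sum>i\<in>J. (log q (Z (f i)) - log q (M (f i))) - (log q (X (e i)) - log q (M (e i))))
      \<le> (\<Sum>l\<in>\<phi> ` J. log q (Z (h l)) - log q (X (h l)))"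
    by (simp add: sum_subtractf)
  moreover have "card (\<phi> ` J) = card J" using \<phi>(1) by (rule card_image)
  ultimately show ?thesis using \<phi>(2) by blast
qed

text \<open>The largest term of \<open>e i\<close> in the basis \<open>f\<close> has a norm in the same coset of \<open>q\<^sup>\<int>\<close> as \<open>e i\<close>. For
  different \<open>i\<close> the cosets are different, so that these terms belong to different vectors of \<open>f\<close>.\<close>

lemma match_generic_bases:
  assumes M: "nonarch_norm M" and e: "\<And>i. i < n \<Longrightarrow> e i \<noteq> 0"
    and f: "is_basis f" and ad: "adapted M f"
    and generic: "\<And>i j a. i < n \<Longrightarrow> j < n \<Longrightarrow> i \<noteq> j \<Longrightarrow> M (e i) \<noteq> absv a * M (e j)"
  obtains \<pi>' where "bij_betw \<pi>' {..<n} {..<n}"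
    "\<And>i j a. i < n \<Longrightarrow> j < n \<Longrightarrow> i \<noteq> j \<Longrightarrow> M (e i) \<noteq> absv a * M (f (\<pi>' j))"
    "\<And>i j a. i < n \<Longrightarrow> j < n \<Longrightarrow> i \<noteq> j \<Longrightarrow> M (f (\<pi>' i)) \<noteq> absv a * M (e j)"
proof -
  have "\<exists>l a. i < n \<longrightarrow> l < n \<and> M (e i) = absv a * M (f l)" for i
  proof (cases "i < n")
    case True
    obtain c where c: "e i = (\<Sum>l<n. c l *s f l)" using basis_coeffs[OF f, of "e i"] by metis
    obtain l where l: "l < n" "M (e i) \<le> absv (c l) * M (f l)"
      using norm_combination_le_term[OF M, of c f] c e[OF True] by metis
    have "absv (c l) * M (f l) \<le> M (e i)" unfolding c by (rule adaptedD[OF ad l(1)])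
    with l have "M (e i) = absv (c l) * M (f l)" by simp
    with l(1) show ?thesis by blast
  qed auto
  then obtain \<pi>' a where pa: "\<And>i. i < n \<Longrightarrow> \<pi>' i < n \<and> M (e i) = absv (a i) * M (f (\<pi>' i))" by metis
  have a0: "absv (a i) > 0" if "i < n" for i
  proof -
    have "M (e i) > 0" by (rule nonarch_normD(5)[OF M e[OF that]])
    hence "a i \<noteq> 0" using pa[OF that] by auto
    thus ?thesis by (rule absv_pos)
  qed
  have fe: "M (f (\<pi>' j)) = absv (inverse (a j)) * M (e j)" if "j < n" for j
    using pa[OF that] a0[OF that] by (simp add: absv_inverse)
  have g1: "M (e i) \<noteq> absv b * M (f (\<pi>' j))" if ij: "i < n" "j < n" "i \<noteq> j" for i j b
    using generic[OF ij, of "b * inverse (a j)"] unfolding fe[OF ij(2)] by (simp add: absv_mult mult.assoc)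
  show ?thesis
  proof (rule that)
    have "inj_on \<pi>' {..<n}"
    proof (rule inj_onI)
      fix i j assume ij: "i \<in> {..<n}" "j \<in> {..<n}" "\<pi>' i = \<pi>' j"
      show "i = j" using g1[of i j "a i"] pa[of i] ij by auto
    qed
    moreover have "\<pi>' ` {..<n} \<subseteq> {..<n}" using pa by auto
    ultimately show "bij_betw \<pi>' {..<n} {..<n}"
      by (simp add: bij_betw_def endo_inj_surj)
    show "M (e i) \<noteq> absv b * M (f (\<pi>' j))" if "i < n" "j < n" "i \<noteq> j" for i j b
      by (rule g1[OF that])
    show "M (f (\<pi>' i)) \<noteq> absv b * M (e j)" if ij: "i < n" "j < n" "i \<noteq> j" for i j b
    proof
      assume "M (f (\<pi>' i)) = absv b * M (e j)"
      hence "M (e i) = absv (a i * b) * M (e j)" using pa[OF ij(1)] by (simp add: absv_mult)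
      thus False using generic[OF ij] by blast
    qed
  qed
qed

lemma basis_permute:
  assumes f: "is_basis f" and r: "bij_betw r {..<n} {..<n}"
  shows "is_basis (f \<circ> r)" "adapted N f \<Longrightarrow> adapted N (f \<circ> r)"
proof -
  have img: "(f \<circ> r) ` {..<n} = f ` {..<n}"
    unfolding image_comp[symmetric] bij_betw_imp_surj_on[OF r] ..
  show b: "is_basis (f \<circ> r)"
    using f r unfolding is_basis_def img by (auto simp: bij_betw_def intro!: comp_inj_on)
  show "adapted N (f \<circ> r)" if "adapted N f"
    using that orthogonal_iff_adapted[OF b] orthogonal_iff_adapted[OF f] unfolding img by simp
qed

end

context metric_bruhat_tits_building
begin

section \<open>Norms and the metric\<close>

lemma dist_triangle: "x \<in> building \<Longrightarrow> y \<in> building \<Longrightarrow> z \<in> building \<Longrightarrow> d x z \<le> d x y + d y z"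
  using Metric_space.triangle[OF metric] by blast

lemma dist_commute: "d x y = d y x"
  using Metric_space.commute[OF metric] by blast

lemma dist_nonneg: "0 \<le> d x y"
  using Metric_space.nonneg[OF metric] by blast

lemma dist_zero: "x \<in> building \<Longrightarrow> y \<in> building \<Longrightarrow> d x y = 0 \<longleftrightarrow> x = y"
  using Metric_space.zero[OF metric] by blast

text \<open>The factor between \<open>ip\<close> and the standard scalar product on the hyperplane of vectors with
  coordinate sum \<open>0\<close>, which represents \<open>\<real>\<^sup>n / \<real>(1, \<dots>, 1)\<close>.\<close>

definition ipc :: real where
  "ipc = (SOME \<kappa>. \<kappa> > 0 \<and> (\<forall>a. ip a a = \<kappa> * ((\<Sum>i<n. (a i)\<^sup>2) - (\<Sum>i<n. a i)\<^sup>2 / n)))"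

lemma ipc: "ipc > 0" "ip a a = ipc * ((\<Sum>i<n. (a i)\<^sup>2) - (\<Sum>i<n. a i)\<^sup>2 / n)"
proof -
  have "\<exists>\<kappa>. \<kappa> > 0 \<and> (\<forall>a. ip a a = \<kappa> * ((\<Sum>i<n. (a i)\<^sup>2) - (\<Sum>i<n. a i)\<^sup>2 / n))"
    using invariant_scalar_product_explicit[OF scalar_product] by blast
  from someI_ex[OF this, folded ipc_def]
  show "ipc > 0" "ip a a = ipc * ((\<Sum>i<n. (a i)\<^sup>2) - (\<Sum>i<n. a i)\<^sup>2 / n)" by blast+
qed

definition nrm :: "(nat \<Rightarrow> real) \<Rightarrow> real" where
  "nrm a = sqrt (ip a a)"

lemma sum_affine_squares:
  fixes b :: "nat \<Rightarrow> real"
  shows "(\<Sum>i<n. (s * b i + c)\<^sup>2) - (\<Sum>i<n. s * b i + c)\<^sup>2 / n =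
    s\<^sup>2 * ((\<Sum>i<n. (b i)\<^sup>2) - (\<Sum>i<n. b i)\<^sup>2 / n)"
proof -
  define A where "A = (\<Sum>i<n. b i)"
  have 1: "(\<Sum>i<n. (s * b i + c)\<^sup>2) = s\<^sup>2 * (\<Sum>i<n. (b i)\<^sup>2) + 2 * s * c * A + n * c\<^sup>2"
    by (simp add: power2_sum power_mult_distrib sum.distrib sum_distrib_left A_def mult_ac)
  have 2: "(\<Sum>i<n. s * b i + c) = s * A + n * c"
    by (simp add: sum.distrib sum_distrib_left A_def)
  show ?thesis
  proof (cases "n = 0")
    case False
    have "(s * A + n * c)\<^sup>2 / n = s\<^sup>2 * A\<^sup>2 / n + 2 * s * c * A + n * c\<^sup>2"
      using False by (simp add: power2_eq_square field_simps)
    thus ?thesis unfolding 1 2 A_def[symmetric] by (simp add: algebra_simps)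
  qed simp
qed

lemma ip_affine:
  assumes "\<And>i. i < n \<Longrightarrow> a i = s * b i + c"
  shows "ip a a = s\<^sup>2 * ip b b"
proof -
  have "(\<Sum>i<n. (a i)\<^sup>2) = (\<Sum>i<n. (s * b i + c)\<^sup>2)" "(\<Sum>i<n. a i) = (\<Sum>i<n. s * b i + c)"
    using assms by (intro sum.cong; simp)+
  thus ?thesis unfolding ipc(2) using sum_affine_squares[of s b c] by simp
qed

lemma nrm_affine:
  assumes "\<And>i. i < n \<Longrightarrow> a i = s * b i + c"
  shows "nrm a = \<bar>s\<bar> * nrm b"
  unfolding nrm_def by (subst ip_affine[OF assms]) (simp_all add: real_sqrt_mult)

text \<open>Centering the coordinates turns \<open>ip\<close> into a multiple of the standard scalar product, so that
  \<open>nrm\<close> can be compared with the coordinates up to a common constant.\<close>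

lemma ip_centered: "ip a a = ipc * (\<Sum>i<n. (a i - (\<Sum>i<n. a i) / n)\<^sup>2)"
proof (cases "n = 0")
  case True
  thus ?thesis by (simp add: ipc(2))
next
  case False
  define A where "A = (\<Sum>i<n. a i)"
  have "(\<Sum>i<n. (a i - A / n)\<^sup>2) = (\<Sum>i<n. (a i)\<^sup>2 + (A / n)\<^sup>2 - (2 * (A / n)) * a i)"
    by (intro sum.cong) (simp_all add: power2_diff)
  also have "\<dots> = (\<Sum>i<n. (a i)\<^sup>2) - 2 * (A / n) * A + n * (A / n)\<^sup>2"
    unfolding sum.distrib sum_subtractf sum_distrib_left[symmetric] A_def[symmetric] by simp
  also have "\<dots> = (\<Sum>i<n. (a i)\<^sup>2) - A\<^sup>2 / n"
    using False by (simp add: power2_eq_square field_simps)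
  finally show ?thesis unfolding ipc(2) A_def[symmetric] by simp
qed

lemma ip_nonneg: "0 \<le> ip a a"
  unfolding ip_centered using ipc(1) by (intro mult_nonneg_nonneg sum_nonneg) auto

lemma nrm_nonneg [simp]: "0 \<le> nrm a"
  by (simp add: nrm_def ip_nonneg)

lemma nrm_square: "(nrm a)\<^sup>2 = ip a a"
  by (simp add: nrm_def ip_nonneg)

lemma nrm_le:
  assumes "\<And>i. i < n \<Longrightarrow> \<bar>a i - c\<bar> \<le> B" "0 \<le> B"
  shows "nrm a \<le> sqrt (ipc * n) * B"
proof -
  have "ip a a = ip (\<lambda>i. a i - c) (\<lambda>i. a i - c)"
    using ip_affine[of "\<lambda>i. a i - c" 1 a "- c"] by simp
  also have "\<dots> \<le> ipc * (\<Sum>i<n. (a i - c)\<^sup>2)"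
    unfolding ipc(2) using ipc(1) by (intro mult_left_mono) auto
  also have "\<dots> \<le> ipc * (\<Sum>i<n. B\<^sup>2)"
    using ipc(1) assms by (intro mult_left_mono sum_mono) (auto simp: power2_le_iff_abs_le)
  also have "\<dots> = (sqrt (ipc * n) * B)\<^sup>2" using ipc(1) by (simp add: power_mult_distrib)
  finally show ?thesis unfolding nrm_def using assms(2) ipc(1) by (intro real_le_lsqrt) (auto simp: ip_nonneg)
qed

lemma nrm_ge:
  assumes "i < n"
  shows "\<bar>a i - (\<Sum>i<n. a i) / n\<bar> \<le> nrm a / sqrt ipc"
proof -
  let ?m = "(\<Sum>i<n. a i) / n"
  have "(a i - ?m)\<^sup>2 \<le> (\<Sum>i<n. (a i - ?m)\<^sup>2)"
    using assms by (intro member_le_sum) auto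
  also have "\<dots> = (nrm a / sqrt ipc)\<^sup>2"
    using ipc(1) ip_centered[of a] by (simp add: power_divide nrm_square)
  finally have "\<bar>a i - ?m\<bar> \<le> \<bar>nrm a / sqrt ipc\<bar>" by (simp only: abs_le_square_iff)
  thus ?thesis using ipc(1) by simp
qed

lemma nrm_mono_majorization:
  assumes "\<And>J. J \<subseteq> {..<n} \<Longrightarrow> \<exists>L\<subseteq>{..<n}. card L = card J \<and> sum u J \<le> sum l L"
    and "sum u {..<n} = sum l {..<n}"
  shows "nrm u \<le> nrm l"
  using majorization_sum_squares[OF assms] assms(2) ipc(1) by (simp add: nrm_def ipc(2))

lemma ip_interpolate:
  "ip (\<lambda>i. (1 - s) * a i + s * b i) (\<lambda>i. (1 - s) * a i + s * b i) =
    (1 - s) * ip a a + s * ip b b - s * (1 - s) * ip (\<lambda>i. a i - b i) (\<lambda>i. a i - b i)"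
proof -
  define A B where "A = (\<Sum>i<n. a i)" and "B = (\<Sum>i<n. b i)"
  have id: "((1 - s) * x + s * y)\<^sup>2 = (1 - s) * x\<^sup>2 + s * y\<^sup>2 - s * (1 - s) * (x - y)\<^sup>2" for x y :: real
    by (simp add: power2_eq_square algebra_simps)
  have 1: "(\<Sum>i<n. ((1 - s) * a i + s * b i)\<^sup>2) = (1 - s) * (\<Sum>i<n. (a i)\<^sup>2) + s * (\<Sum>i<n. (b i)\<^sup>2)
      - s * (1 - s) * (\<Sum>i<n. (a i - b i)\<^sup>2)"
    unfolding id by (simp add: sum.distrib sum_subtractf sum_distrib_left)
  have 2: "(\<Sum>i<n. (1 - s) * a i + s * b i) = (1 - s) * A + s * B"
    by (simp add: sum.distrib sum_distrib_left A_def B_def)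
  have 3: "(\<Sum>i<n. a i - b i) = A - B" by (simp add: sum_subtractf A_def B_def)
  show ?thesis
    unfolding ipc(2) 1 2 3 unfolding id A_def[symmetric] B_def[symmetric]
    by (simp add: algebra_simps add_divide_distrib diff_divide_distrib)
qed

subsection \<open>Distances in terms of weights\<close>

text \<open>By \<open>chart_pnorm\<close> the weights are the negatives of the chart coordinates up to a common
  constant. Distances are invariant under the change of sign.\<close>

definition wt :: "(nat \<Rightarrow> 'v) \<Rightarrow> ('v set set \<Rightarrow> real) \<Rightarrow> nat \<Rightarrow> real" where
  "wt w x i = log q (pnorm x (w i))"

lemma dist_wt:
  assumes w: "is_basis w" and x: "x \<in> apartment w" and y: "y \<in> apartment w"
    and a: "\<And>i. i < n \<Longrightarrow> wt w x i = a i + C" and b: "\<And>i. i < n \<Longrightarrow> wt w y i = b i + D"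
  shows "d x y = nrm (\<lambda>i. a i - b i)"
proof -
  obtain A where A: "\<forall>i<n. chart w x i = A - log q (pnorm x (w i))" using chart_pnorm[OF w x] by blast
  obtain B where B: "\<forall>i<n. chart w y i = B - log q (pnorm y (w i))" using chart_pnorm[OF w y] by blast
  have "d x y = nrm (\<lambda>i. chart w x i - chart w y i)"
    unfolding nrm_def by (rule d_apartment[OF w x y])
  also have "\<dots> = \<bar>- 1\<bar> * nrm (\<lambda>i. a i - b i)"
  proof (rule nrm_affine)
    show "chart w x i - chart w y i = - 1 * (a i - b i) + (A - B - C + D)" if "i < n" for i
      using a[OF that] b[OF that] A B that by (simp add: wt_def)
  qed
  finally show ?thesis by simp
qed

definition pt :: "(nat \<Rightarrow> 'v) \<Rightarrow> (nat \<Rightarrow> real) \<Rightarrow> 'v set set \<Rightarrow> real" where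
  "pt w c = (SOME x. x \<in> apartment w \<and> (\<exists>C. \<forall>i<n. wt w x i = c i + C))"

lemma pt:
  assumes "is_basis w"
  shows "pt w c \<in> apartment w" "\<exists>C. \<forall>i<n. wt w (pt w c) i = c i + C"
proof -
  have "\<exists>x. x \<in> apartment w \<and> (\<exists>C. \<forall>i<n. wt w x i = c i + C)"
    using apartment_point_exists[OF assms, of c] unfolding wt_def by blast
  from someI_ex[OF this, folded pt_def]
  show "pt w c \<in> apartment w" "\<exists>C. \<forall>i<n. wt w (pt w c) i = c i + C" by blast+
qed

lemma pt_building: "is_basis w \<Longrightarrow> pt w c \<in> building"
  using pt(1) apartment_building by blast

lemma dist_pt_wt:
  assumes w: "is_basis w" and x: "x \<in> apartment w"
  shows "d (pt w c) x = nrm (\<lambda>i. c i - wt w x i)" "d x (pt w c) = nrm (\<lambda>i. c i - wt w x i)"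
proof -
  obtain C where "\<forall>i<n. wt w (pt w c) i = c i + C" using pt(2)[OF w] by blast
  thus "d (pt w c) x = nrm (\<lambda>i. c i - wt w x i)"
    using dist_wt[OF w pt(1)[OF w] x, of c c C "wt w x" 0] by simp
  thus "d x (pt w c) = nrm (\<lambda>i. c i - wt w x i)" by (simp add: dist_commute)
qed

lemma dist_pt:
  assumes w: "is_basis w"
  shows "d (pt w a) (pt w b) = nrm (\<lambda>i. a i - b i)"
proof -
  obtain C where "\<forall>i<n. wt w (pt w a) i = a i + C" using pt(2)[OF w] by blast
  moreover obtain D where "\<forall>i<n. wt w (pt w b) i = b i + D" using pt(2)[OF w] by blast
  ultimately show ?thesis
    using dist_wt[OF w pt(1)[OF w] pt(1)[OF w], of a a C b b D] by simp
qed

lemma pt_wt: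
  assumes w: "is_basis w" and x: "x \<in> apartment w" and c: "\<And>i. i < n \<Longrightarrow> c i = wt w x i"
  shows "pt w c = x"
proof -
  have "nrm (\<lambda>i. c i - wt w x i) = \<bar>0\<bar> * nrm (\<lambda>i. 0)"
    by (rule nrm_affine[where c = 0]) (simp add: c)
  hence "d (pt w c) x = 0" unfolding dist_pt_wt(1)[OF w x] by simp
  thus ?thesis using dist_zero pt_building[OF w] apartment_building[OF x] by blast
qed

subsection \<open>Retraction onto an apartment\<close>

text \<open>The retraction onto the apartment of \<open>e\<close> that is centred at the chamber of \<open>m\<close>: a basis \<open>f\<close>
  adapted to \<open>m\<close> and \<open>z\<close> is matched with \<open>e\<close>, and the point \<open>rr\<close> has the same position relative to \<open>m\<close>
  in \<open>e\<close> as \<open>z\<close> has in \<open>f\<close>. For \<open>x\<close> in the apartment of \<open>e\<close> the relative position of \<open>x\<close> and \<open>z\<close>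
  majorizes that of \<open>x\<close> and \<open>rr\<close>.\<close>

lemma retraction:
  assumes e: "is_basis e" and m: "m \<in> apartment e" and z: "z \<in> building"
    and generic: "\<And>i j. i < n \<Longrightarrow> j < n \<Longrightarrow> i \<noteq> j \<Longrightarrow> wt e m i - wt e m j \<notin> \<int>"
  obtains rr where "rr \<in> apartment e" "d rr m = d z m" "\<And>x. x \<in> apartment e \<Longrightarrow> d rr x \<le> d z x"
proof -
  have mb: "m \<in> building" by (rule apartment_building[OF m])
  note M = pnorm_norm[OF mb] and Z = pnorm_norm[OF z]
  obtain f0 where f0: "is_basis f0" "m \<in> apartment f0" "z \<in> apartment f0"
    using common_apartment[OF mb z] by blast
  have gen: "pnorm m (e i) \<noteq> absv a * pnorm m (e j)" if ij: "i < n" "j < n" "i \<noteq> j" for i j a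
  proof
    assume eq: "pnorm m (e i) = absv a * pnorm m (e j)"
    have pos: "pnorm m (e i) > 0" "pnorm m (e j) > 0" using basis_nz[OF e] ij by (auto intro: pnorm_pos)
    have "a \<noteq> 0" using eq pos by auto
    then obtain k where k: "absv a = q powi k" by (rule value_group)
    have "log q (q powi k) = k" using q_gt_1 by (simp flip: powr_real_of_int')
    hence "wt e m i = k + wt e m j"
      unfolding wt_def eq k using pos q_gt_1 by (subst log_mult_pos) auto
    thus False using generic[OF ij] by simp
  qed
  obtain r where r: "bij_betw r {..<n} {..<n}"
    "\<And>i j a. i < n \<Longrightarrow> j < n \<Longrightarrow> i \<noteq> j \<Longrightarrow> pnorm m (e i) \<noteq> absv a * pnorm m (f0 (r j))"
    "\<And>i j a. i < n \<Longrightarrow> j < n \<Longrightarrow> i \<noteq> j \<Longrightarrow> pnorm m (f0 (r i)) \<noteq> absv a * pnorm m (e j)"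
    using match_generic_bases[where e = e, OF M basis_nz[OF e] f0(1) apartment_adapted[OF f0(1,2)] gen]
    by blast
  define f where "f = f0 \<circ> r"
  have f: "is_basis f" "adapted (pnorm m) f" "adapted (pnorm z) f"
    unfolding f_def using basis_permute[OF f0(1) r(1)] apartment_adapted[OF f0(1,2)]
      apartment_adapted[OF f0(1,3)] by blast+
  have mf: "m \<in> apartment f" and zf: "z \<in> apartment f"
    using adapted_apartment f mb z by blast+
  define c where "c i = wt f z i + wt e m i - wt f m i" for i
  show ?thesis
  proof (rule that[of "pt e c"])
    show "pt e c \<in> apartment e" by (rule pt(1)[OF e])
    show "d (pt e c) m = d z m"
      unfolding dist_pt_wt(1)[OF e m] using dist_wt[OF f(1) zf mf, of "wt f z" 0 "wt f m" 0]
      by (simp add: c_def)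
    show "d (pt e c) x \<le> d z x" if x: "x \<in> apartment e" for x
    proof -
      have xb: "x \<in> building" by (rule apartment_building[OF x])
      note X = pnorm_norm[OF xb]
      obtain h where h: "is_basis h" "x \<in> apartment h" "z \<in> apartment h"
        using common_apartment[OF xb z] by blast
      let ?u = "\<lambda>i. c i - wt e x i" and ?l = "\<lambda>i. wt h z i - wt h x i"
      have 1: "\<exists>L\<subseteq>{..<n}. card L = card J \<and> sum ?u J \<le> sum ?l L" if J: "J \<subseteq> {..<n}" for J
      proof -
        have "\<exists>L\<subseteq>{..<n}. card L = card J \<and>
          (\<Sum>i\<in>J. (log q (pnorm z (f i)) - log q (pnorm m (f i))) - (log q (pnorm x (e i)) - log q (pnorm m (e i))))
          \<le> (\<Sum>l\<in>L. log q (pnorm z (h l)) - log q (pnorm x (h l)))"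
          by (rule relative_position_majorizes[where e = e, OF X Z M h(1) f(1)
            apartment_adapted[OF h(1,2)] f(3,2) basis_nz[OF e] _ J]) (simp_all add: f_def r(2))
        moreover have "(log q (pnorm z (f i)) - log q (pnorm m (f i))) - (log q (pnorm x (e i)) - log q (pnorm m (e i))) = ?u i" for i
          by (simp add: c_def wt_def)
        ultimately show ?thesis by (simp add: wt_def)
      qed
      \<comment> \<open>Exchanging the roles of \<open>x\<close>, \<open>e\<close> and \<open>z\<close>, \<open>f\<close> gives equality of the total sums.\<close>
      obtain L where L: "L \<subseteq> {..<n}" "card L = card {..<n}"
        "(\<Sum>i<n. (log q (pnorm x (e i)) - log q (pnorm m (e i))) - (log q (pnorm z (f i)) - log q (pnorm m (f i))))
          \<le> (\<Sum>l\<in>L. log q (pnorm x (h l)) - log q (pnorm z (h l)))"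
        using relative_position_majorizes[where e = f, OF Z X M h(1) e apartment_adapted[OF h(1,3)]
            apartment_adapted[OF e x] apartment_adapted[OF e m] basis_nz[OF f(1)] _ subset_refl]
          r(3) by (auto simp: f_def)
      have "L = {..<n}" using L(1,2) by (intro card_subset_eq) auto
      hence "sum ?l {..<n} \<le> sum ?u {..<n}"
        using L(3) by (simp add: c_def wt_def sum_subtractf sum.distrib)
      moreover have "sum ?u {..<n} \<le> sum ?l {..<n}"
      proof -
        obtain L where "L \<subseteq> {..<n}" "card L = card {..<n}" "sum ?u {..<n} \<le> sum ?l L"
          using 1[of "{..<n}"] by blast
        moreover from this have "L = {..<n}" by (intro card_subset_eq) auto
        ultimately show ?thesis by simp
      qed
      ultimately have "nrm ?u \<le> nrm ?l" by (intro nrm_mono_majorization 1) auto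
      thus ?thesis
        unfolding dist_pt_wt(1)[OF e x] using dist_wt[OF h(1,3,2), of "wt h z" 0 "wt h x" 0] by simp
    qed
  qed
qed

subsection \<open>The inequality of Bruhat and Tits\<close>

lemma generic_perturbation:
  fixes c :: "nat \<Rightarrow> real"
  assumes "\<epsilon> > 0"
  obtains c' where "\<And>i. i < n \<Longrightarrow> \<bar>c' i - c i\<bar> \<le> \<epsilon>"
    "\<And>i j. i < n \<Longrightarrow> j < n \<Longrightarrow> i \<noteq> j \<Longrightarrow> c' i - c' j \<notin> \<int>"
proof -
  define B where "B = (\<Union>i<n. \<Union>j\<in>{..<n} - {i}. (\<lambda>k. (of_int k - (c i - c j)) / (real i - real j)) ` UNIV)"
  have "countable B" unfolding B_def by (intro countable_UN countable_image) auto
  moreover have "uncountable {0<..<\<epsilon> / (n + 1)}"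
    using assms by (intro uncountable_open_interval[THEN iffD2]) simp
  ultimately have "\<not> {0<..<\<epsilon> / (n + 1)} \<subseteq> B" using countable_subset by blast
  then obtain t where t': "t \<in> {0<..<\<epsilon> / (n + 1)}" and tB: "t \<notin> B" by blast
  from t' have t: "0 < t" "t < \<epsilon> / (n + 1)" unfolding greaterThanLessThan_iff by blast+
  show ?thesis
  proof (rule that[of "\<lambda>i. c i + t * i"])
    show "\<bar>c i + t * i - c i\<bar> \<le> \<epsilon>" if "i < n" for i
    proof -
      have "t * i \<le> t * (n + 1)" using that t(1) by simp
      also have "\<dots> \<le> \<epsilon>" using t(2) by (simp add: field_simps)
      finally show ?thesis using t(1) by simp
    qed
    show "(c i + t * i) - (c j + t * j) \<notin> \<int>" if ij: "i < n" "j < n" "i \<noteq> j" for i j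
    proof
      assume "(c i + t * i) - (c j + t * j) \<in> \<int>"
      then obtain k where k: "(c i + t * i) - (c j + t * j) = of_int k" by (auto elim: Ints_cases)
      have "real i - real j \<noteq> 0" using ij by simp
      hence "t = (of_int k - (c i - c j)) / (real i - real j)"
        unfolding k[symmetric] by (simp add: field_simps)
      hence "t \<in> B" unfolding B_def using ij by blast
      thus False using tB by blast
    qed
  qed
qed

text \<open>The inequality holds with equality in the Euclidean apartment through \<open>x\<close>, \<open>y\<close> and the
  image of \<open>z\<close> under the retraction centred at the dividing point of \<open>x\<close> and \<open>y\<close>; the retraction
  does not increase the distances from \<open>x\<close> and \<open>y\<close>. A small perturbation of the centre makes it
  generic.\<close>

lemma bruhat_tits_inequality:
  assumes x: "x \<in> building" and y: "y \<in> building" and s: "0 \<le> s" "s \<le> 1"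
  obtains m where "m \<in> building" "\<And>z. z \<in> building \<Longrightarrow>
    (d z m)\<^sup>2 \<le> (1 - s) * (d z x)\<^sup>2 + s * (d z y)\<^sup>2 - s * (1 - s) * (d x y)\<^sup>2"
proof -
  obtain w where w: "is_basis w" "x \<in> apartment w" "y \<in> apartment w"
    using common_apartment[OF x y] by blast
  define c where "c i = (1 - s) * wt w x i + s * wt w y i" for i
  define m where "m = pt w c"
  have m: "m \<in> building" unfolding m_def by (rule pt_building[OF w(1)])
  have "(d z m)\<^sup>2 \<le> (1 - s) * (d z x)\<^sup>2 + s * (d z y)\<^sup>2 - s * (1 - s) * (d x y)\<^sup>2" (is "_ \<le> ?R")
    if z: "z \<in> building" for z
  proof -
    have flat: "(d rr m)\<^sup>2 = (1 - s) * (d rr x)\<^sup>2 + s * (d rr y)\<^sup>2 - s * (1 - s) * (d x y)\<^sup>2"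
      if rr: "rr \<in> apartment w" for rr
    proof -
      let ?a = "\<lambda>i. wt w rr i - wt w x i" and ?b = "\<lambda>i. wt w rr i - wt w y i"
      have eq: "(\<lambda>i. c i - wt w rr i) = (\<lambda>i. - 1 * ((1 - s) * ?a i + s * ?b i) + 0)"
        by (simp add: c_def algebra_simps fun_eq_iff)
      have 1: "(d rr m)\<^sup>2 = ip (\<lambda>i. (1 - s) * ?a i + s * ?b i) (\<lambda>i. (1 - s) * ?a i + s * ?b i)"
        unfolding m_def dist_pt_wt(2)[OF w(1) rr] nrm_square eq
        using ip_affine[of "\<lambda>i. - 1 * ((1 - s) * ?a i + s * ?b i) + 0" "- 1" "\<lambda>i. (1 - s) * ?a i + s * ?b i" 0]
        by simp
      have 2: "(d rr x)\<^sup>2 = ip ?a ?a" "(d rr y)\<^sup>2 = ip ?b ?b"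
        using dist_wt[OF w(1) rr w(2), of "wt w rr" 0 "wt w x" 0]
          dist_wt[OF w(1) rr w(3), of "wt w rr" 0 "wt w y" 0] by (simp_all add: nrm_square)
      have 3: "(d x y)\<^sup>2 = ip (\<lambda>i. ?a i - ?b i) (\<lambda>i. ?a i - ?b i)"
        using dist_wt[OF w(1,2,3), of "wt w x" 0 "wt w y" 0]
          ip_affine[of "\<lambda>i. ?a i - ?b i" "- 1" "\<lambda>i. wt w x i - wt w y i" 0]
        by (simp add: nrm_square)
      show ?thesis unfolding 1 2 3 by (rule ip_interpolate)
    qed
    have key: "d z m \<le> sqrt ?R + 2 * \<delta>" if \<delta>: "\<delta> > 0" for \<delta>
    proof -
      \<comment> \<open>\<open>sqrt (ipc * n)\<close> compares \<open>nrm\<close> with the maximum norm; \<open>1\<close> is added to divide by \<open>?K\<close>.\<close>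
      let ?K = "sqrt (ipc * n) + 1"
      have K: "?K > 0" using ipc(1) by (simp add: add_nonneg_pos)
      obtain c' where c': "\<And>i. i < n \<Longrightarrow> \<bar>c' i - c i\<bar> \<le> \<delta> / ?K"
        "\<And>i j. i < n \<Longrightarrow> j < n \<Longrightarrow> i \<noteq> j \<Longrightarrow> c' i - c' j \<notin> \<int>"
        using generic_perturbation[of "\<delta> / ?K" c] K \<delta> by auto
      define m' where "m' = pt w c'"
      have m': "m' \<in> apartment w" "m' \<in> building"
        unfolding m'_def by (rule pt(1)[OF w(1)], rule pt_building[OF w(1)])
      have "d m' m \<le> sqrt (ipc * n) * (\<delta> / ?K)"
        unfolding m'_def m_def dist_pt[OF w(1)]
        using c'(1) K \<delta> by (intro nrm_le[where c = 0]) auto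
      also have "\<dots> \<le> ?K * (\<delta> / ?K)" using K \<delta> by (intro mult_right_mono) auto
      also have "\<dots> = \<delta>" using K by simp
      finally have dm: "d m' m \<le> \<delta>" .
      obtain C where C: "\<forall>i<n. wt w m' i = c' i + C" unfolding m'_def using pt(2)[OF w(1)] by blast
      have gen: "wt w m' i - wt w m' j \<notin> \<int>" if "i < n" "j < n" "i \<noteq> j" for i j
        using c'(2)[OF that] C that by simp
      obtain rr where rr: "rr \<in> apartment w" "d rr m' = d z m'" "\<And>x. x \<in> apartment w \<Longrightarrow> d rr x \<le> d z x"
        using retraction[OF w(1) m'(1) z gen] by blast
      have rb: "rr \<in> building" by (rule apartment_building[OF rr(1)])
      have "(d rr x)\<^sup>2 \<le> (d z x)\<^sup>2" "(d rr y)\<^sup>2 \<le> (d z y)\<^sup>2"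
        using rr(3)[OF w(2)] rr(3)[OF w(3)] dist_nonneg by (auto intro: power_mono)
      hence "(d rr m)\<^sup>2 \<le> ?R"
        unfolding flat[OF rr(1)] using s by (intro diff_right_mono add_mono mult_left_mono) auto
      hence "d rr m \<le> sqrt ?R" by (rule real_le_rsqrt)
      moreover have "d z m \<le> d z m' + d m' m" by (rule dist_triangle[OF z m'(2) m])
      moreover have "d rr m' \<le> d rr m + d m m'" by (rule dist_triangle[OF rb m m'(2)])
      ultimately show ?thesis using dm rr(2) dist_commute[of m m'] by linarith
    qed
    have "d z m \<le> sqrt ?R"
    proof (rule field_le_epsilon)
      fix \<epsilon> :: real assume "\<epsilon> > 0"
      thus "d z m \<le> sqrt ?R + \<epsilon>" using key[of "\<epsilon> / 2"] by simp
    qed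
    have "0 \<le> ?R"
    proof -
      have "0 \<le> sqrt ?R" using \<open>d z m \<le> sqrt ?R\<close> dist_nonneg[of z m] by linarith
      thus ?thesis by simp
    qed
    hence "(sqrt ?R)\<^sup>2 = ?R" by (rule real_sqrt_pow2)
    moreover have "(d z m)\<^sup>2 \<le> (sqrt ?R)\<^sup>2"
      using \<open>d z m \<le> sqrt ?R\<close> dist_nonneg by (rule power_mono)
    ultimately show ?thesis by simp
  qed
  thus ?thesis using that[OF m] by blast
qed

section \<open>Geodesics and the cone topology\<close>

lemma bruhat_tits_inequality_between:
  assumes x: "x \<in> building" and y: "y \<in> building" and m: "m \<in> building" and z: "z \<in> building"
    and s: "0 \<le> s" "s \<le> 1" and between: "d x m = s * d x y" "d m y = (1 - s) * d x y"
  shows "(d z m)\<^sup>2 \<le> (1 - s) * (d z x)\<^sup>2 + s * (d z y)\<^sup>2 - s * (1 - s) * (d x y)\<^sup>2"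
proof -
  obtain m0 where m0: "m0 \<in> building" "\<And>z. z \<in> building \<Longrightarrow>
    (d z m0)\<^sup>2 \<le> (1 - s) * (d z x)\<^sup>2 + s * (d z y)\<^sup>2 - s * (1 - s) * (d x y)\<^sup>2"
    using bruhat_tits_inequality[OF x y s] by blast
  have "(d m m0)\<^sup>2 \<le> (1 - s) * (s * d x y)\<^sup>2 + s * ((1 - s) * d x y)\<^sup>2 - s * (1 - s) * (d x y)\<^sup>2"
    using m0(2)[OF m] between dist_commute[of m x] by simp
  also have "\<dots> = 0" by (simp add: power2_eq_square algebra_simps)
  finally have "d m m0 = 0" by simp
  hence "m = m0" using dist_zero[OF m m0(1)] by simp
  thus ?thesis using m0(2)[OF z] by simp
qed

text \<open>Apply the inequality to \<open>a'\<close> on the side from \<open>x\<close> to \<open>a\<close> and then to \<open>b'\<close> on the side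
  from \<open>x\<close> to \<open>b\<close>, seen from \<open>b'\<close> and from \<open>a\<close>; the terms \<open>(d x a)\<^sup>2\<close> and \<open>(d x b)\<^sup>2\<close> cancel.\<close>

lemma thales:
  assumes x: "x \<in> building" and a: "a \<in> building" and b: "b \<in> building"
    and a': "a' \<in> building" and b': "b' \<in> building"
    and s: "0 \<le> s" "s \<le> 1"
    and xa: "d x a' = s * d x a" "d a' a = (1 - s) * d x a"
    and xb: "d x b' = s * d x b" "d b' b = (1 - s) * d x b"
  shows "d a' b' \<le> s * d a b"
proof -
  have 1: "(d b' a')\<^sup>2 \<le> (1 - s) * (d b' x)\<^sup>2 + s * (d b' a)\<^sup>2 - s * (1 - s) * (d x a)\<^sup>2"
    by (rule bruhat_tits_inequality_between[OF x a a' b' s xa])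
  have 2: "(d a b')\<^sup>2 \<le> (1 - s) * (d a x)\<^sup>2 + s * (d a b)\<^sup>2 - s * (1 - s) * (d x b)\<^sup>2"
    by (rule bruhat_tits_inequality_between[OF x b b' a s xb])
  have 3: "s * (d a b')\<^sup>2 \<le> s * ((1 - s) * (d x a)\<^sup>2 + s * (d a b)\<^sup>2 - s * (1 - s) * (d x b)\<^sup>2)"
    using 2 s(1) dist_commute[of a x] by (intro mult_left_mono) auto
  have "(d a' b')\<^sup>2 \<le> (1 - s) * (s * d x b)\<^sup>2 + s * (d a b')\<^sup>2 - s * (1 - s) * (d x a)\<^sup>2"
    using 1 xb(1) dist_commute[of b' a'] dist_commute[of b' x] dist_commute[of b' a] by simp
  also have "\<dots> \<le> (s * d a b)\<^sup>2"
    using 3 by (simp add: power2_eq_square algebra_simps)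
  finally show ?thesis using s(1) dist_nonneg by (intro power2_le_imp_le[of "d a' b'"]) auto
qed

lemma segment_exists:
  assumes x: "x \<in> building" and y: "y \<in> building"
  shows "\<exists>c. is_segment c x y"
proof (cases "x = y")
  case True
  have "d x x = 0" using dist_zero[OF x x] by simp
  thus ?thesis using True x by (intro exI[of _ "\<lambda>_. x"]) (simp add: is_segment_def)
next
  case False
  obtain w where w: "is_basis w" "x \<in> apartment w" "y \<in> apartment w"
    using common_apartment[OF x y] by blast
  define D where "D = d x y"
  have D: "D > 0" using False dist_zero[OF x y] dist_nonneg[of x y] by (simp add: D_def)
  define c where "c t = pt w (\<lambda>i. wt w x i + t / D * (wt w y i - wt w x i))" for t
  have Dn: "D = nrm (\<lambda>i. wt w x i - wt w y i)"
    unfolding D_def by (rule dist_wt[OF w, of _ 0 _ 0]) simp_all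
  have "c 0 = x" unfolding c_def by (rule pt_wt[OF w(1,2)]) simp
  moreover have "c D = y" unfolding c_def by (rule pt_wt[OF w(1,3)]) (use D in simp)
  moreover have "c t \<in> building" for t unfolding c_def by (rule pt_building[OF w(1)])
  moreover have "d (c s) (c t) = \<bar>s - t\<bar>" for s t
  proof -
    have "d (c s) (c t) = \<bar>(t - s) / D\<bar> * nrm (\<lambda>i. wt w x i - wt w y i)"
      unfolding c_def dist_pt[OF w(1)]
      by (rule nrm_affine[where c = 0]) (simp add: diff_divide_distrib algebra_simps)
    thus ?thesis unfolding Dn[symmetric] using D by simp
  qed
  ultimately show ?thesis unfolding is_segment_def D_def by blast
qed

lemma half_geodesicD:
  assumes "is_half_geodesic \<rho>"
  shows "0 \<le> t \<Longrightarrow> \<rho> t \<in> building" "0 \<le> s \<Longrightarrow> 0 \<le> t \<Longrightarrow> d (\<rho> s) (\<rho> t) = \<bar>s - t\<bar>"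
  using assms by (auto simp: is_half_geodesic_def)

lemma segmentD:
  assumes "is_segment c x y"
  shows "c 0 = x" "c (d x y) = y" "0 \<le> t \<Longrightarrow> t \<le> d x y \<Longrightarrow> c t \<in> building"
    "0 \<le> s \<Longrightarrow> s \<le> d x y \<Longrightarrow> 0 \<le> t \<Longrightarrow> t \<le> d x y \<Longrightarrow> d (c s) (c t) = \<bar>s - t\<bar>"
  using assms unfolding is_segment_def by auto

text \<open>By \<open>thales\<close> the point of the segment at the proportional parameter is within \<open>r / t * C\<close> of
  \<open>\<sigma> r\<close>. The lengths of the two geodesics differ by at most \<open>C\<close>, so the step from the proportional
  parameter to \<open>r\<close> costs the same again.\<close>

lemma segment_near_ray:
  assumes \<sigma>: "is_half_geodesic \<sigma>" and g: "g \<in> building" and t: "0 < t" and C: "d g (\<sigma> t) \<le> C"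
    and seg: "is_segment c (\<sigma> 0) g" and r: "0 < r" "r \<le> t" "r \<le> d (\<sigma> 0) g"
  shows "d (c r) (\<sigma> r) \<le> 2 * r * C / t"
proof -
  let ?D = "d (\<sigma> 0) g" and ?s = "r / t"
  have b: "\<sigma> 0 \<in> building" "\<sigma> t \<in> building" "\<sigma> r \<in> building"
    using half_geodesicD(1)[OF \<sigma>] t r by auto
  have t0: "d (\<sigma> 0) (\<sigma> t) = t" "d (\<sigma> 0) (\<sigma> r) = r" "d (\<sigma> r) (\<sigma> t) = t - r"
    using half_geodesicD(2)[OF \<sigma>] t r by auto
  have s: "0 \<le> ?s" "?s \<le> 1" using t r by auto
  have D0: "0 < ?D" using r by linarith
  have sD: "0 \<le> ?s * ?D" "?s * ?D \<le> ?D"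
    using mult_nonneg_nonneg[OF s(1), of ?D] mult_left_le_one_le[OF _ s, of ?D] D0 by linarith+
  let ?a = "c (?s * ?D)"
  have a: "?a \<in> building" by (rule segmentD(3)[OF seg sD])
  have cr: "c r \<in> building" using segmentD(3)[OF seg] r by auto
  have 1: "d (\<sigma> 0) ?a = ?s * ?D"
    using segmentD(4)[OF seg _ _ sD, of 0] segmentD(1)[OF seg] D0 sD r t by (simp add: abs_mult)
  have 2: "d ?a g = (1 - ?s) * ?D"
    using segmentD(4)[OF seg sD, of ?D] segmentD(2)[OF seg] D0 sD by (simp add: left_diff_distrib)
  have "d ?a (\<sigma> r) \<le> ?s * d g (\<sigma> t)"
    by (rule thales[OF b(1) g b(2) a b(3) s 1 2]) (use t t0 in \<open>simp_all add: left_diff_distrib\<close>)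
  also have "\<dots> \<le> ?s * C" using C s by (intro mult_left_mono)
  finally have 3: "d ?a (\<sigma> r) \<le> ?s * C" .
  have "\<bar>t - ?D\<bar> \<le> C"
    using dist_triangle[OF b(1) b(2) g] dist_triangle[OF b(1) g b(2)] t0(1) C dist_commute[of g "\<sigma> t"]
    by linarith
  hence "?s * \<bar>t - ?D\<bar> \<le> ?s * C" using s by (intro mult_left_mono)
  moreover have "d (c r) ?a = \<bar>r - ?s * ?D\<bar>"
    using segmentD(4)[OF seg _ _ sD, of r] r by simp
  moreover have "\<bar>r - ?s * ?D\<bar> = ?s * \<bar>t - ?D\<bar>"
  proof -
    have "r - ?s * ?D = ?s * (t - ?D)" using t by (simp add: right_diff_distrib)
    thus ?thesis using s r t by (simp add: abs_mult)
  qed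
  ultimately have "d (c r) ?a \<le> ?s * C" by simp
  moreover have "2 * r * C / t = ?s * C + ?s * C" by simp
  ultimately show ?thesis using 3 dist_triangle[OF cr a b(3)] by linarith
qed

text \<open>Again by \<open>thales\<close> and a change of the parameter, now with the apex at the far end \<open>\<gamma> t\<close>.\<close>

lemma segment_near_geodesic:
  assumes \<gamma>: "is_half_geodesic \<gamma>" and x: "x \<in> building" and seg: "is_segment c x (\<gamma> t)"
    and r: "0 < r" "r \<le> t" "r \<le> d x (\<gamma> t)"
  shows "d (c r) (\<gamma> r) \<le> 2 * d x (\<gamma> 0)"
proof -
  let ?D = "d x (\<gamma> t)" and ?u = "r / t" and ?A = "d x (\<gamma> 0)"
  have t: "0 < t" using r by linarith
  have b: "\<gamma> 0 \<in> building" "\<gamma> t \<in> building" "\<gamma> r \<in> building"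
    using half_geodesicD(1)[OF \<gamma>] t r by auto
  have t0: "d (\<gamma> 0) (\<gamma> t) = t" "d (\<gamma> t) (\<gamma> r) = t - r" "d (\<gamma> r) (\<gamma> 0) = r" "d (\<gamma> t) (\<gamma> 0) = t"
    using half_geodesicD(2)[OF \<gamma>] t r by auto
  have u: "0 \<le> ?u" "?u \<le> 1" using t r by auto
  have D0: "0 < ?D" using r by linarith
  have uD: "0 \<le> ?u * ?D" "?u * ?D \<le> ?D"
    using mult_nonneg_nonneg[OF u(1), of ?D] mult_left_le_one_le[OF _ u, of ?D] D0 by linarith+
  let ?a = "c (?u * ?D)"
  have a: "?a \<in> building" by (rule segmentD(3)[OF seg uD])
  have cr: "c r \<in> building" using segmentD(3)[OF seg] r by auto
  have 1: "d (\<gamma> t) ?a = (1 - ?u) * d (\<gamma> t) x"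
    using segmentD(4)[OF seg _ _ uD, of ?D] segmentD(2)[OF seg] D0 uD dist_commute[of "\<gamma> t" x]
    by (simp add: left_diff_distrib)
  have 2: "d ?a x = (1 - (1 - ?u)) * d (\<gamma> t) x"
    using segmentD(4)[OF seg uD, of 0] segmentD(1)[OF seg] D0 uD dist_commute[of "\<gamma> t" x] r t
    by (simp add: abs_mult)
  have s: "0 \<le> 1 - ?u" "1 - ?u \<le> 1" using u by auto
  have "d ?a (\<gamma> r) \<le> (1 - ?u) * ?A"
    by (rule thales[OF b(2) x b(1) a b(3) s 1 2]) (use t t0 in \<open>simp_all add: left_diff_distrib\<close>)
  hence 3: "d ?a (\<gamma> r) \<le> ?A" using s dist_nonneg[of x "\<gamma> 0"] mult_right_le_one_le[of ?A "1 - ?u"]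
    by (simp add: mult.commute)
  have tD: "\<bar>t - ?D\<bar> \<le> ?A"
    using dist_triangle[OF x b(1) b(2)] dist_triangle[OF b(1) x b(2)] t0(1) dist_commute[of "\<gamma> 0" x]
    by linarith
  have "d (c r) ?a = \<bar>r - ?u * ?D\<bar>"
    using segmentD(4)[OF seg _ _ uD, of r] r by simp
  also have "r - ?u * ?D = ?u * (t - ?D)" using t by (simp add: right_diff_distrib)
  also have "\<bar>?u * (t - ?D)\<bar> = ?u * \<bar>t - ?D\<bar>" using u r t by (simp add: abs_mult)
  also have "\<dots> \<le> ?A" using mult_mono[OF u(2) tD] by simp
  finally show ?thesis using 3 dist_triangle[OF cr a b(3)] by simp
qed

subsection \<open>Boundary classes\<close>

lemma in_boundary_class:
  "\<sigma> \<in> boundary_class \<rho> \<longleftrightarrow> is_half_geodesic \<sigma> \<and> (\<exists>C. \<forall>t\<ge>0. d (\<rho> t) (\<sigma> t) \<le> C)"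
  by (simp add: boundary_class_def)

lemma boundary_class_self: "is_half_geodesic \<rho> \<Longrightarrow> \<rho> \<in> boundary_class \<rho>"
  using dist_zero half_geodesicD(1) unfolding in_boundary_class by (metis order_refl)

lemma boundary_class_subset:
  assumes \<rho>: "is_half_geodesic \<rho>" and \<sigma>: "is_half_geodesic \<sigma>" and C: "\<And>t. 0 \<le> t \<Longrightarrow> d (\<rho> t) (\<sigma> t) \<le> C"
  shows "boundary_class \<sigma> \<subseteq> boundary_class \<rho>"
proof
  fix \<upsilon> assume "\<upsilon> \<in> boundary_class \<sigma>"
  then obtain B where \<upsilon>: "is_half_geodesic \<upsilon>" and B: "\<And>t. 0 \<le> t \<Longrightarrow> d (\<sigma> t) (\<upsilon> t) \<le> B"
    unfolding in_boundary_class by blast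
  have "d (\<rho> t) (\<upsilon> t) \<le> C + B" if "0 \<le> t" for t
    using dist_triangle[OF half_geodesicD(1)[OF \<rho> that] half_geodesicD(1)[OF \<sigma> that] half_geodesicD(1)[OF \<upsilon> that]]
      C[OF that] B[OF that] by linarith
  thus "\<upsilon> \<in> boundary_class \<rho>" unfolding in_boundary_class using \<upsilon> by blast
qed

lemma boundary_class_eq:
  assumes \<rho>: "is_half_geodesic \<rho>" and "\<sigma> \<in> boundary_class \<rho>"
  shows "boundary_class \<sigma> = boundary_class \<rho>"
proof -
  obtain C where \<sigma>: "is_half_geodesic \<sigma>" and C: "\<And>t. 0 \<le> t \<Longrightarrow> d (\<rho> t) (\<sigma> t) \<le> C"
    using assms(2) unfolding in_boundary_class by blast
  have C': "d (\<sigma> t) (\<rho> t) \<le> C" if "0 \<le> t" for t using C[OF that] dist_commute[of "\<sigma> t"] by simp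
  show ?thesis using boundary_class_subset[OF \<rho> \<sigma> C] boundary_class_subset[OF \<sigma> \<rho> C'] by blast
qed

lemma boundary_mem:
  assumes "y \<in> boundary" "\<sigma> \<in> y"
  shows "is_half_geodesic \<sigma>" "y = boundary_class \<sigma>"
proof -
  obtain \<rho> where \<rho>: "is_half_geodesic \<rho>" "y = boundary_class \<rho>" using assms(1) by (auto simp: boundary_def)
  show "is_half_geodesic \<sigma>" using assms(2) \<rho>(2) by (simp add: in_boundary_class)
  show "y = boundary_class \<sigma>" using boundary_class_eq[OF \<rho>(1)] assms(2) \<rho>(2) by simp
qed

text \<open>A neighbourhood of \<open>y\<close> in the cone topology only tests segments from a base point to \<open>\<gamma> t\<close>.
  If \<open>\<gamma>\<close> represents \<open>y\<close>, these segments tend to the half-geodesic of \<open>y\<close> from the same base point, by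
  \<open>segment_near_ray\<close>. Conversely, if they tend to a half-geodesic \<open>\<rho>\<close>, then \<open>\<gamma>\<close> stays at bounded
  distance from \<open>\<rho>\<close>, because it stays at bounded distance from the segments, by
  \<open>segment_near_geodesic\<close>.\<close>

lemma limit_in_compactification:
  assumes y: "y \<in> boundary" and \<gamma>: "is_half_geodesic \<gamma>"
  shows "limitin compactification (\<lambda>t. Inl (\<gamma> t)) (Inr y) at_top \<longleftrightarrow> \<gamma> \<in> y"
proof
  assume lim: "limitin compactification (\<lambda>t. Inl (\<gamma> t)) (Inr y) at_top"
  obtain \<rho> where \<rho>: "is_half_geodesic \<rho>" and y\<rho>: "y = boundary_class \<rho>" using y by (auto simp: boundary_def)
  have \<rho>0: "\<rho> 0 \<in> building" "\<gamma> 0 \<in> building" using half_geodesicD(1)[OF \<rho>] half_geodesicD(1)[OF \<gamma>] by auto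
  let ?A = "d (\<rho> 0) (\<gamma> 0)"
  have near: "d (\<rho> r) (\<gamma> r) \<le> 1 + 2 * ?A" if r: "0 \<le> r" for r
  proof (cases "r = 0")
    case True
    thus ?thesis using dist_nonneg[of "\<rho> 0" "\<gamma> 0"] by simp
  next
    case False
    hence r0: "0 < r" using r by simp
    let ?U = "cone_nbhd \<rho> r 1"
    have "openin compactification ?U"
      unfolding compactification_def
      by (rule topology_generated_by_Basis) (use \<rho> r0 in force)
    moreover have "Inr y \<in> ?U"
      unfolding cone_nbhd_def using y y\<rho> boundary_class_self[OF \<rho>]
        dist_zero[OF half_geodesicD(1)[OF \<rho> r] half_geodesicD(1)[OF \<rho> r]] by force
    ultimately have "\<forall>\<^sub>F t in at_top. Inl (\<gamma> t) \<in> ?U" using lim unfolding limitin_def by blast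
    then obtain T where T: "\<And>t. t \<ge> T \<Longrightarrow> Inl (\<gamma> t) \<in> ?U" unfolding eventually_at_top_linorder by blast
    define t where "t = max T r"
    have "Inl (\<gamma> t) \<in> ?U" by (rule T) (simp add: t_def)
    then obtain c where c: "r < d (\<rho> 0) (\<gamma> t)" "is_segment c (\<rho> 0) (\<gamma> t)" "d (c r) (\<rho> r) < 1"
      unfolding cone_nbhd_def by auto
    have "d (c r) (\<gamma> r) \<le> 2 * ?A"
      by (rule segment_near_geodesic[OF \<gamma> \<rho>0(1) c(2) r0]) (use c(1) in \<open>auto simp: t_def\<close>)
    moreover have "c r \<in> building" using segmentD(3)[OF c(2), of r] r c(1) by simp
    ultimately show ?thesis
      using dist_triangle[OF half_geodesicD(1)[OF \<rho> r] _ half_geodesicD(1)[OF \<gamma> r], of "c r"]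
        c(3) dist_commute[of "c r" "\<rho> r"] by simp
  qed
  thus "\<gamma> \<in> y" unfolding y\<rho> in_boundary_class using \<gamma> by blast
next
  assume \<gamma>y: "\<gamma> \<in> y"
  let ?B = "{Inl ` Metric_space.mball building d x \<epsilon> | x \<epsilon>. x \<in> building \<and> \<epsilon> > 0} \<union>
      {cone_nbhd \<rho> r \<epsilon> | \<rho> r \<epsilon>. is_half_geodesic \<rho> \<and> r > 0 \<and> \<epsilon> > 0}"
  have sub: "\<forall>\<^sub>F t in at_top. Inl (\<gamma> t) \<in> cone_nbhd \<rho> r \<epsilon>"
    if \<rho>: "is_half_geodesic \<rho>" "r > 0" "\<epsilon> > 0" and mem: "Inr y \<in> cone_nbhd \<rho> r \<epsilon>" for \<rho> r \<epsilon>
  proof -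
    obtain \<sigma> where \<sigma>: "\<sigma> \<in> y" "\<sigma> 0 = \<rho> 0" "d (\<sigma> r) (\<rho> r) < \<epsilon>"
      using mem unfolding cone_nbhd_def by auto
    have \<sigma>h: "is_half_geodesic \<sigma>" and y\<sigma>: "y = boundary_class \<sigma>" using boundary_mem[OF y \<sigma>(1)] by auto
    obtain C where C: "\<And>t. 0 \<le> t \<Longrightarrow> d (\<sigma> t) (\<gamma> t) \<le> C"
      using \<gamma>y unfolding y\<sigma> in_boundary_class by blast
    have C0: "0 \<le> C" using C[of 0] dist_nonneg[of "\<sigma> 0" "\<gamma> 0"] by linarith
    define \<delta> where "\<delta> = \<epsilon> - d (\<sigma> r) (\<rho> r)"
    have \<delta>: "\<delta> > 0" using \<sigma>(3) by (simp add: \<delta>_def)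
    define T where "T = max (r + C + 1) (2 * r * C / \<delta> + 1)"
    have "Inl (\<gamma> t) \<in> cone_nbhd \<rho> r \<epsilon>" if t: "t \<ge> T" for t
    proof -
      have t1: "t \<ge> r + C + 1" "t \<ge> 2 * r * C / \<delta> + 1" using t by (auto simp: T_def)
      have t0: "0 < t" using t1(1) C0 \<rho>(2) by linarith
      have b: "\<sigma> 0 \<in> building" "\<gamma> t \<in> building" "\<sigma> t \<in> building" "\<sigma> r \<in> building" "\<rho> r \<in> building"
        using half_geodesicD(1)[OF \<sigma>h] half_geodesicD(1)[OF \<gamma>] half_geodesicD(1)[OF \<rho>(1)] t0 \<rho>(2) by auto
      have Ct: "d (\<gamma> t) (\<sigma> t) \<le> C" using C[of t] t0 dist_commute[of "\<gamma> t"] by simp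
      have "t = d (\<sigma> 0) (\<sigma> t)" using half_geodesicD(2)[OF \<sigma>h, of 0 t] t0 by simp
      hence far: "r < d (\<sigma> 0) (\<gamma> t)"
        using dist_triangle[OF b(1) b(2) b(3)] Ct t1(1) by linarith
      obtain c where c: "is_segment c (\<sigma> 0) (\<gamma> t)" using segment_exists[OF b(1,2)] by blast
      have cb: "c r \<in> building" using segmentD(3)[OF c] far \<rho>(2) by simp
      have "d (c r) (\<sigma> r) \<le> 2 * r * C / t"
        by (rule segment_near_ray[OF \<sigma>h b(2) t0 Ct c \<rho>(2)]) (use far t1(1) C0 in auto)
      also have "\<dots> < \<delta>"
      proof -
        have "2 * r * C / \<delta> < t" using t1(2) by linarith
        thus ?thesis using t0 \<delta> by (simp add: field_simps)
      qed
      finally have "d (c r) (\<rho> r) < \<epsilon>"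
        using dist_triangle[OF cb b(4,5)] by (simp add: \<delta>_def)
      thus ?thesis unfolding cone_nbhd_def using b(2) far c \<sigma>(2) by auto
    qed
    thus ?thesis unfolding eventually_at_top_linorder by blast
  qed
  have gen: "Inr y \<in> U \<longrightarrow> (\<forall>\<^sub>F t in at_top. Inl (\<gamma> t) \<in> U)" if "generate_topology_on ?B U" for U
    using that
  proof (induction rule: generate_topology_on.induct)
    case (Int a b)
    thus ?case by (auto intro: eventually_conj)
  next
    case (UN K)
    show ?case
    proof
      assume "Inr y \<in> \<Union>K"
      then obtain k where k: "k \<in> K" "Inr y \<in> k" by blast
      hence "\<forall>\<^sub>F t in at_top. Inl (\<gamma> t) \<in> k" using UN by blast
      thus "\<forall>\<^sub>F t in at_top. Inl (\<gamma> t) \<in> \<Union>K" by (rule eventually_mono) (use k in blast)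
    qed
  next
    case (Basis s)
    thus ?case using sub by auto
  qed simp
  have "Inr y \<in> topspace compactification"
  proof -
    have "Inr y \<in> cone_nbhd \<gamma> 1 1"
      unfolding cone_nbhd_def using y \<gamma>y
        dist_zero[OF half_geodesicD(1)[OF \<gamma>] half_geodesicD(1)[OF \<gamma>], of 1 1] by force
    moreover have "\<exists>\<rho> r \<epsilon>. cone_nbhd \<gamma> 1 1 = cone_nbhd \<rho> r \<epsilon> \<and> is_half_geodesic \<rho> \<and> 0 < r \<and> 0 < \<epsilon>"
      using \<gamma> by (intro exI[of _ \<gamma>] exI[of _ 1]) simp
    hence "cone_nbhd \<gamma> 1 1 \<in> ?B" by blast
    ultimately show ?thesis unfolding compactification_def topology_generated_by_topspace by blast
  qed
  moreover have "\<forall>\<^sub>F t in at_top. Inl (\<gamma> t) \<in> U" if "openin compactification U" "Inr y \<in> U" for U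
    using that gen[of U] unfolding compactification_def openin_topology_generated_by_iff by blast
  ultimately show "limitin compactification (\<lambda>t. Inl (\<gamma> t)) (Inr y) at_top"
    unfolding limitin_def by blast
qed

lemma limitin_at_bot: "limitin X f l at_bot \<longleftrightarrow> limitin X (\<lambda>t::real. f (- t)) l at_top"
  unfolding limitin_def at_bot_mirror eventually_filtermap ..

lemma connects_iff:
  assumes \<gamma>: "is_geodesic \<gamma>" and y: "y \<in> boundary" and y': "y' \<in> boundary"
  shows "connects \<gamma> y y' \<longleftrightarrow> \<gamma> \<in> y \<and> (\<lambda>t. \<gamma> (- t)) \<in> y' \<or> \<gamma> \<in> y' \<and> (\<lambda>t. \<gamma> (- t)) \<in> y"
proof -
  have "is_half_geodesic \<gamma>" "is_half_geodesic (\<lambda>t. \<gamma> (- t))"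
    using \<gamma> by (auto simp: is_geodesic_def is_half_geodesic_def)
  thus ?thesis
    unfolding connects_def limitin_at_bot using limit_in_compactification y y' by blast
qed

end

context bruhat_tits_building
begin

section \<open>The action of the general linear group\<close>

lemma GL_linear:
  assumes "g \<in> GL"
  shows "g (u + v) = g u + g v" "g (c *s v) = c *s g v" "bij g" "g 0 = 0" "g v = 0 \<longleftrightarrow> v = 0"
    "g (\<Sum>i\<in>A. a i *s f i) = (\<Sum>i\<in>A. a i *s g (f i))"
proof -
  have lin: "Vector_Spaces.linear scale scale g" and bij: "bij g" using assms by (auto simp: GL_def)
  interpret g: Vector_Spaces.linear scale scale g by (rule lin)
  show "g (u + v) = g u + g v" "g (c *s v) = c *s g v" "bij g" "g 0 = 0"
    by (rule g.add g.scale bij g.zero)+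
  show "g v = 0 \<longleftrightarrow> v = 0" using bij g.zero by (metis bij_pointE)
  show "g (\<Sum>i\<in>A. a i *s f i) = (\<Sum>i\<in>A. a i *s g (f i))" by (simp add: g.sum g.scale)
qed

lemma GL_inv:
  assumes "g \<in> GL"
  shows "inv g \<in> GL" "g (inv g v) = v" "inv g (g v) = v" "inv (inv g) = g"
proof -
  note g = GL_linear[OF assms]
  show 1: "g (inv g v) = v" for v using g(3) by (simp add: bij_is_surj surj_f_inv_f)
  show 2: "inv g (g v) = v" for v using g(3) by (simp add: bij_is_inj)
  have "inv g (u + v) = inv g u + inv g v" for u v
    using g(1)[of "inv g u" "inv g v"] 1 2 by metis
  moreover have "inv g (c *s v) = c *s inv g v" for c v
    using g(2)[of c "inv g v"] 1 2 by metis
  ultimately have "Vector_Spaces.linear scale scale (inv g)"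
    by (intro Vector_Spaces.linear.intro module_hom.intro module_hom_axioms.intro)
      (unfold_locales, auto)
  thus "inv g \<in> GL" using g(3) by (simp add: GL_def bij_imp_bij_inv)
  show "inv (inv g) = g" using g(3) by (rule inv_inv_eq)
qed

lemma GL_basis:
  assumes g: "g \<in> GL" and w: "is_basis w"
  shows "is_basis (g \<circ> w)"
proof -
  have lin: "Vector_Spaces.linear scale scale g" and bij: "bij g" using g by (auto simp: GL_def)
  interpret g: Vector_Spaces.linear scale scale g by (rule lin)
  have inj: "inj g" by (rule bij_is_inj[OF bij])
  have w': "inj_on w {..<n}" "independent (w ` {..<n})" "span (w ` {..<n}) = UNIV"
    using w by (auto simp: is_basis_def)
  have "inj_on (g \<circ> w) {..<n}" using w'(1) inj by (intro comp_inj_on) (auto intro: inj_on_subset)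
  moreover have "independent (g ` w ` {..<n})"
    by (rule g.independent_injective_image[OF w'(2)]) (rule inj_on_subset[OF inj], simp)
  moreover have "span (g ` w ` {..<n}) = UNIV"
    unfolding g.span_image w'(3) using bij_is_surj[OF bij] by simp
  ultimately show ?thesis unfolding is_basis_def image_comp by blast
qed

lemma GL_lattice_of:
  assumes g: "g \<in> GL"
  shows "g ` lattice_of w = lattice_of (g \<circ> w)"
proof -
  have eq: "(\<Sum>i<n. a i *s (g \<circ> w) i) = g (\<Sum>i<n. a i *s w i)" for a
    by (simp add: GL_linear(6)[OF g])
  show ?thesis unfolding lattice_of_def eq by blast
qed

lemma GL_lattice:
  assumes g: "g \<in> GL" and L: "is_lattice L"
  shows "is_lattice (g ` L)"
proof -
  obtain w where w: "is_basis w" "L = lattice_of w" using L by (auto simp: is_lattice_def)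
  show ?thesis unfolding w(2) GL_lattice_of[OF g] is_lattice_def using GL_basis[OF g w(1)] by blast
qed

lemma GL_scale_image: "g \<in> GL \<Longrightarrow> g ` scale c ` L = scale c ` g ` L"
  by (simp add: image_image GL_linear(2))

lemma gauge_GL:
  assumes g: "g \<in> GL"
  shows "gauge (g ` L) (g v) = gauge L v"
proof -
  have "inj g" using GL_linear(3)[OF g] by (rule bij_is_inj)
  hence "g v \<in> scale c ` g ` L \<longleftrightarrow> v \<in> scale c ` L" for c
    unfolding GL_scale_image[OF g, symmetric] by (rule inj_image_mem_iff)
  thus ?thesis by (simp add: gauge_def)
qed

lemma act_vertex_class:
  assumes g: "g \<in> GL"
  shows "act_vertex g (lattice_class M) = lattice_class (g ` M)"
proof -
  have "act_vertex g (lattice_class M) = {g ` scale c ` M | c. c \<noteq> 0}"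
    unfolding act_vertex_def lattice_class_def by blast
  thus ?thesis unfolding GL_scale_image[OF g] lattice_class_def .
qed

lemma act_vertex_inv:
  assumes g: "g \<in> GL"
  shows "act_vertex g (act_vertex (inv g) u) = u" "act_vertex (inv g) (act_vertex g u) = u"
  by (simp_all add: act_vertex_def image_image GL_inv[OF g])

lemma act_vertex_vertices:
  assumes g: "g \<in> GL" and u: "u \<in> vertices"
  shows "act_vertex g u \<in> vertices"
proof -
  obtain M where M: "is_lattice M" "u = lattice_class M" using u by (auto simp: vertices_def)
  show ?thesis
    unfolding M(2) act_vertex_class[OF g] vertices_def using GL_lattice[OF g M(1)] by blast
qed

lemma act_vertex_vgauge:
  assumes g: "g \<in> GL" and u: "u \<in> vertices"
  obtains A where "0 < A" "\<And>v. vgauge (act_vertex g u) (g v) = A * vgauge u v"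
proof -
  have "rep u \<in> u" using vertex_rep(2)[OF u] lattice_class_self by metis
  hence "g ` rep u \<in> act_vertex g u" by (simp add: act_vertex_def)
  then obtain A where A: "0 < A" "\<And>v. gauge (g ` rep u) v = A * vgauge (act_vertex g u) v"
    using gauge_member[OF act_vertex_vertices[OF g u]] by metis
  show ?thesis
  proof (rule that[of "1 / A"])
    show "vgauge (act_vertex g u) (g v) = 1 / A * vgauge u v" for v
      using A(1) A(2)[of "g v"] gauge_GL[OF g, of "rep u" v] by simp
  qed (use A(1) in simp)
qed

lemma act_adjacent:
  assumes g: "g \<in> GL" and adj: "adjacent u u'"
  shows "adjacent (act_vertex g u) (act_vertex g u')"
proof -
  obtain M N where MN: "M \<in> u" "N \<in> u'" "scale \<pi> ` N \<subseteq> M" "M \<subseteq> N" and ne: "u \<noteq> u'"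
    using adj by (auto simp: adjacent_def)
  have "act_vertex g u \<noteq> act_vertex g u'" using ne act_vertex_inv(2)[OF g] by metis
  moreover have "scale \<pi> ` g ` N \<subseteq> g ` M" "g ` M \<subseteq> g ` N"
    using image_mono[OF MN(3), of g] image_mono[OF MN(4), of g] by (simp_all add: GL_scale_image[OF g])
  moreover have "g ` M \<in> act_vertex g u" "g ` N \<in> act_vertex g u'"
    using MN(1,2) by (auto simp: act_vertex_def)
  ultimately show ?thesis unfolding adjacent_def by blast
qed

lemma supp_act_point:
  assumes g: "g \<in> GL"
  shows "supp (act_point g x) = act_vertex g ` supp x"
proof (intro equalityI subsetI)
  fix u assume "u \<in> supp (act_point g x)"
  hence "act_vertex (inv g) u \<in> supp x" by (simp add: supp_def act_point_def)
  thus "u \<in> act_vertex g ` supp x" using act_vertex_inv(1)[OF g, of u] by (metis imageI)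
next
  fix u assume "u \<in> act_vertex g ` supp x"
  thus "u \<in> supp (act_point g x)"
    by (auto simp: supp_def act_point_def act_vertex_inv(2)[OF g])
qed

lemma act_vertex_inj:
  assumes "g \<in> GL"
  shows "inj_on (act_vertex g) S"
  using act_vertex_inv(2)[OF assms] by (rule inj_on_inverseI)

lemma act_point_act_vertex:
  assumes "g \<in> GL"
  shows "act_point g x (act_vertex g u) = x u"
  by (simp add: act_point_def act_vertex_inv(2)[OF assms])

lemma act_point_building:
  assumes g: "g \<in> GL" and x: "x \<in> building"
  shows "act_point g x \<in> building"
proof (rule buildingI)
  show "finite (supp (act_point g x))"
    unfolding supp_act_point[OF g] using buildingD(1)[OF x] by simp
  show "supp (act_point g x) \<subseteq> vertices"
    unfolding supp_act_point[OF g] using buildingD(3)[OF x] act_vertex_vertices[OF g] by auto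
  show "sum (act_point g x) (supp (act_point g x)) = 1"
    unfolding supp_act_point[OF g] sum.reindex[OF act_vertex_inj[OF g]]
    by (simp add: act_point_act_vertex[OF g] buildingD(4)[OF x] comp_def)
  show "0 \<le> act_point g x u" for u
    using buildingD(5)[OF x, of "act_vertex (inv g) u"] unfolding act_point_def supp_def by force
  fix u u' assume "u \<in> supp (act_point g x)" "u' \<in> supp (act_point g x)" "u \<noteq> u'"
  then obtain v v' where "v \<in> supp x" "v' \<in> supp x" "u = act_vertex g v" "u' = act_vertex g v'" "v \<noteq> v'"
    unfolding supp_act_point[OF g] by blast
  thus "adjacent u u'" using act_adjacent[OF g buildingD(6)[OF x]] by blast
qed

lemma act_point_inv:
  assumes g: "g \<in> GL"
  shows "act_point g (act_point (inv g) x) = x"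
  by (simp add: act_point_def GL_inv(4)[OF g] act_vertex_inv[OF g])

lemma pnorm_act_point:
  assumes g: "g \<in> GL" and x: "x \<in> building"
  shows "\<exists>c. \<forall>v. v \<noteq> 0 \<longrightarrow> log q (pnorm (act_point g x) (g v)) = log q (pnorm x v) + c"
proof -
  have "\<exists>A>0. \<forall>v. vgauge (act_vertex g u) (g v) = A * vgauge u v" if "u \<in> supp x" for u
    using act_vertex_vgauge[OF g, of u] that buildingD(3)[OF x] by blast
  then obtain A where A: "\<And>u. u \<in> supp x \<Longrightarrow> 0 < A u"
    "\<And>u v. u \<in> supp x \<Longrightarrow> vgauge (act_vertex g u) (g v) = A u * vgauge u v" by metis
  have "log q (pnorm (act_point g x) (g v)) = log q (pnorm x v) + (\<Sum>u\<in>supp x. x u * log q (A u))"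
    if v: "v \<noteq> 0" for v
  proof -
    have "g v \<noteq> 0" using v GL_linear(5)[OF g] by simp
    hence "log q (pnorm (act_point g x) (g v)) =
        (\<Sum>u\<in>supp x. x u * log q (vgauge (act_vertex g u) (g v)))"
      by (simp add: log_pnorm supp_act_point[OF g] sum.reindex[OF act_vertex_inj[OF g]]
        act_point_act_vertex[OF g])
    also have "\<dots> = (\<Sum>u\<in>supp x. x u * log q (vgauge u v) + x u * log q (A u))"
    proof (intro sum.cong refl)
      fix u assume u: "u \<in> supp x"
      hence "vgauge u v > 0" using vgauge_pos v buildingD(3)[OF x] by blast
      thus "x u * log q (vgauge (act_vertex g u) (g v)) = x u * log q (vgauge u v) + x u * log q (A u)"
        using A(1)[OF u] unfolding A(2)[OF u] by (simp add: log_mult_pos algebra_simps)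
    qed
    finally show ?thesis using v by (simp add: sum.distrib log_pnorm)
  qed
  thus ?thesis by (intro exI allI impI)
qed

section \<open>Norms at bounded distance\<close>

text \<open>The constant \<open>c\<close> is allowed because norms represent points up to a factor.\<close>

definition near :: "real \<Rightarrow> ('v \<Rightarrow> real) \<Rightarrow> ('v \<Rightarrow> real) \<Rightarrow> bool" where
  "near B N N' \<longleftrightarrow> (\<exists>c. \<forall>v. v \<noteq> 0 \<longrightarrow> \<bar>log q (N v) - log q (N' v) - c\<bar> \<le> B)"

lemma log_norm_scale:
  assumes "nonarch_norm N" "a \<noteq> 0" "v \<noteq> 0"
  shows "log q (N (a *s v)) = log q (absv a) + log q (N v)"
  unfolding nonarch_normD(3)[OF assms(1)]
  using absv_pos[OF assms(2)] nonarch_normD(5)[OF assms(1,3)] by (rule log_mult_pos)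

lemma log_norm_le_term:
  assumes N: "nonarch_norm N" and w: "is_basis w" and nz: "(\<Sum>i<n. a i *s w i) \<noteq> 0"
  obtains i where "i < n" "a i \<noteq> 0"
    "log q (N (\<Sum>i<n. a i *s w i)) \<le> log q (absv (a i)) + log q (N (w i))"
proof -
  obtain i where i: "i < n" "N (\<Sum>i<n. a i *s w i) \<le> absv (a i) * N (w i)"
    by (rule norm_combination_le_term[OF N nz])
  have pos: "N (\<Sum>i<n. a i *s w i) > 0" by (rule nonarch_normD(5)[OF N nz])
  have ai: "a i \<noteq> 0" using i(2) pos by auto
  have "log q (N (\<Sum>i<n. a i *s w i)) \<le> log q (absv (a i) * N (w i))"
    using i(2) pos q_gt_1 by simp
  also have "\<dots> = log q (absv (a i)) + log q (N (w i))"
    using absv_pos[OF ai] nonarch_normD(5)[OF N basis_nz[OF w i(1)]] by (rule log_mult_pos)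
  finally show ?thesis using that i(1) ai by blast
qed

lemma log_norm_adapted_ge:
  assumes N: "nonarch_norm N" and w: "is_basis w" and ad: "adapted N w" and i: "i < n" "a i \<noteq> 0"
  shows "log q (absv (a i)) + log q (N (w i)) \<le> log q (N (\<Sum>i<n. a i *s w i))"
proof -
  have pos: "absv (a i) > 0" "N (w i) > 0"
    using absv_pos[OF i(2)] nonarch_normD(5)[OF N basis_nz[OF w i(1)]] by auto
  have le: "absv (a i) * N (w i) \<le> N (\<Sum>i<n. a i *s w i)" by (rule adaptedD[OF ad i(1)])
  have "log q (absv (a i)) + log q (N (w i)) = log q (absv (a i) * N (w i))"
    using pos by (simp add: log_mult_pos)
  also have "\<dots> \<le> log q (N (\<Sum>i<n. a i *s w i))"
    using le pos q_gt_1 mult_pos_pos[OF pos] by (subst log_le_cancel_iff) linarith+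
  finally show ?thesis .
qed

text \<open>The hypothesis on linear combinations says that \<open>w\<close> is orthogonal for \<open>N\<close> up to a factor \<open>q powr C\<close>. In this form it
  results from invariance of a half-geodesic under elementary maps.\<close>

lemma near_coordinates:
  assumes N: "nonarch_norm N" and P: "nonarch_norm P" and w: "is_basis w"
    and c: "\<And>i. i < n \<Longrightarrow> \<bar>log q (N (w i)) - log q (P (w i)) - c\<bar> \<le> B"
    and N': "\<And>a i. i < n \<Longrightarrow> a i \<noteq> 0 \<Longrightarrow> log q (absv (a i)) + log q (N (w i)) \<le> log q (N (\<Sum>i<n. a i *s w i)) + C"
    and P': "adapted P w" and C: "0 \<le> C"
  shows "near (B + C) N P"
  unfolding near_def
proof (intro exI allI impI)
  fix v :: 'v assume v: "v \<noteq> 0"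
  obtain a where a: "v = (\<Sum>i<n. a i *s w i)" using basis_coeffs[OF w] by blast
  note nz = v[unfolded a]
  obtain i where i: "i < n" "a i \<noteq> 0" "log q (N v) \<le> log q (absv (a i)) + log q (N (w i))"
    unfolding a by (rule log_norm_le_term[OF N w nz])
  obtain j where j: "j < n" "a j \<noteq> 0" "log q (P v) \<le> log q (absv (a j)) + log q (P (w j))"
    unfolding a by (rule log_norm_le_term[OF P w nz])
  have "log q (absv (a i)) + log q (P (w i)) \<le> log q (P v)"
    unfolding a by (rule log_norm_adapted_ge[of P w i a, OF P w P' i(1,2)])
  moreover have "log q (absv (a j)) + log q (N (w j)) \<le> log q (N v) + C"
    unfolding a by (rule N'[of j a, OF j(1,2)])
  ultimately show "\<bar>log q (N v) - log q (P v) - c\<bar> \<le> B + C"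
    using i(3) j(3) c[OF i(1)] c[OF j(1)] C by linarith
qed

end

context metric_bruhat_tits_building
begin

lemma near_of_dist:
  assumes x: "x \<in> building" and y: "y \<in> building" and "d x y \<le> D"
  shows "near (D / sqrt ipc) (pnorm x) (pnorm y)"
proof -
  obtain w where w: "is_basis w" "x \<in> apartment w" "y \<in> apartment w"
    using common_apartment[OF x y] by blast
  let ?a = "\<lambda>i. wt w x i - wt w y i"
  have dxy: "d x y = nrm ?a" by (rule dist_wt[OF w, of _ 0 _ 0]) simp_all
  have "near (D / sqrt ipc + 0) (pnorm x) (pnorm y)"
  proof (rule near_coordinates[OF pnorm_norm[OF x] pnorm_norm[OF y] w(1)])
    fix i assume "i < n"
    hence "\<bar>?a i - (\<Sum>i<n. ?a i) / n\<bar> \<le> nrm ?a / sqrt ipc" by (rule nrm_ge)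
    also have "\<dots> \<le> D / sqrt ipc" using assms(3) dxy ipc(1) by (simp add: divide_right_mono)
    finally show "\<bar>log q (pnorm x (w i)) - log q (pnorm y (w i)) - (\<Sum>i<n. ?a i) / n\<bar> \<le> D / sqrt ipc"
      by (simp add: wt_def)
  next
    fix a :: "nat \<Rightarrow> 'k" and i assume "i < n" "a i \<noteq> 0"
    thus "log q (absv (a i)) + log q (pnorm x (w i)) \<le> log q (pnorm x (\<Sum>i<n. a i *s w i)) + 0"
      using log_norm_adapted_ge[of "pnorm x" w i a, OF pnorm_norm[OF x] w(1) apartment_adapted[OF w(1,2)]]
      by simp
  qed (use apartment_adapted[OF w(1,3)] in auto)
  thus ?thesis by simp
qed

lemma dist_of_near:
  assumes x: "x \<in> building" and y: "y \<in> building" and nr: "near B (pnorm x) (pnorm y)" and B: "0 \<le> B"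
  shows "d x y \<le> sqrt (ipc * n) * B"
proof -
  obtain w where w: "is_basis w" "x \<in> apartment w" "y \<in> apartment w"
    using common_apartment[OF x y] by blast
  obtain c where c: "\<And>v. v \<noteq> 0 \<Longrightarrow> \<bar>log q (pnorm x v) - log q (pnorm y v) - c\<bar> \<le> B"
    using nr unfolding near_def by blast
  have "d x y = nrm (\<lambda>i. wt w x i - wt w y i)" by (rule dist_wt[OF w, of _ 0 _ 0]) simp_all
  also have "\<dots> \<le> sqrt (ipc * n) * B"
    by (rule nrm_le[OF _ B]) (use c basis_nz[OF w(1)] in \<open>auto simp: wt_def\<close>)
  finally show ?thesis .
qed

text \<open>By \<open>displacement_near\<close> and the comparison of norms and distances this says that \<open>g\<close> moves the
  points \<open>\<rho> t\<close> by bounded distances.\<close>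

definition bounded_distortion :: "('v \<Rightarrow> 'v) \<Rightarrow> (real \<Rightarrow> 'v set set \<Rightarrow> real) \<Rightarrow> bool" where
  "bounded_distortion g \<rho> \<longleftrightarrow> (\<exists>B\<ge>0. \<forall>t\<ge>0. \<exists>c. \<forall>v. v \<noteq> 0 \<longrightarrow>
     \<bar>log q (pnorm (\<rho> t) (g v)) - log q (pnorm (\<rho> t) v) - c\<bar> \<le> B)"

lemma displacement_near:
  assumes g: "g \<in> GL" and x: "x \<in> building"
  shows "(\<exists>c. \<forall>v. v \<noteq> 0 \<longrightarrow> \<bar>log q (pnorm x (g v)) - log q (pnorm x v) - c\<bar> \<le> B) \<longleftrightarrow>
    near B (pnorm x) (pnorm (act_point g x))"
proof -
  obtain k where k: "\<And>v. v \<noteq> 0 \<Longrightarrow> log q (pnorm (act_point g x) (g v)) = log q (pnorm x v) + k"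
    using pnorm_act_point[OF g x] by blast
  show ?thesis
  proof
    assume "\<exists>c. \<forall>v. v \<noteq> 0 \<longrightarrow> \<bar>log q (pnorm x (g v)) - log q (pnorm x v) - c\<bar> \<le> B"
    then obtain c where c: "\<And>v. v \<noteq> 0 \<Longrightarrow> \<bar>log q (pnorm x (g v)) - log q (pnorm x v) - c\<bar> \<le> B" by blast
    have "\<bar>log q (pnorm x v) - log q (pnorm (act_point g x) v) - (c - k)\<bar> \<le> B" if "v \<noteq> 0" for v
    proof -
      have "inv g v \<noteq> 0" using that GL_linear(5)[OF GL_inv(1)[OF g]] by simp
      thus ?thesis using c[of "inv g v"] k[of "inv g v"] GL_inv(2)[OF g] by simp
    qed
    thus "near B (pnorm x) (pnorm (act_point g x))" unfolding near_def by blast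
  next
    assume "near B (pnorm x) (pnorm (act_point g x))"
    then obtain c where c: "\<And>v. v \<noteq> 0 \<Longrightarrow> \<bar>log q (pnorm x v) - log q (pnorm (act_point g x) v) - c\<bar> \<le> B"
      unfolding near_def by blast
    have "\<bar>log q (pnorm x (g v)) - log q (pnorm x v) - (c + k)\<bar> \<le> B" if "v \<noteq> 0" for v
    proof -
      have "g v \<noteq> 0" using that GL_linear(5)[OF g] by simp
      thus ?thesis using c[of "g v"] k[OF that] by simp
    qed
    thus "\<exists>c. \<forall>v. v \<noteq> 0 \<longrightarrow> \<bar>log q (pnorm x (g v)) - log q (pnorm x v) - c\<bar> \<le> B" by blast
  qed
qed

lemma act_half_geodesic:
  assumes g: "g \<in> GL" and \<rho>: "is_half_geodesic \<rho>"
  shows "is_half_geodesic (\<lambda>t. act_point g (\<rho> t))"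
  using \<rho> act_point_building[OF g] d_invariant[OF g] by (auto simp: is_half_geodesic_def)

lemma fixes_class_iff:
  assumes g: "g \<in> GL" and \<rho>: "is_half_geodesic \<rho>"
  shows "act_boundary g (boundary_class \<rho>) = boundary_class \<rho> \<longleftrightarrow> bounded_distortion g \<rho>"
proof
  assume fix': "act_boundary g (boundary_class \<rho>) = boundary_class \<rho>"
  have "(\<lambda>t. act_point g (\<rho> t)) \<in> act_boundary g (boundary_class \<rho>)"
    unfolding act_boundary_def using boundary_class_self[OF \<rho>] by (rule imageI)
  then obtain C where C: "\<And>t. 0 \<le> t \<Longrightarrow> d (\<rho> t) (act_point g (\<rho> t)) \<le> C"
    unfolding fix' in_boundary_class by blast
  have "0 \<le> C" using C[of 0] dist_nonneg[of "\<rho> 0" "act_point g (\<rho> 0)"] by linarith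
  hence "0 \<le> C / sqrt ipc" using ipc(1) by simp
  moreover have "\<exists>c. \<forall>v. v \<noteq> 0 \<longrightarrow> \<bar>log q (pnorm (\<rho> t) (g v)) - log q (pnorm (\<rho> t) v) - c\<bar> \<le> C / sqrt ipc"
    if t: "0 \<le> t" for t
    unfolding displacement_near[OF g half_geodesicD(1)[OF \<rho> t]]
    by (rule near_of_dist[OF half_geodesicD(1)[OF \<rho> t] act_point_building[OF g half_geodesicD(1)[OF \<rho> t]] C[OF t]])
  ultimately show "bounded_distortion g \<rho>" unfolding bounded_distortion_def by blast
next
  assume "bounded_distortion g \<rho>"
  then obtain B where B: "0 \<le> B" "\<forall>t\<ge>0. \<exists>c. \<forall>v. v \<noteq> 0 \<longrightarrow>
      \<bar>log q (pnorm (\<rho> t) (g v)) - log q (pnorm (\<rho> t) v) - c\<bar> \<le> B"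
    unfolding bounded_distortion_def by (elim exE conjE)
  let ?g\<rho> = "\<lambda>t. act_point g (\<rho> t)"
  have C: "d (\<rho> t) (?g\<rho> t) \<le> sqrt (ipc * n) * B" if t: "0 \<le> t" for t
  proof -
    note b = half_geodesicD(1)[OF \<rho> t]
    have "near B (pnorm (\<rho> t)) (pnorm (?g\<rho> t))"
      unfolding displacement_near[OF g b, symmetric] using B(2) t by simp
    thus ?thesis by (rule dist_of_near[OF b act_point_building[OF g b] _ B(1)])
  qed
  have g\<rho>: "is_half_geodesic ?g\<rho>" by (rule act_half_geodesic[OF g \<rho>])
  have eq: "boundary_class ?g\<rho> = boundary_class \<rho>"
    by (rule boundary_class_eq[OF \<rho>]) (use g\<rho> C in \<open>auto simp: in_boundary_class\<close>)
  show "act_boundary g (boundary_class \<rho>) = boundary_class \<rho>"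
    unfolding eq[symmetric]
  proof (intro equalityI subsetI)
    fix \<upsilon> assume "\<upsilon> \<in> act_boundary g (boundary_class ?g\<rho>)"
    then obtain \<sigma> where \<sigma>: "\<sigma> \<in> boundary_class \<rho>" "\<upsilon> = (\<lambda>t. act_point g (\<sigma> t))"
      unfolding eq act_boundary_def by blast
    obtain D where \<sigma>h: "is_half_geodesic \<sigma>" and D: "\<And>t. 0 \<le> t \<Longrightarrow> d (\<rho> t) (\<sigma> t) \<le> D"
      using \<sigma>(1) unfolding in_boundary_class by blast
    have "d (?g\<rho> t) (\<upsilon> t) \<le> D" if "0 \<le> t" for t
      unfolding \<sigma>(2) using d_invariant[OF g half_geodesicD(1)[OF \<rho> that] half_geodesicD(1)[OF \<sigma>h that]] D[OF that]
      by simp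
    thus "\<upsilon> \<in> boundary_class ?g\<rho>"
      unfolding in_boundary_class \<sigma>(2) using act_half_geodesic[OF g \<sigma>h] by blast
  next
    fix \<upsilon> assume "\<upsilon> \<in> boundary_class ?g\<rho>"
    then obtain D where \<upsilon>h: "is_half_geodesic \<upsilon>" and D: "\<And>t. 0 \<le> t \<Longrightarrow> d (?g\<rho> t) (\<upsilon> t) \<le> D"
      unfolding in_boundary_class by blast
    define \<sigma> where "\<sigma> = (\<lambda>t. act_point (inv g) (\<upsilon> t))"
    have \<sigma>h: "is_half_geodesic \<sigma>" unfolding \<sigma>_def by (rule act_half_geodesic[OF GL_inv(1)[OF g] \<upsilon>h])
    have \<upsilon>: "\<upsilon> = (\<lambda>t. act_point g (\<sigma> t))" unfolding \<sigma>_def by (simp add: act_point_inv[OF g])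
    have "d (\<rho> t) (\<sigma> t) \<le> D" if "0 \<le> t" for t
      using d_invariant[OF g half_geodesicD(1)[OF \<rho> that] half_geodesicD(1)[OF \<sigma>h that]] D[OF that]
      unfolding \<upsilon> by simp
    hence "\<sigma> \<in> boundary_class \<rho>" unfolding in_boundary_class using \<sigma>h by blast
    thus "\<upsilon> \<in> act_boundary g (boundary_class ?g\<rho>)"
      unfolding eq act_boundary_def \<upsilon> by (rule imageI)
  qed
qed

end

context bruhat_tits_building
begin

section \<open>Coordinates and coordinate subspaces\<close>

definition coord :: "(nat \<Rightarrow> 'v) \<Rightarrow> 'v \<Rightarrow> nat \<Rightarrow> 'k" where
  "coord w v = (SOME a. v = (\<Sum>i<n. a i *s w i))"

lemma coord_sum:
  assumes "is_basis w"
  shows "v = (\<Sum>i<n. coord w v i *s w i)"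
proof -
  have "\<exists>a. v = (\<Sum>i<n. a i *s w i)" using basis_coeffs[OF assms, of v] by metis
  thus ?thesis unfolding coord_def by (rule someI_ex)
qed

lemma coord_eqI:
  assumes "is_basis w" "v = (\<Sum>i<n. a i *s w i)" "i < n"
  shows "coord w v i = a i"
proof (rule basis_coeffs_unique[OF assms(1) _ assms(3)])
  show "(\<Sum>i<n. coord w v i *s w i) = (\<Sum>i<n. a i *s w i)"
    using coord_sum[OF assms(1), of v] assms(2) by simp
qed

lemma coord_add:
  assumes w: "is_basis w" and i: "i < n"
  shows "coord w (u + v) i = coord w u i + coord w v i"
proof (rule coord_eqI[OF w _ i])
  have "u + v = (\<Sum>i<n. coord w u i *s w i) + (\<Sum>i<n. coord w v i *s w i)"
    using coord_sum[OF w] by metis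
  thus "u + v = (\<Sum>i<n. (coord w u i + coord w v i) *s w i)"
    by (simp add: scale_left_distrib sum.distrib)
qed

lemma coord_scale:
  assumes w: "is_basis w" and i: "i < n"
  shows "coord w (c *s v) i = c * coord w v i"
proof (rule coord_eqI[OF w _ i])
  have "c *s v = c *s (\<Sum>i<n. coord w v i *s w i)"
    using coord_sum[OF w] by metis
  thus "c *s v = (\<Sum>i<n. (c * coord w v i) *s w i)" by (simp add: scale_sum_right)
qed

lemma coord_zero: "is_basis w \<Longrightarrow> i < n \<Longrightarrow> coord w 0 i = 0"
  using coord_scale[of w i 0 0] by simp

lemma coord_basis:
  assumes w: "is_basis w" and "i < n" "j < n"
  shows "coord w (w j) i = (if i = j then 1 else 0)"
proof (rule coord_eqI[OF w _ assms(2)])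
  show "w j = (\<Sum>i<n. (if i = j then 1 else 0) *s w i)"
    using assms(3) by (simp add: if_distrib[of "\<lambda>x. x *s _"] cong: if_cong)
qed

lemma coord_nonzero:
  assumes w: "is_basis w" and v: "v \<noteq> 0"
  obtains i where "i < n" "coord w v i \<noteq> 0"
proof (rule ccontr)
  assume "\<not> thesis"
  hence "\<forall>i<n. coord w v i = 0" using that by blast
  hence "(\<Sum>i<n. coord w v i *s w i) = 0" by simp
  thus False using coord_sum[OF w, of v] v by simp
qed

lemma mem_coordinate_subspace:
  assumes w: "is_basis w" and I: "I \<subseteq> {..<n}"
  shows "v \<in> span (w ` I) \<longleftrightarrow> (\<forall>i<n. coord w v i \<noteq> 0 \<longrightarrow> i \<in> I)"
proof
  let ?S = "{v. \<forall>i<n. coord w v i \<noteq> 0 \<longrightarrow> i \<in> I}"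
  have "subspace ?S"
  proof (rule subspaceI)
    show "0 \<in> ?S" using coord_zero[OF w] by simp
    show "x + y \<in> ?S" if "x \<in> ?S" "y \<in> ?S" for x y
    proof safe
      fix i assume i: "i < n" "coord w (x + y) i \<noteq> 0"
      hence "coord w x i \<noteq> 0 \<or> coord w y i \<noteq> 0" unfolding coord_add[OF w i(1)] by auto
      thus "i \<in> I" using that i(1) by auto
    qed
    show "c *s x \<in> ?S" if "x \<in> ?S" for c x
      using that coord_scale[OF w] by auto
  qed
  moreover have "w ` I \<subseteq> ?S" using I coord_basis[OF w] by (auto split: if_splits)
  ultimately have "span (w ` I) \<subseteq> ?S" by (intro span_minimal)
  thus "\<forall>i<n. coord w v i \<noteq> 0 \<longrightarrow> i \<in> I" if "v \<in> span (w ` I)" using that by blast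
next
  assume *: "\<forall>i<n. coord w v i \<noteq> 0 \<longrightarrow> i \<in> I"
  have "(\<Sum>i<n. coord w v i *s w i) \<in> span (w ` I)"
  proof (rule span_sum)
    fix i assume "i \<in> {..<n}"
    thus "coord w v i *s w i \<in> span (w ` I)"
    proof (cases "coord w v i = 0")
      case False
      hence "w i \<in> w ` I" using * \<open>i \<in> {..<n}\<close> by auto
      thus ?thesis by (intro span_scale span_base)
    qed (simp add: span_zero)
  qed
  thus "v \<in> span (w ` I)" using coord_sum[OF w, of v] by simp
qed

lemma basis_mem_coordinate_subspace:
  assumes w: "is_basis w" and I: "I \<subseteq> {..<n}" and i: "i < n"
  shows "w i \<in> span (w ` I) \<longleftrightarrow> i \<in> I"
  unfolding mem_coordinate_subspace[OF w I] using coord_basis[OF w _ i] i by auto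

lemma coordinate_subspaces_complementary:
  assumes w: "is_basis w" and I: "I \<subseteq> {..<n}" and I': "I' \<subseteq> {..<n}"
  shows "span (w ` I) \<inter> span (w ` I') = {0} \<and>
      {u + u' | u u'. u \<in> span (w ` I) \<and> u' \<in> span (w ` I')} = UNIV \<longleftrightarrow> I' = {..<n} - I"
    (is "?L \<longleftrightarrow> ?R")
proof
  assume L: ?L
  have "i \<notin> I \<or> i \<notin> I'" if i: "i < n" for i
  proof (rule ccontr)
    assume "\<not> ?thesis"
    hence "w i \<in> span (w ` I) \<inter> span (w ` I')"
      using basis_mem_coordinate_subspace[OF w _ i] I I' by simp
    thus False using L basis_nz[OF w i] by simp
  qed
  moreover have "i \<in> I \<or> i \<in> I'" if i: "i < n" for i
  proof (rule ccontr)
    assume n: "\<not> ?thesis"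
    have "w i \<in> {u + u' | u u'. u \<in> span (w ` I) \<and> u' \<in> span (w ` I')}" using L by simp
    then obtain u u' where u: "u \<in> span (w ` I)" "u' \<in> span (w ` I')" "w i = u + u'" by blast
    have "coord w u i = 0" "coord w u' i = 0"
      using u(1,2) n i unfolding mem_coordinate_subspace[OF w I] mem_coordinate_subspace[OF w I'] by auto
    thus False using coord_add[OF w i, of u u'] coord_basis[OF w i i] u(3) by simp
  qed
  ultimately show ?R using I I' by auto
next
  assume R: ?R
  have "v = 0" if v: "v \<in> span (w ` I)" "v \<in> span (w ` I')" for v
  proof (rule ccontr)
    assume "v \<noteq> 0"
    then obtain i where "i < n" "coord w v i \<noteq> 0" by (rule coord_nonzero[OF w])
    thus False using v R unfolding mem_coordinate_subspace[OF w I] mem_coordinate_subspace[OF w I'] by auto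
  qed
  hence "span (w ` I) \<inter> span (w ` I') = {0}" using span_zero by blast
  moreover have "UNIV = {u + u' | u u'. u \<in> span (w ` I) \<and> u' \<in> span (w ` I')}"
  proof (rule UNIV_eq_I)
    fix v
    have "v = (\<Sum>i\<in>I. coord w v i *s w i) + (\<Sum>i\<in>I'. coord w v i *s w i)"
      using coord_sum[OF w, of v] sum.subset_diff[OF I, of "\<lambda>i. coord w v i *s w i"] R
      by (simp add: add.commute)
    moreover have "(\<Sum>i\<in>J. coord w v i *s w i) \<in> span (w ` J)" for J
      by (intro span_sum span_scale span_base imageI)
    ultimately show "v \<in> {u + u' | u u'. u \<in> span (w ` I) \<and> u' \<in> span (w ` I')}" by blast
  qed
  ultimately show ?L by simp
qed

text \<open>A basis of \<open>W \<inter> W'\<close>, extended to a basis of \<open>W\<close>, is extended to a basis of \<open>W + W'\<close> by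
  vectors of \<open>W'\<close>; together with the basis of \<open>W \<inter> W'\<close> these vectors span \<open>W'\<close>.\<close>

lemma common_basis_of_subspaces:
  assumes W: "subspace W" and W': "subspace W'"
  obtains w I I' where "is_basis w" "I \<subseteq> {..<n}" "I' \<subseteq> {..<n}" "W = span (w ` I)" "W' = span (w ` I')"
proof -
  obtain B0 where B0: "B0 \<subseteq> W \<inter> W'" "independent B0" "W \<inter> W' \<subseteq> span B0"
    using maximal_independent_subset[of "W \<inter> W'"] by auto
  obtain B1 where B1: "B0 \<subseteq> B1" "B1 \<subseteq> W" "independent B1" "W \<subseteq> span B1"
    using maximal_independent_subset_extend[OF _ B0(2), of W] B0(1) by auto
  obtain B where B: "B1 \<subseteq> B" "B \<subseteq> B1 \<union> W'" "independent B" "B1 \<union> W' \<subseteq> span B"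
    using maximal_independent_subset_extend[OF _ B1(3), of "B1 \<union> W'"] by auto
  let ?C = "B0 \<union> (B - B1)"
  have WB: "W = span B1"
    using B1(4) span_minimal[OF B1(2) W] by blast
  have C: "?C \<subseteq> W'" using B0(1) B(2) by auto
  have "W' \<subseteq> span ?C"
  proof
    fix v assume v: "v \<in> W'"
    hence "v \<in> span (B1 \<union> (B - B1))" using B(1,4) by (auto simp: Un_absorb1)
    then obtain b c where bc: "b \<in> span B1" "c \<in> span (B - B1)" "v = b + c"
      unfolding span_Un by blast
    have "c \<in> W'" using bc(2) span_minimal[OF _ W', of "B - B1"] B(2) by auto
    hence "v - c \<in> W'" using v by (intro subspace_diff[OF W'])
    hence "b \<in> W \<inter> W'" using bc(1,3) WB by simp
    hence "b \<in> span ?C" using B0(3) span_mono[of B0 ?C] by blast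
    moreover have "c \<in> span ?C" using bc(2) span_mono[of "B - B1" ?C] by blast
    ultimately show "v \<in> span ?C" unfolding bc(3) by (rule span_add)
  qed
  hence W'C: "W' = span ?C" using span_minimal[OF C W'] by blast
  obtain w J where w: "is_basis w" "J \<subseteq> {..<n}" "w ` J = B"
    by (rule extend_to_basis[OF B(3)])
  have img: "w ` {i \<in> J. w i \<in> S} = S" if "S \<subseteq> B" for S using w(3) that by blast
  show ?thesis
  proof (rule that[OF w(1), of "{i \<in> J. w i \<in> B1}" "{i \<in> J. w i \<in> ?C}"])
    show "W = span (w ` {i \<in> J. w i \<in> B1})" unfolding img[OF B(1)] by (rule WB)
    have sub: "?C \<subseteq> B" using B(1) B1(1) by auto
    show "W' = span (w ` {i \<in> J. w i \<in> ?C})" unfolding img[OF sub] by (rule W'C)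
  qed (use w(2) in auto)
qed

text \<open>A transvection or, for \<open>u = w i\<close>, the doubling of one basis vector.\<close>

definition elementary :: "(nat \<Rightarrow> 'v) \<Rightarrow> nat \<Rightarrow> 'v \<Rightarrow> 'v \<Rightarrow> 'v" where
  "elementary w i u v = v + coord w v i *s u"

lemma elementary_GL:
  assumes w: "is_basis w" and i: "i < n" and u: "1 + coord w u i \<noteq> 0"
  shows "elementary w i u \<in> GL"
proof -
  let ?g = "elementary w i u" and ?c = "\<lambda>v. coord w v i"
  have add: "?g (x + y) = ?g x + ?g y" for x y
    by (simp add: elementary_def coord_add[OF w i] scale_left_distrib)
  have scl: "?g (c *s x) = c *s ?g x" for c x
    by (simp add: elementary_def coord_scale[OF w i] scale_right_distrib)
  have cg: "?c (?g v) = ?c v * (1 + ?c u)" for v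
    by (simp add: elementary_def coord_add[OF w i] coord_scale[OF w i] algebra_simps)
  have lin: "Vector_Spaces.linear scale scale ?g"
    by (intro Vector_Spaces.linear.intro module_hom.intro module_hom_axioms.intro)
      (unfold_locales, auto simp: add scl)
  have "inj ?g"
  proof (rule injI)
    fix x y assume xy: "?g x = ?g y"
    hence "?c x * (1 + ?c u) = ?c y * (1 + ?c u)" using cg by metis
    hence "?c x = ?c y" using u by simp
    thus "x = y" using xy by (simp add: elementary_def)
  qed
  moreover have "surj ?g"
  proof (rule surjI)
    fix z
    let ?v = "z + (- (?c z / (1 + ?c u))) *s u"
    have "?c ?v = ?c z - ?c z / (1 + ?c u) * ?c u"
      unfolding coord_add[OF w i] coord_scale[OF w i] by simp
    also have "\<dots> = ?c z / (1 + ?c u)" using u by (simp add: field_simps)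
    finally have cv: "?c ?v = ?c z / (1 + ?c u)" .
    show "?g ?v = z" unfolding elementary_def cv by (simp add: scale_left_distrib[symmetric])
  qed
  ultimately show ?thesis using lin by (simp add: GL_def bij_def)
qed

lemma elementary_coordinate_subspace:
  assumes w: "is_basis w" and I: "I \<subseteq> {..<n}" and ij: "i < n" "j < n" "i \<notin> I \<or> j \<in> I"
  shows "elementary w i (w j) \<in> GL" "elementary w i (w j) ` span (w ` I) = span (w ` I)"
proof -
  let ?g = "elementary w i (w j)" and ?c = "\<lambda>v. coord w v i" and ?W = "span (w ` I)"
  have nz: "1 + ?c (w j) \<noteq> 0" using coord_basis[OF w ij(1,2)] by simp
  show GL: "?g \<in> GL" by (rule elementary_GL[OF w ij(1) nz])
  have cg: "?c (?g v) = ?c v * (1 + ?c (w j))" for v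
    by (simp add: elementary_def coord_add[OF w ij(1)] coord_scale[OF w ij(1)] algebra_simps)
  have iff: "?g v \<in> ?W \<longleftrightarrow> v \<in> ?W" for v
  proof (cases "j \<in> I")
    case True
    hence s: "coord w v i *s w j \<in> ?W" by (intro span_scale span_base imageI)
    show ?thesis
    proof
      assume "?g v \<in> ?W"
      from span_diff[OF this s] show "v \<in> ?W" by (simp add: elementary_def)
    qed (use s in \<open>auto simp: elementary_def intro: span_add\<close>)
  next
    case False
    hence iI: "i \<notin> I" using ij(3) by simp
    have "?c v = 0" if "?g v \<in> ?W \<or> v \<in> ?W"
      using that
    proof
      assume "?g v \<in> ?W"
      hence "?c (?g v) = 0" using iI ij(1) unfolding mem_coordinate_subspace[OF w I] by blast
      thus ?thesis unfolding cg using nz by simp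
    next
      assume "v \<in> ?W"
      thus ?thesis using iI ij(1) unfolding mem_coordinate_subspace[OF w I] by blast
    qed
    thus ?thesis by (auto simp: elementary_def)
  qed
  show "?g ` ?W = ?W"
  proof (intro equalityI subsetI)
    fix v assume v: "v \<in> ?W"
    have "?g (inv ?g v) = v" by (rule GL_inv(2)[OF GL])
    thus "v \<in> ?g ` ?W" using iff[of "inv ?g v"] v by (metis imageI)
  qed (use iff in auto)
qed

end

context metric_bruhat_tits_building
begin

section \<open>Rays towards a subspace\<close>

definition ind :: "nat set \<Rightarrow> nat \<Rightarrow> real" where
  "ind I i = (if i \<in> I then 1 else 0)"

definition rate :: "nat set \<Rightarrow> real" where
  "rate I = 1 / nrm (ind I)"

text \<open>Up to rounding, \<open>ray w I t\<close> is the class of the lattice which the vectors \<open>\<pi>\<^sup>-\<^sup>s w i\<close>, \<open>i \<in> I\<close>, and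
  \<open>w i\<close>, \<open>i \<notin> I\<close>, generate, with \<open>s = t * rate I\<close>. The factor \<open>rate I\<close> gives it unit speed.\<close>

definition ray :: "(nat \<Rightarrow> 'v) \<Rightarrow> nat set \<Rightarrow> real \<Rightarrow> 'v set set \<Rightarrow> real" where
  "ray w I t = pt w (\<lambda>i. - (t * rate I) * ind I i)"

definition proper :: "nat set \<Rightarrow> bool" where
  "proper I \<longleftrightarrow> I \<subseteq> {..<n} \<and> I \<noteq> {} \<and> I \<noteq> {..<n}"

lemma nrm_zero_imp_const:
  assumes "nrm a = 0" "i < n" "j < n"
  shows "a i = a j"
proof -
  have "\<bar>a k - (\<Sum>i<n. a i) / n\<bar> \<le> 0" if "k < n" for k
    using nrm_ge[OF that, of a] assms(1) by simp
  from this[OF assms(2)] this[OF assms(3)] show ?thesis by simp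
qed

lemma proper_obtain:
  assumes "proper I"
  obtains i j where "i \<in> I" "i < n" "j \<notin> I" "j < n"
  using assms unfolding proper_def by blast

lemma nrm_ind_pos:
  assumes "proper I"
  shows "0 < nrm (ind I)"
proof (rule ccontr)
  assume "\<not> ?thesis"
  hence z: "nrm (ind I) = 0" using nrm_nonneg[of "ind I"] by simp
  obtain i j where "i \<in> I" "i < n" "j \<notin> I" "j < n" by (rule proper_obtain[OF assms])
  thus False using nrm_zero_imp_const[OF z, of i j] by (simp add: ind_def)
qed

lemma rate_pos: "proper I \<Longrightarrow> 0 < rate I"
  using nrm_ind_pos by (simp add: rate_def)

lemma dist_ind:
  assumes "is_basis w" "proper I"
  shows "d (pt w (\<lambda>i. a * ind I i)) (pt w (\<lambda>i. b * ind I i)) = \<bar>a - b\<bar> / rate I"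
proof -
  have "d (pt w (\<lambda>i. a * ind I i)) (pt w (\<lambda>i. b * ind I i)) = \<bar>a - b\<bar> * nrm (ind I)"
    unfolding dist_pt[OF assms(1)] by (rule nrm_affine[where c = 0]) (simp add: left_diff_distrib)
  thus ?thesis using nrm_ind_pos[OF assms(2)] by (simp add: rate_def)
qed

lemma ray_geodesic:
  assumes w: "is_basis w" and I: "proper I"
  shows "is_geodesic (ray w I)" "is_half_geodesic (ray w I)"
proof -
  have "d (ray w I s) (ray w I t) = \<bar>s - t\<bar>" for s t
  proof -
    have "d (ray w I s) (ray w I t) = \<bar>- (s * rate I) - - (t * rate I)\<bar> / rate I"
      unfolding ray_def by (rule dist_ind[OF w I])
    also have "- (s * rate I) - - (t * rate I) = (t - s) * rate I" by (simp add: algebra_simps)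
    also have "\<bar>(t - s) * rate I\<bar> / rate I = \<bar>s - t\<bar>" using rate_pos[OF I] by (simp add: abs_mult)
    finally show ?thesis .
  qed
  moreover have "ray w I t \<in> building" for t unfolding ray_def by (rule pt_building[OF w])
  ultimately show "is_geodesic (ray w I)" "is_half_geodesic (ray w I)"
    by (simp_all add: is_geodesic_def is_half_geodesic_def)
qed

lemma ray_building: "is_basis w \<Longrightarrow> ray w I t \<in> building"
  unfolding ray_def by (rule pt_building)

text \<open>The weights of the ray are known up to a constant that depends on \<open>t\<close>; \<open>growth\<close> removes it.\<close>

definition growth :: "(nat \<Rightarrow> 'v) \<Rightarrow> nat set \<Rightarrow> real \<Rightarrow> 'v \<Rightarrow> real" where
  "growth w I t v = log q (pnorm (ray w I t) v) -
     (SOME C. \<forall>i<n. wt w (ray w I t) i = - (t * rate I) * ind I i + C)"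

lemma growth_basis:
  assumes w: "is_basis w" and i: "i < n"
  shows "growth w I t (w i) = - (t * rate I) * ind I i"
proof -
  have "\<exists>C. \<forall>i<n. wt w (ray w I t) i = - (t * rate I) * ind I i + C"
    unfolding ray_def by (rule pt(2)[OF w])
  from someI_ex[OF this, rule_format, OF i] show ?thesis
    unfolding growth_def wt_def[symmetric] by linarith
qed

lemma growth_le_term:
  assumes w: "is_basis w" and h: "is_basis h" and nz: "(\<Sum>i<n. a i *s h i) \<noteq> 0"
  obtains i where "i < n" "a i \<noteq> 0"
    "growth w I t (\<Sum>i<n. a i *s h i) \<le> log q (absv (a i)) + growth w I t (h i)"
proof -
  obtain i where "i < n" "a i \<noteq> 0" "log q (pnorm (ray w I t) (\<Sum>i<n. a i *s h i))
      \<le> log q (absv (a i)) + log q (pnorm (ray w I t) (h i))"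
    by (rule log_norm_le_term[OF pnorm_norm[OF ray_building[OF w]] h nz])
  thus ?thesis using that by (simp add: growth_def)
qed

lemma growth_ge:
  assumes w: "is_basis w" and i: "i < n" "a i \<noteq> 0"
  shows "log q (absv (a i)) + growth w I t (w i) \<le> growth w I t (\<Sum>i<n. a i *s w i)"
proof -
  have "ray w I t \<in> apartment w" unfolding ray_def by (rule pt(1)[OF w])
  thus ?thesis
    using log_norm_adapted_ge[of "pnorm (ray w I t)" w i a, OF pnorm_norm[OF ray_building[OF w]] w
        apartment_adapted[OF w] i] by (simp add: growth_def)
qed

text \<open>The norm of \<open>v\<close> is that of its largest term. The terms with index in \<open>I\<close> shrink along the ray at
  the same rate, the others keep their size, and \<open>v\<close> lies in the subspace iff it has none of the latter.\<close>

lemma growth_bounds: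
  assumes w: "is_basis w" and I: "proper I" and v: "v \<noteq> 0"
  shows "\<exists>K\<ge>0. \<forall>t\<ge>0. \<bar>growth w I t v + (if v \<in> span (w ` I) then t * rate I else 0)\<bar> \<le> K"
proof -
  have I': "I \<subseteq> {..<n}" using I by (simp add: proper_def)
  let ?a = "coord w v" and ?W = "span (w ` I)"
  let ?K = "\<Sum>i<n. \<bar>log q (absv (?a i))\<bar>"
  have K: "\<bar>log q (absv (?a i))\<bar> \<le> ?K" if "i < n" for i
    using that by (intro member_le_sum) auto
  have va: "v = (\<Sum>i<n. ?a i *s w i)" by (rule coord_sum[OF w])
  have nz: "(\<Sum>i<n. ?a i *s w i) \<noteq> 0" using v va by simp
  have "\<bar>growth w I t v + (if v \<in> ?W then t * rate I else 0)\<bar> \<le> ?K" if t: "0 \<le> t" for t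
  proof -
    have tr: "0 \<le> t * rate I" using t rate_pos[OF I] by simp
    obtain i where i: "i < n" "?a i \<noteq> 0"
      "growth w I t (\<Sum>i<n. ?a i *s w i) \<le> log q (absv (?a i)) + growth w I t (w i)"
      by (rule growth_le_term[OF w w nz])
    hence up: "growth w I t v \<le> ?K - (t * rate I) * ind I i"
      using K[OF i(1)] growth_basis[OF w i(1)] va by simp
    obtain j where j: "j < n" "?a j \<noteq> 0" "v \<in> ?W \<or> j \<notin> I"
    proof (cases "v \<in> ?W")
      case True
      thus ?thesis using that i by blast
    next
      case False
      thus ?thesis using that unfolding mem_coordinate_subspace[OF w I'] by blast
    qed
    have "log q (absv (?a j)) + growth w I t (w j) \<le> growth w I t (\<Sum>i<n. ?a i *s w i)"
      by (rule growth_ge[where a = ?a, OF w j(1,2)])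
    hence lo: "- ?K - (t * rate I) * ind I j \<le> growth w I t v"
      using K[OF j(1)] growth_basis[OF w j(1)] va by simp
    show ?thesis
    proof (cases "v \<in> ?W")
      case True
      hence "i \<in> I" "j \<in> I"
        using i(1,2) j(1,2) unfolding mem_coordinate_subspace[OF w I'] by blast+
      thus ?thesis using up lo True by (simp add: ind_def)
    next
      case False
      hence "j \<notin> I" using j(3) by simp
      thus ?thesis using up lo False tr by (simp add: ind_def split: if_splits)
    qed
  qed
  moreover have "0 \<le> ?K" by (intro sum_nonneg) simp
  ultimately show ?thesis by blast
qed

text \<open>In the basis \<open>w\<close> the matrix of \<open>g\<close> is block triangular, and along the ray the block off the
  diagonal is scaled down.\<close>

lemma growth_le_of_stable:
  assumes w: "is_basis w" and I: "proper I" and g: "g \<in> GL" and W: "g ` span (w ` I) \<subseteq> span (w ` I)"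
  shows "\<exists>B\<ge>0. \<forall>t\<ge>0. \<forall>v. v \<noteq> 0 \<longrightarrow> growth w I t (g v) \<le> growth w I t v + B"
proof -
  have I': "I \<subseteq> {..<n}" using I by (simp add: proper_def)
  have gw: "is_basis (g \<circ> w)" by (rule GL_basis[OF g w])
  have "\<exists>K\<ge>0. \<forall>t\<ge>0. \<bar>growth w I t (g (w i)) + (if g (w i) \<in> span (w ` I) then t * rate I else 0)\<bar> \<le> K"
    if "i < n" for i
    using growth_bounds[OF w I] basis_nz[OF gw that] by simp
  then obtain K where K: "\<And>i. i < n \<Longrightarrow> 0 \<le> K i" "\<And>i t. i < n \<Longrightarrow> 0 \<le> t \<Longrightarrow>
    \<bar>growth w I t (g (w i)) + (if g (w i) \<in> span (w ` I) then t * rate I else 0)\<bar> \<le> K i" by metis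
  have "growth w I t (g v) \<le> growth w I t v + (\<Sum>i<n. K i)" if t: "0 \<le> t" and v: "v \<noteq> 0" for t v
  proof -
    let ?a = "coord w v"
    have tr: "0 \<le> t * rate I" using t rate_pos[OF I] by simp
    have va: "v = (\<Sum>i<n. ?a i *s w i)" by (rule coord_sum[OF w])
    have gva: "g v = (\<Sum>i<n. ?a i *s (g \<circ> w) i)"
      by (subst va) (simp add: GL_linear(6)[OF g])
    have "g v \<noteq> 0" using v GL_linear(5)[OF g] by simp
    hence nz: "(\<Sum>i<n. ?a i *s (g \<circ> w) i) \<noteq> 0" using gva by simp
    obtain i where i: "i < n" "?a i \<noteq> 0"
      "growth w I t (\<Sum>i<n. ?a i *s (g \<circ> w) i) \<le> log q (absv (?a i)) + growth w I t ((g \<circ> w) i)"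
      by (rule growth_le_term[OF w gw nz])
    have "growth w I t (g (w i)) \<le> K i - (t * rate I) * ind I i"
    proof (cases "i \<in> I")
      case True
      hence "g (w i) \<in> span (w ` I)" using W by (auto intro: span_base)
      thus ?thesis using K(2)[OF i(1) t] True by (simp add: ind_def)
    next
      case False
      thus ?thesis using K(2)[OF i(1) t] tr by (simp add: ind_def split: if_splits)
    qed
    moreover have "K i \<le> (\<Sum>i<n. K i)" using i(1) K(1) by (intro member_le_sum) auto
    moreover have "log q (absv (?a i)) + growth w I t (w i) \<le> growth w I t (\<Sum>i<n. ?a i *s w i)"
      by (rule growth_ge[where a = ?a, OF w i(1,2)])
    ultimately show ?thesis
      using i(3) growth_basis[OF w i(1), of I t] va gva by simp
  qed
  moreover have "0 \<le> (\<Sum>i<n. K i)" using K(1) by (intro sum_nonneg) auto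
  ultimately show ?thesis by blast
qed

lemma bounded_distortion_growth:
  "bounded_distortion g (ray w I) \<longleftrightarrow> (\<exists>B\<ge>0. \<forall>t\<ge>0. \<exists>c. \<forall>v. v \<noteq> 0 \<longrightarrow>
     \<bar>growth w I t (g v) - growth w I t v - c\<bar> \<le> B)"
  unfolding bounded_distortion_def growth_def by simp

lemma stabilizer_of_ray:
  assumes w: "is_basis w" and I: "proper I" and g: "g \<in> GL"
  shows "bounded_distortion g (ray w I) \<longleftrightarrow> g ` span (w ` I) = span (w ` I)"
proof
  let ?W = "span (w ` I)"
  assume "bounded_distortion g (ray w I)"
  then obtain B where B: "0 \<le> B" "\<forall>t\<ge>0. \<exists>c. \<forall>v. v \<noteq> 0 \<longrightarrow>
     \<bar>growth w I t (g v) - growth w I t v - c\<bar> \<le> B"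
    unfolding bounded_distortion_growth by (elim exE conjE)
  have I': "I \<subseteq> {..<n}" using I by (simp add: proper_def)
  obtain i j where ij: "i \<in> I" "i < n" "j \<notin> I" "j < n" by (rule proper_obtain[OF I])
  define e where "e t v = (if v \<in> ?W then t * rate I else 0)" for t v
  \<comment> \<open>If \<open>u\<close> and \<open>g u\<close> grow at different rates, all vectors must do so, with the same sign; one of
    the basis vectors \<open>w i\<close> and \<open>w j\<close> violates this.\<close>
  have same: "g u \<in> ?W \<longleftrightarrow> u \<in> ?W" if u: "u \<noteq> 0" for u
  proof (rule ccontr)
    assume ne: "\<not> ?thesis"
    have nz: "u \<noteq> 0" "g u \<noteq> 0" "w i \<noteq> 0" "g (w i) \<noteq> 0" "w j \<noteq> 0" "g (w j) \<noteq> 0"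
      using u GL_linear(5)[OF g] basis_nz[OF w] ij by auto
    have bnd: "\<exists>K\<ge>0. \<forall>t\<ge>0. growth w I t v \<le> K - e t v \<and> - K - e t v \<le> growth w I t v" if vn: "v \<noteq> 0" for v
    proof -
      obtain K where K: "0 \<le> K" "\<forall>t\<ge>0. \<bar>growth w I t v + e t v\<bar> \<le> K"
        using growth_bounds[OF w I vn] unfolding e_def by blast
      have "growth w I t v \<le> K - e t v \<and> - K - e t v \<le> growth w I t v" if "0 \<le> t" for t
        using K(2)[rule_format, OF that] by linarith
      thus ?thesis using K(1) by blast
    qed
    obtain K1 where K1: "0 \<le> K1" "\<forall>t\<ge>0. growth w I t u \<le> K1 - e t u \<and> - K1 - e t u \<le> growth w I t u"
      using bnd[OF nz(1)] by blast
    obtain K2 where K2: "0 \<le> K2" "\<forall>t\<ge>0. growth w I t (g u) \<le> K2 - e t (g u) \<and> - K2 - e t (g u) \<le> growth w I t (g u)"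
      using bnd[OF nz(2)] by blast
    have contra: False
      if x: "x \<noteq> 0" "g x \<noteq> 0" and *: "\<And>t. 0 \<le> t \<Longrightarrow> \<bar>e t (g u) - e t u\<bar> = t * rate I \<and>
        (e t (g u) - e t u) * (e t (g x) - e t x) \<le> 0" for x
    proof -
      obtain K3 where K3: "0 \<le> K3" "\<forall>t\<ge>0. growth w I t x \<le> K3 - e t x \<and> - K3 - e t x \<le> growth w I t x"
        using bnd[OF x(1)] by blast
      obtain K4 where K4: "0 \<le> K4" "\<forall>t\<ge>0. growth w I t (g x) \<le> K4 - e t (g x) \<and> - K4 - e t (g x) \<le> growth w I t (g x)"
        using bnd[OF x(2)] by blast
      define S where "S = K1 + K2 + K3 + K4 + 2 * B"
      have S: "0 \<le> S" using K1 K2 K3 K4 B by (simp add: S_def)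
      define t where "t = (S + 1) / rate I"
      have t: "0 \<le> t" unfolding t_def using rate_pos[OF I] S by simp
      have tr: "t * rate I = S + 1" unfolding t_def using rate_pos[OF I] by simp
      obtain c where c: "\<And>v. v \<noteq> 0 \<Longrightarrow> \<bar>growth w I t (g v) - growth w I t v - c\<bar> \<le> B"
        using B(2) t by blast
      note b = K1(2)[rule_format, OF t] K2(2)[rule_format, OF t] K3(2)[rule_format, OF t] K4(2)[rule_format, OF t]
      define p1 where "p1 = e t (g u) - e t u"
      define p2 where "p2 = e t (g x) - e t x"
      have "\<bar>p1 - p2\<bar> \<le> S"
        using b c[OF nz(1)] c[OF x(1)] unfolding p1_def p2_def S_def by linarith
      moreover have "\<bar>p1\<bar> = S + 1" "p1 * p2 \<le> 0" using *[OF t] tr by (simp_all add: p1_def p2_def)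
      moreover have "p1 > 0 \<or> p1 < 0" using \<open>\<bar>p1\<bar> = S + 1\<close> S by auto
      ultimately show False using S by (auto simp: mult_le_0_iff)
    qed
    have wi: "w i \<in> ?W" "w j \<notin> ?W" using basis_mem_coordinate_subspace[OF w I'] ij by auto
    show False
    proof (cases "u \<in> ?W")
      case True
      have "\<bar>e t (g u) - e t u\<bar> = t * rate I \<and> (e t (g u) - e t u) * (e t (g (w j)) - e t (w j)) \<le> 0"
        if "0 \<le> t" for t
        using True ne wi that rate_pos[OF I] by (auto simp: e_def)
      from contra[OF nz(5,6) this] show False .
    next
      case False
      have "\<bar>e t (g u) - e t u\<bar> = t * rate I \<and> (e t (g u) - e t u) * (e t (g (w i)) - e t (w i)) \<le> 0"
        if "0 \<le> t" for t
        using False ne wi that rate_pos[OF I] by (auto simp: e_def)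
      from contra[OF nz(3,4) this] show False .
    qed
  qed
  have same': "g u \<in> ?W \<longleftrightarrow> u \<in> ?W" for u
    using same[of u] GL_linear(4)[OF g] by (cases "u = 0") (simp_all add: span_zero)
  show "g ` ?W = ?W"
  proof (intro equalityI subsetI)
    fix v assume "v \<in> ?W"
    thus "v \<in> g ` ?W" using same'[of "inv g v"] GL_inv(2)[OF g, of v] by (metis imageI)
  qed (use same' in auto)
next
  let ?W = "span (w ` I)"
  assume W: "g ` ?W = ?W"
  have "inv g ` ?W = inv g ` g ` ?W" using W by simp
  also have "\<dots> = ?W" by (simp add: image_image GL_inv(3)[OF g])
  finally have W': "inv g ` ?W \<subseteq> ?W" by simp
  obtain B where B: "0 \<le> B" "\<forall>t\<ge>0. \<forall>v. v \<noteq> 0 \<longrightarrow> growth w I t (g v) \<le> growth w I t v + B"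
    using growth_le_of_stable[OF w I g] W by blast
  obtain B' where B': "0 \<le> B'" "\<forall>t\<ge>0. \<forall>v. v \<noteq> 0 \<longrightarrow> growth w I t (inv g v) \<le> growth w I t v + B'"
    using growth_le_of_stable[OF w I GL_inv(1)[OF g] W'] by blast
  have "\<bar>growth w I t (g v) - growth w I t v - 0\<bar> \<le> B + B'" if "0 \<le> t" "v \<noteq> 0" for t v
  proof -
    have "g v \<noteq> 0" using that GL_linear(5)[OF g] by simp
    hence "growth w I t v \<le> growth w I t (g v) + B'" using B'(2) that GL_inv(3)[OF g, of v] by metis
    moreover have "growth w I t (g v) \<le> growth w I t v + B" using B(2) that by blast
    ultimately show ?thesis using B(1) B'(1) by linarith
  qed
  hence "\<forall>t\<ge>0. \<exists>c. \<forall>v. v \<noteq> 0 \<longrightarrow> \<bar>growth w I t (g v) - growth w I t v - c\<bar> \<le> B + B'"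
    by blast
  moreover have "0 \<le> B + B'" using B(1) B'(1) by simp
  ultimately show "bounded_distortion g (ray w I)"
    unfolding bounded_distortion_growth by blast
qed

lemma stabilizer_boundary_ray:
  assumes w: "is_basis w" and I: "proper I"
  shows "stabilizer_boundary (boundary_class (ray w I)) = stabilizer_subspace (span (w ` I))"
proof -
  have "g \<in> GL \<and> act_boundary g (boundary_class (ray w I)) = boundary_class (ray w I) \<longleftrightarrow>
      g \<in> GL \<and> g ` span (w ` I) = span (w ` I)" for g
    using fixes_class_iff[OF _ ray_geodesic(2)[OF w I]] stabilizer_of_ray[OF w I] by blast
  thus ?thesis unfolding stabilizer_boundary_def stabilizer_subspace_def by simp
qed

subsection \<open>Uniqueness of the boundary point\<close>

lemma bounded_distortion_scale:
  assumes c: "c \<noteq> 0" and g: "\<And>v. g v = c *s g' v" and g': "g' \<in> GL"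
    and \<sigma>: "is_half_geodesic \<sigma>" and bd: "bounded_distortion g' \<sigma>"
  shows "bounded_distortion g \<sigma>"
proof -
  obtain B where B: "0 \<le> B" "\<forall>t\<ge>0. \<exists>k. \<forall>v. v \<noteq> 0 \<longrightarrow>
     \<bar>log q (pnorm (\<sigma> t) (g' v)) - log q (pnorm (\<sigma> t) v) - k\<bar> \<le> B"
    using bd unfolding bounded_distortion_def by (elim exE conjE)
  have "\<exists>k. \<forall>v. v \<noteq> 0 \<longrightarrow> \<bar>log q (pnorm (\<sigma> t) (g v)) - log q (pnorm (\<sigma> t) v) - k\<bar> \<le> B"
    if t: "0 \<le> t" for t
  proof -
    obtain k where k: "\<forall>v. v \<noteq> 0 \<longrightarrow> \<bar>log q (pnorm (\<sigma> t) (g' v)) - log q (pnorm (\<sigma> t) v) - k\<bar> \<le> B"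
      using B(2) t by blast
    have "\<bar>log q (pnorm (\<sigma> t) (g v)) - log q (pnorm (\<sigma> t) v) - (log q (absv c) + k)\<bar> \<le> B"
      if v: "v \<noteq> 0" for v
    proof -
      have "g' v \<noteq> 0" using v GL_linear(5)[OF g'] by simp
      hence "log q (pnorm (\<sigma> t) (g v)) = log q (absv c) + log q (pnorm (\<sigma> t) (g' v))"
        unfolding g by (rule log_norm_scale[OF pnorm_norm[OF half_geodesicD(1)[OF \<sigma> t]] c])
      thus ?thesis using k[rule_format, OF v] by linarith
    qed
    thus ?thesis by blast
  qed
  thus ?thesis unfolding bounded_distortion_def using B(1) by blast
qed

lemma stabilizer_bounded_distortion:
  assumes \<sigma>: "is_half_geodesic \<sigma>"
    and st: "stabilizer_boundary (boundary_class \<sigma>) = stabilizer_subspace W"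
    and g: "g \<in> GL" "g ` W = W"
  shows "bounded_distortion g \<sigma>"
proof -
  have "proj_class g \<in> stabilizer_boundary (boundary_class \<sigma>)"
    unfolding st stabilizer_subspace_def using g by blast
  then obtain g' where g': "proj_class g = proj_class g'" "g' \<in> GL"
    "act_boundary g' (boundary_class \<sigma>) = boundary_class \<sigma>"
    unfolding stabilizer_boundary_def by blast
  have "g = (\<lambda>v. 1 *s g v)" by simp
  hence "g \<in> proj_class g" unfolding proj_class_def using one_neq_zero by blast
  hence "g \<in> proj_class g'" using g'(1) by simp
  then obtain c where c: "c \<noteq> 0" "g = (\<lambda>v. c *s g' v)" unfolding proj_class_def by blast
  have "bounded_distortion g' \<sigma>" using fixes_class_iff[OF g'(2) \<sigma>] g'(3) by simp
  thus ?thesis by (rule bounded_distortion_scale[OF c(1) _ g'(2) \<sigma>, rotated]) (simp add: c(2))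
qed

text \<open>An elementary map \<open>g\<close> fixes a basis vector, so that the constants in \<open>bounded_distortion g \<sigma>\<close>
  are bounded. As \<open>g v - v\<close> is \<open>coord w v i *s w j\<close>, the norm of the latter is bounded by that of \<open>v\<close>.\<close>

lemma stabilizer_coordinate_bound:
  assumes \<sigma>: "is_half_geodesic \<sigma>" and w: "is_basis w" and I: "proper I"
    and st: "stabilizer_boundary (boundary_class \<sigma>) = stabilizer_subspace (span (w ` I))"
    and ij: "i < n" "j < n" "i \<notin> I \<or> j \<in> I"
  shows "\<exists>B\<ge>0. \<forall>t\<ge>0. \<forall>v. coord w v i \<noteq> 0 \<longrightarrow>
    log q (absv (coord w v i)) + log q (pnorm (\<sigma> t) (w j)) \<le> log q (pnorm (\<sigma> t) v) + B"
proof -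
  have I': "I \<subseteq> {..<n}" using I by (simp add: proper_def)
  let ?g = "elementary w i (w j)"
  note g = elementary_coordinate_subspace[OF w I' ij]
  have "bounded_distortion ?g \<sigma>" by (rule stabilizer_bounded_distortion[OF \<sigma> st g])
  then obtain B where B: "0 \<le> B" "\<forall>t\<ge>0. \<exists>k. \<forall>v. v \<noteq> 0 \<longrightarrow>
     \<bar>log q (pnorm (\<sigma> t) (?g v)) - log q (pnorm (\<sigma> t) v) - k\<bar> \<le> B"
    unfolding bounded_distortion_def by (elim exE conjE)
  \<comment> \<open>As \<open>I\<close> is a proper subset, there are at least two basis vectors.\<close>
  obtain k where k: "k < n" "k \<noteq> i" using proper_obtain[OF I] by metis
  have gk: "?g (w k) = w k" using coord_basis[OF w ij(1) k(1)] k(2) by (simp add: elementary_def)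
  have "log q (absv (coord w v i)) + log q (pnorm (\<sigma> t) (w j)) \<le> log q (pnorm (\<sigma> t) v) + 2 * B"
    if t: "0 \<le> t" and vi: "coord w v i \<noteq> 0" for t v
  proof -
    note N = pnorm_norm[OF half_geodesicD(1)[OF \<sigma> t]]
    obtain c where c: "\<And>v. v \<noteq> 0 \<Longrightarrow> \<bar>log q (pnorm (\<sigma> t) (?g v)) - log q (pnorm (\<sigma> t) v) - c\<bar> \<le> B"
      using B(2) t by blast
    have "\<bar>c\<bar> \<le> B" using c[OF basis_nz[OF w k(1)]] gk by simp
    have v: "v \<noteq> 0" using vi coord_zero[OF w ij(1)] by auto
    have gv: "?g v \<noteq> 0" using v GL_linear(5)[OF g(1)] by simp
    have le: "log q (pnorm (\<sigma> t) (?g v)) \<le> log q (pnorm (\<sigma> t) v) + 2 * B"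
      using c[OF v] \<open>\<bar>c\<bar> \<le> B\<close> by linarith
    have "log q (absv (coord w v i)) + log q (pnorm (\<sigma> t) (w j)) = log q (pnorm (\<sigma> t) (coord w v i *s w j))"
      by (rule log_norm_scale[OF N vi basis_nz[OF w ij(2)], symmetric])
    also have "coord w v i *s w j = ?g v - v" by (simp add: elementary_def)
    also have "log q (pnorm (\<sigma> t) (?g v - v)) \<le> log q (max (pnorm (\<sigma> t) (?g v)) (pnorm (\<sigma> t) v))"
    proof -
      have "?g v - v \<noteq> 0" using vi basis_nz[OF w ij(2)] by (simp add: elementary_def)
      hence "0 < pnorm (\<sigma> t) (?g v - v)" by (rule pnorm_pos)
      moreover have "pnorm (\<sigma> t) (?g v - v) \<le> max (pnorm (\<sigma> t) (?g v)) (pnorm (\<sigma> t) v)"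
        by (rule nonarch_norm_diff[OF N])
      ultimately show ?thesis using q_gt_1 by (subst log_le_cancel_iff) linarith+
    qed
    also have "\<dots> \<le> log q (pnorm (\<sigma> t) v) + 2 * B"
      using le B(1) by (simp add: max_def)
    finally show ?thesis .
  qed
  moreover have "0 \<le> 2 * B" using B(1) by simp
  ultimately show ?thesis by blast
qed

text \<open>The stabilizer of the class of \<open>\<sigma>\<close> forces the norms along \<open>\<sigma>\<close> to be almost orthogonal in
  the basis \<open>w\<close> and almost constant on \<open>I\<close> and on its complement. So \<open>\<sigma>\<close> stays near the line
  \<open>\<real> ind I\<close> in the apartment, and the transvections which add vectors of \<open>W\<close> to vectors outside
  decide on which end of the line it escapes.\<close>

lemma boundary_class_determined:
  assumes \<sigma>: "is_half_geodesic \<sigma>" and w: "is_basis w" and I: "proper I"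
    and st: "stabilizer_boundary (boundary_class \<sigma>) = stabilizer_subspace (span (w ` I))"
  shows "boundary_class \<sigma> = boundary_class (ray w I)"
proof -
  obtain i0 j0 where i0: "i0 \<in> I" "i0 < n" and j0: "j0 \<notin> I" "j0 < n" by (rule proper_obtain[OF I])
  define l where "l t v = log q (pnorm (\<sigma> t) v)" for t v
  have "\<exists>B. 0 \<le> B \<and> (i < n \<and> j < n \<and> (i \<notin> I \<or> j \<in> I) \<longrightarrow> (\<forall>t\<ge>0. \<forall>v. coord w v i \<noteq> 0 \<longrightarrow>
    log q (absv (coord w v i)) + l t (w j) \<le> l t v + B))" for i j
    using stabilizer_coordinate_bound[OF \<sigma> w I st, of i j] unfolding l_def by (meson order_refl)
  then obtain b where b0: "\<And>i j. 0 \<le> b i j" and b: "\<And>i j t v. i < n \<Longrightarrow> j < n \<Longrightarrow> i \<notin> I \<or> j \<in> I \<Longrightarrow>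
    0 \<le> t \<Longrightarrow> coord w v i \<noteq> 0 \<Longrightarrow> log q (absv (coord w v i)) + l t (w j) \<le> l t v + b i j" by metis
  define B where "B = (\<Sum>i<n. \<Sum>j<n. b i j)"
  have bB: "b i j \<le> B" if "i < n" "j < n" for i j
  proof -
    have "b i j \<le> (\<Sum>j<n. b i j)" using that b0 by (intro member_le_sum) auto
    also have "\<dots> \<le> B" unfolding B_def using that b0 by (intro member_le_sum) (auto intro: sum_nonneg)
    finally show ?thesis .
  qed
  have B0: "0 \<le> B" unfolding B_def using b0 by (intro sum_nonneg) auto
  have coords: "log q (absv (coord w v i)) + l t (w i) \<le> l t v + B"
    if "i < n" "0 \<le> t" "coord w v i \<noteq> 0" for i t v
    using b[OF that(1,1) _ that(2,3)] bB[OF that(1,1)] by fastforce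
  have pair: "l t (w j) \<le> l t (w i) + B" if "i < n" "j < n" "i \<notin> I \<or> j \<in> I" "0 \<le> t" for i j t
    using b[OF that, of "w i"] coord_basis[OF w that(1,1)] bB[OF that(1,2)] by simp
  \<comment> \<open>\<open>- s t\<close> is the position of \<open>\<sigma> t\<close> along the line \<open>\<real> ind I\<close>.\<close>
  define s where "s t = l t (w j0) - l t (w i0)" for t
  have s_ge: "- B \<le> s t" if "0 \<le> t" for t
    using pair[OF j0(2) i0(2) _ that] i0(1) by (simp add: s_def)
  define x where "x t = pt w (\<lambda>i. - s t * ind I i)" for t
  have x: "x t \<in> building" "x t \<in> apartment w" for t
    unfolding x_def by (rule pt_building[OF w], rule pt(1)[OF w])
  let ?K = "sqrt (ipc * n) * (B + B)"
  have near: "d (\<sigma> t) (x t) \<le> ?K" if t: "0 \<le> t" for t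
  proof (rule dist_of_near[OF half_geodesicD(1)[OF \<sigma> t] x(1)])
    obtain C where C: "\<forall>i<n. wt w (x t) i = - s t * ind I i + C" unfolding x_def using pt(2)[OF w] by blast
    show "near (B + B) (pnorm (\<sigma> t)) (pnorm (x t))"
    proof (rule near_coordinates[OF pnorm_norm[OF half_geodesicD(1)[OF \<sigma> t]] pnorm_norm[OF x(1)] w])
      fix i assume i: "i < n"
      have "\<bar>l t (w i) - wt w (x t) i - (l t (w j0) - C)\<bar> \<le> B"
      proof (cases "i \<in> I")
        case True
        thus ?thesis
          using C i pair[OF i i0(2) _ t] pair[OF i0(2) i _ t] i0(1) by (simp add: ind_def s_def abs_le_iff)
      next
        case False
        thus ?thesis
          using C i pair[OF i j0(2) _ t] pair[OF j0(2) i _ t] j0(1) by (simp add: ind_def abs_le_iff)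
      qed
      thus "\<bar>log q (pnorm (\<sigma> t) (w i)) - log q (pnorm (x t) (w i)) - (l t (w j0) - C)\<bar> \<le> B"
        by (simp add: l_def wt_def)
    next
      fix a :: "nat \<Rightarrow> 'k" and i assume i: "i < n" "a i \<noteq> 0"
      let ?v = "\<Sum>i<n. a i *s w i"
      have "coord w ?v i = a i" by (rule coord_eqI[OF w refl i(1)])
      thus "log q (absv (a i)) + log q (pnorm (\<sigma> t) (w i)) \<le> log q (pnorm (\<sigma> t) ?v) + B"
        using coords[OF i(1) t, of ?v] i(2) by (simp add: l_def)
    qed (use apartment_adapted[OF w x(2)] B0 in auto)
    show "0 \<le> B + B" using B0 by simp
  qed
  let ?D = "d (\<sigma> 0) (pt w (\<lambda>i. 0 * ind I i))"
  have "d (\<sigma> t) (ray w I t) \<le> ?K + (?K + ?D + 2 * B / rate I)" if t: "0 \<le> t" for t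
  proof -
    note xt = x(1)[of t] and \<sigma>t = half_geodesicD(1)[OF \<sigma> t] and \<sigma>0 = half_geodesicD(1)[OF \<sigma> order_refl]
    let ?o = "pt w (\<lambda>i. 0 * ind I i)"
    have o: "?o \<in> building" by (rule pt_building[OF w])
    have r: "rate I > 0" by (rule rate_pos[OF I])
    have 1: "d ?o (x t) = \<bar>s t\<bar> / rate I" unfolding x_def dist_ind[OF w I] by simp
    have 2: "d (\<sigma> 0) (\<sigma> t) = t" using half_geodesicD(2)[OF \<sigma>, of 0 t] t by simp
    have "\<bar>\<bar>s t\<bar> / rate I - t\<bar> \<le> ?K + ?D"
      using dist_triangle[OF \<sigma>0 o xt] dist_triangle[OF \<sigma>0 xt \<sigma>t] dist_triangle[OF o \<sigma>0 xt]
        dist_triangle[OF \<sigma>0 \<sigma>t xt] near[OF t] 1 2 dist_commute[of "\<sigma> 0" ?o] dist_commute[of "\<sigma> t" "x t"]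
      by linarith
    moreover have "\<bar>s t / rate I - \<bar>s t\<bar> / rate I\<bar> \<le> 2 * B / rate I"
    proof -
      have "\<bar>s t - \<bar>s t\<bar>\<bar> \<le> 2 * B" using s_ge[OF t] B0 by linarith
      hence "\<bar>s t - \<bar>s t\<bar>\<bar> / rate I \<le> 2 * B / rate I" using r by (intro divide_right_mono) auto
      moreover have "\<bar>s t / rate I - \<bar>s t\<bar> / rate I\<bar> = \<bar>s t - \<bar>s t\<bar>\<bar> / rate I"
        using r by (simp add: diff_divide_distrib[symmetric])
      ultimately show ?thesis by simp
    qed
    ultimately have "\<bar>s t / rate I - t\<bar> \<le> ?K + ?D + 2 * B / rate I" by linarith
    moreover have "d (x t) (ray w I t) = \<bar>s t / rate I - t\<bar>"
    proof -
      have "d (x t) (ray w I t) = \<bar>- s t - - (t * rate I)\<bar> / rate I"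
        unfolding x_def ray_def by (rule dist_ind[OF w I])
      also have "\<dots> = \<bar>(- s t - - (t * rate I)) / rate I\<bar>" using r by simp
      also have "(- s t - - (t * rate I)) / rate I = - (s t / rate I - t)" using r by (simp add: field_simps)
      finally show ?thesis by simp
    qed
    ultimately show ?thesis
      using dist_triangle[OF \<sigma>t xt ray_building[OF w, of I t]] near[OF t] by linarith
  qed
  hence "ray w I \<in> boundary_class \<sigma>"
    unfolding in_boundary_class using ray_geodesic(2)[OF w I] by blast
  from boundary_class_eq[OF \<sigma> this] show ?thesis by simp
qed

lemma boundary_vertex_eq:
  assumes w: "is_basis w" and I: "proper I"
  shows "boundary_vertex (span (w ` I)) = boundary_class (ray w I)"
  unfolding boundary_vertex_def
proof (rule the_equality)
  show "boundary_class (ray w I) \<in> boundary \<and>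
      stabilizer_boundary (boundary_class (ray w I)) = stabilizer_subspace (span (w ` I))"
    using ray_geodesic(2)[OF w I] stabilizer_boundary_ray[OF w I] by (auto simp: boundary_def)
  show "y = boundary_class (ray w I)"
    if y: "y \<in> boundary \<and> stabilizer_boundary y = stabilizer_subspace (span (w ` I))" for y
  proof -
    obtain \<sigma> where "is_half_geodesic \<sigma>" "y = boundary_class \<sigma>" using y by (auto simp: boundary_def)
    thus ?thesis using boundary_class_determined[OF _ w I, of \<sigma>] y by simp
  qed
qed

section \<open>Connecting boundary vertices\<close>

lemma opposite_rays:
  assumes w: "is_basis w" and I: "proper I"
  shows "proper ({..<n} - I)" "ray w ({..<n} - I) t = ray w I (- t)"
proof -
  let ?J = "{..<n} - I"
  show J: "proper ?J" using I by (auto simp: proper_def)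
  have compl: "ind ?J i = - 1 * ind I i + 1" if "i < n" for i using that by (simp add: ind_def)
  have "nrm (ind ?J) = \<bar>- 1\<bar> * nrm (ind I)" by (rule nrm_affine) (rule compl)
  hence r: "rate ?J = rate I" by (simp add: rate_def)
  have "d (ray w ?J t) (ray w I (- t)) = \<bar>0\<bar> * nrm (ind I)"
    unfolding ray_def dist_pt[OF w] r
    by (rule nrm_affine[where c = "- (t * rate I)"]) (simp add: compl algebra_simps)
  thus "ray w ?J t = ray w I (- t)"
    using dist_zero[OF ray_building[OF w] ray_building[OF w]] by simp
qed

text \<open>The rays towards \<open>W\<close> and \<open>W'\<close> leave a common origin in an apartment in directions of unit
  vectors. A geodesic that connects their end points makes the distance of the rays grow like
  \<open>2 t\<close>, so the unit vectors have distance \<open>2\<close> and are opposite.\<close>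

lemma complementary_of_connected:
  assumes w: "is_basis w" and I: "proper I" and I': "proper I'" and \<gamma>: "is_geodesic \<gamma>"
    and mem: "\<gamma> \<in> boundary_class (ray w I)" "(\<lambda>t. \<gamma> (- t)) \<in> boundary_class (ray w I')"
  shows "I' = {..<n} - I"
proof -
  obtain C where C: "\<forall>t\<ge>0. d (ray w I t) (\<gamma> t) \<le> C" using mem(1) unfolding in_boundary_class by blast
  obtain C' where C': "\<forall>t\<ge>0. d (ray w I' t) (\<gamma> (- t)) \<le> C'" using mem(2) unfolding in_boundary_class by blast
  let ?u = "\<lambda>i. rate I * ind I i" and ?v = "\<lambda>i. rate I' * ind I' i"
  have \<gamma>b: "\<gamma> t \<in> building" for t using \<gamma> by (simp add: is_geodesic_def)
  have grow: "2 * t \<le> t * nrm (\<lambda>i. ?u i - ?v i) + (C + C')" if t: "0 \<le> t" for t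
  proof -
    have "2 * t = d (\<gamma> t) (\<gamma> (- t))" using \<gamma> t by (simp add: is_geodesic_def)
    also have "\<dots> \<le> d (\<gamma> t) (ray w I t) + d (ray w I t) (ray w I' t) + d (ray w I' t) (\<gamma> (- t))"
      using dist_triangle[OF \<gamma>b[of t] ray_building[OF w, of I t] \<gamma>b[of "- t"]]
        dist_triangle[OF ray_building[OF w, of I t] ray_building[OF w, of I' t] \<gamma>b[of "- t"]] by linarith
    also have "d (ray w I t) (ray w I' t) = \<bar>- t\<bar> * nrm (\<lambda>i. ?u i - ?v i)"
      unfolding ray_def dist_pt[OF w] by (rule nrm_affine[where c = 0]) (simp add: algebra_simps)
    also have "\<bar>- t\<bar> = t" using t by simp
    finally show ?thesis
      using C[rule_format, OF t] C'[rule_format, OF t] dist_commute[of "\<gamma> t" "ray w I t"] by linarith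
  qed
  have "2 \<le> nrm (\<lambda>i. ?u i - ?v i)"
  proof (rule ccontr)
    assume "\<not> ?thesis"
    hence e: "2 - nrm (\<lambda>i. ?u i - ?v i) > 0" by simp
    define t where "t = (\<bar>C + C'\<bar> + 1) / (2 - nrm (\<lambda>i. ?u i - ?v i))"
    have "0 \<le> t" using e by (simp add: t_def)
    from grow[OF this] have "t * (2 - nrm (\<lambda>i. ?u i - ?v i)) \<le> C + C'" by (simp add: algebra_simps)
    moreover have "t * (2 - nrm (\<lambda>i. ?u i - ?v i)) = \<bar>C + C'\<bar> + 1" using e by (simp add: t_def)
    ultimately show False by linarith
  qed
  hence "2\<^sup>2 \<le> (nrm (\<lambda>i. ?u i - ?v i))\<^sup>2" by (rule power_mono) simp
  hence far: "4 \<le> ip (\<lambda>i. ?u i - ?v i) (\<lambda>i. ?u i - ?v i)" by (simp add: nrm_square)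
  have unit: "ip (\<lambda>i. rate J * ind J i) (\<lambda>i. rate J * ind J i) = 1" if J: "proper J" for J
  proof -
    have "nrm (\<lambda>i. rate J * ind J i) = \<bar>rate J\<bar> * nrm (ind J)" by (rule nrm_affine[where c = 0]) simp
    also have "\<dots> = 1" using nrm_ind_pos[OF J] by (simp add: rate_def)
    finally show ?thesis using nrm_square[of "\<lambda>i. rate J * ind J i"] by simp
  qed
  define m where "m = (\<lambda>i. (1 - 1/2) * ?u i + 1/2 * ?v i)"
  have "ip m m \<le> 0"
    unfolding m_def ip_interpolate[of "1/2"] unit[OF I] unit[OF I'] using far by simp
  hence "nrm m = 0" using ip_nonneg[of m] by (simp add: nrm_def)
  hence const: "?u i + ?v i = ?u j + ?v j" if "i < n" "j < n" for i j
    using nrm_zero_imp_const[of m, OF _ that] by (simp add: m_def)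
  have r: "rate I > 0" "rate I' > 0" using rate_pos[OF I] rate_pos[OF I'] by auto
  have opp: "i \<notin> I' \<and> j \<in> I'" if ij: "i \<in> I" "i < n" "j \<notin> I" "j < n" for i j
    using const[OF ij(2,4)] ij(1,3) r by (auto simp: ind_def split: if_splits)
  obtain i0 j0 where ij0: "i0 \<in> I" "i0 < n" "j0 \<notin> I" "j0 < n" by (rule proper_obtain[OF I])
  have "I \<subseteq> {..<n}" "I' \<subseteq> {..<n}" using I I' by (auto simp: proper_def)
  thus ?thesis using opp[OF _ _ ij0(3,4)] opp[OF ij0(1,2)] by blast
qed

lemma connectable_iff_complementary:
  assumes w: "is_basis w" and I: "proper I" and I': "proper I'"
  shows "connectable (boundary_vertex (span (w ` I))) (boundary_vertex (span (w ` I'))) \<longleftrightarrow> I' = {..<n} - I"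
proof -
  have bd: "boundary_class (ray w J) \<in> boundary" if "proper J" for J
    using ray_geodesic(2)[OF w that] by (auto simp: boundary_def)
  have swap: "I' = {..<n} - I \<longleftrightarrow> I = {..<n} - I'" using I I' by (auto simp: proper_def)
  show ?thesis
    unfolding boundary_vertex_eq[OF w I] boundary_vertex_eq[OF w I'] connectable_def
  proof
    assume "\<exists>\<gamma>. is_geodesic \<gamma> \<and> connects \<gamma> (boundary_class (ray w I)) (boundary_class (ray w I'))"
    then obtain \<gamma> where \<gamma>: "is_geodesic \<gamma>" "connects \<gamma> (boundary_class (ray w I)) (boundary_class (ray w I'))"
      by blast
    from \<gamma>(2) show "I' = {..<n} - I"
      unfolding connects_iff[OF \<gamma>(1) bd[OF I] bd[OF I']]
      using complementary_of_connected[OF w I I' \<gamma>(1)] complementary_of_connected[OF w I' I \<gamma>(1)] swap by blast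
  next
    assume compl: "I' = {..<n} - I"
    have "(\<lambda>t. ray w I (- t)) = ray w I'"
      unfolding compl by (rule ext) (rule opposite_rays(2)[OF w I, symmetric])
    hence "connects (ray w I) (boundary_class (ray w I)) (boundary_class (ray w I'))"
      unfolding connects_iff[OF ray_geodesic(1)[OF w I] bd[OF I] bd[OF I']]
      using boundary_class_self[OF ray_geodesic(2)[OF w I]] boundary_class_self[OF ray_geodesic(2)[OF w I']]
      by simp
    thus "\<exists>\<gamma>. is_geodesic \<gamma> \<and> connects \<gamma> (boundary_class (ray w I)) (boundary_class (ray w I'))"
      using ray_geodesic(1)[OF w I] by blast
  qed
qed

lemma connectable_iff_direct_sum:
  assumes W: "subspace W" "W \<noteq> {0}" "W \<noteq> UNIV" and W': "subspace W'" "W' \<noteq> {0}" "W' \<noteq> UNIV"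
  shows "connectable (boundary_vertex W) (boundary_vertex W') \<longleftrightarrow>
    W \<inter> W' = {0} \<and> {u + u' | u u'. u \<in> W \<and> u' \<in> W'} = UNIV"
proof -
  obtain w I I' where w: "is_basis w" and I: "I \<subseteq> {..<n}" "W = span (w ` I)"
    and I': "I' \<subseteq> {..<n}" "W' = span (w ` I')"
    by (rule common_basis_of_subspaces[OF W(1) W'(1)])
  have "proper J" if "J \<subseteq> {..<n}" "span (w ` J) \<noteq> {0}" "span (w ` J) \<noteq> UNIV" for J
    using that w by (auto simp: proper_def is_basis_def)
  hence "proper I" "proper I'" using W(2,3) W'(2,3) I I' by blast+
  thus ?thesis
    unfolding I(2) I'(2) coordinate_subspaces_complementary[OF w I(1) I'(1)]
    by (rule connectable_iff_complementary[OF w])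
qed

end

theorem lemma2p3:
  fixes p n :: nat
    and Qp :: "'k::field_char_0 set" and absv :: "'k \<Rightarrow> real" and \<pi> :: 'k
    and scale :: "'k \<Rightarrow> 'v::ab_group_add \<Rightarrow> 'v"
    and ip :: "(nat \<Rightarrow> real) \<Rightarrow> (nat \<Rightarrow> real) \<Rightarrow> real"
    and d :: "('v set set \<Rightarrow> real) \<Rightarrow> ('v set set \<Rightarrow> real) \<Rightarrow> real"
    and W W' :: "'v set"
  assumes "metric_bruhat_tits_building p Qp absv scale \<pi> n ip d"
    and "module.subspace scale W" and "W \<noteq> {0}" and "W \<noteq> UNIV"
    and "module.subspace scale W'" and "W' \<noteq> {0}" and "W' \<noteq> UNIV"
  shows "metric_bruhat_tits_building.connectable absv scale \<pi> n d
           (metric_bruhat_tits_building.boundary_vertex absv scale \<pi> n d W)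
           (metric_bruhat_tits_building.boundary_vertex absv scale \<pi> n d W')
         \<longleftrightarrow> W \<inter> W' = {0} \<and> {w + w' | w w'. w \<in> W \<and> w' \<in> W'} = UNIV"
proof -
  interpret metric_bruhat_tits_building p Qp absv scale \<pi> n ip d by (rule assms(1))
  show ?thesis by (rule connectable_iff_direct_sum[OF assms(2-7)])
qed

end
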